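(* Let $K$ be an arbitrary number field. There are four arithmetically exceptional rational functions of degree $4$ over $K$, such that their composition is not arithmetically exceptional.
   Context: For a number field $K$ and a non-constant $f\in K(X)$, written as a quotient of coprime polynomials, for all but finitely many places $\mathfrak p$ of $K$ one can reduce the coefficients modulo $\mathfrak p$ to obtain $f_{\mathfrak p}\in K_{\mathfrak p}(X)$, $K_{\mathfrak p}$ the residue field, regarded as a map $\mathbb P^1(K_{\mathfrak p})\to\mathbb P^1(K_{\mathfrak p})$. $f$ is arithmetically exceptional if $f_{\mathfrak p}$ is bijective on $\mathbb P^1(K_{\mathfrak p})$ for infinitely many places $\mathfrak p$ of $K$. The degree of $f=R/S$ ($R,S$ coprime polynomials) is $\max(\deg R,\deg S)$. *)

theory Defs
  imports
    "HOL-Computational_Algebra.Computational_Algebra"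
    "HOL-Algebra.Algebraic_Closure_Type"
    "HOL-Algebra.QuotRing"
    "HOL-Algebra.Polynomial_Divisibility"
begin

text \<open>
  A number field is a type \<open>'k\<close> of characteristic 0 which is a finite-dimensional vector
  space over the rationals.
\<close>

definition number_field :: "'k::field_char_0 itself \<Rightarrow> bool" where
  "number_field _ \<longleftrightarrow>
     (\<exists>B. finite_dimensional_vector_space (\<lambda>(q::rat) (x::'k). of_rat q * x) B)"


text \<open>The field \<open>K(X)\<close> is the type \<open>'k poly fract\<close>.\<close>

definition lowest_terms :: "'k::field poly fract \<Rightarrow> 'k poly \<Rightarrow> 'k poly \<Rightarrow> bool" where
  "lowest_terms f R S \<longleftrightarrow>
     f = Fraction_Field.Fract R S \<and> Rings.coprime R S \<and> Polynomial.lead_coeff S = 1"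

lemma coprime_poly_bezout:
  fixes a b :: "'k::field poly"
  assumes "Rings.coprime a b" "b \<noteq> 0"
  obtains u v where "u * a + v * b = 1"
proof -
  define I where "I = {u * a + v * b | u v. True}"
  have I_add: "x - q * y \<in> I" if "x \<in> I" "y \<in> I" for x y q
  proof -
    from that obtain u v u' v' where "x = u * a + v * b" "y = u' * a + v' * b"
      by (auto simp: I_def)
    hence "x - q * y = (u - q * u') * a + (v - q * v') * b"
      by (simp add: algebra_simps)
    thus ?thesis unfolding I_def by blast
  qed
  have "a = 1 * a + 0 * b" "b = 0 * a + 1 * b" by simp_all
  hence a: "a \<in> I" and b: "b \<in> I"
    unfolding I_def by blast+
  obtain d where d: "d \<in> I" "d \<noteq> 0"
    and least: "\<And>x. x \<in> I \<Longrightarrow> x \<noteq> 0 \<Longrightarrow> Polynomial.degree d \<le> Polynomial.degree x"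
    using ex_has_least_nat[of "\<lambda>x. x \<in> I \<and> x \<noteq> 0" b Polynomial.degree] b assms(2) by metis
  have "d dvd x" if "x \<in> I" for x
  proof (rule ccontr)
    assume "\<not> d dvd x"
    hence nz: "x mod d \<noteq> 0" by (simp add: dvd_eq_mod_eq_0)
    have "x mod d = x - (x div d) * d"
      by (simp add: minus_div_mult_eq_mod)
    hence "x mod d \<in> I"
      using I_add[OF that d(1)] by simp
    with least nz degree_mod_less'[OF d(2) nz] show False
      by (meson leD)
  qed
  with a b have "d dvd a" "d dvd b" by auto
  hence "is_unit d"
    using assms(1) by (rule coprime_common_divisor[rotated])
  then obtain e where e: "1 = d * e" by blast
  obtain u v where "d = u * a + v * b"
    using d(1) unfolding I_def by blast
  hence "(e * u) * a + (e * v) * b = 1"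
    unfolding e by (simp add: algebra_simps)
  thus ?thesis by (rule that)
qed

lemma coprime_poly_dvd_mult:
  fixes a b c :: "'k::field poly"
  assumes "Rings.coprime a b" "b \<noteq> 0" "b dvd a * c"
  shows "b dvd c"
proof -
  obtain u v where uv: "u * a + v * b = 1"
    using assms(1,2) by (rule coprime_poly_bezout)
  have "c = (u * a + v * b) * c" by (simp add: uv)
  also have "\<dots> = u * (a * c) + b * (v * c)" by (simp add: algebra_simps)
  finally show ?thesis
    using assms(3) by (metis dvd_add dvd_mult dvd_triv_left)
qed

lemma lowest_terms_unique:
  assumes "lowest_terms f R S" "lowest_terms f R' S'"
  shows "R = R'" "S = S'"
proof -
  have nz: "S \<noteq> 0" "S' \<noteq> 0"
    using assms by (auto simp: lowest_terms_def)
  have eq: "R * S' = R' * S"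
    using assms nz by (simp add: lowest_terms_def Fraction_Field.eq_fract)
  have "S dvd R * S'" "S' dvd R' * S"
    by (metis dvd_triv_right eq, metis dvd_triv_right eq)
  hence dvd: "S dvd S'" "S' dvd S"
    using assms nz coprime_poly_dvd_mult unfolding lowest_terms_def by blast+
  then obtain c where c: "S' = S * c" by blast
  have "Polynomial.degree S = Polynomial.degree S'"
    using dvd nz by (simp add: dvd_imp_degree_le le_antisym)
  with c nz have "Polynomial.degree c = 0"
    by (auto simp: degree_mult_eq)
  then obtain a where a: "c = [:a:]" by (rule degree_eq_zeroE)
  have "a = 1"
    using assms c a by (cases "a = 0") (auto simp: lowest_terms_def)
  thus S: "S = S'" using c a by simp
  show "R = R'" using eq S nz by simp
qed

lemma lowest_terms_exists: "\<exists>R S. lowest_terms f R S"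
proof -
  define Q where
    "Q = (\<lambda>(a, b). f = Fraction_Field.Fract a b \<and> b \<noteq> 0)"
  obtain a0 b0 where "Q (a0, b0)"
    unfolding Q_def by (cases f) auto
  then obtain a b where ab: "Q (a, b)"
    and least: "\<And>a' b'. Q (a', b') \<Longrightarrow> Polynomial.degree b \<le> Polynomial.degree b'"
    using ex_has_least_nat[of Q _ "\<lambda>p. Polynomial.degree (snd p)"] by fastforce
  have f: "f = Fraction_Field.Fract a b" and b: "b \<noteq> 0"
    using ab by (auto simp: Q_def)
  have cop: "Rings.coprime a b"
  proof (rule coprimeI)
    fix d assume "d dvd a" "d dvd b"
    then obtain a' b' where d: "a = d * a'" "b = d * b'" by blast
    hence "d \<noteq> 0" "b' \<noteq> 0" using b by auto
    hence "Q (a', b')"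
      by (simp add: Q_def f d Fraction_Field.eq_fract)
    hence "Polynomial.degree b \<le> Polynomial.degree b'" by (rule least)
    hence "Polynomial.degree d = 0"
      using \<open>d \<noteq> 0\<close> \<open>b' \<noteq> 0\<close> by (simp add: d degree_mult_eq)
    thus "is_unit d"
      using \<open>d \<noteq> 0\<close> by (simp add: is_unit_iff_degree)
  qed
  define u where "u = [:inverse (Polynomial.lead_coeff b):]"
  have u: "is_unit u" "u \<noteq> 0"
    using b by (simp_all add: u_def is_unit_iff_degree)
  have "lowest_terms f (u * a) (u * b)"
    unfolding lowest_terms_def
  proof (intro conjI)
    show "f = Fraction_Field.Fract (u * a) (u * b)"
      using b u by (simp add: f Fraction_Field.eq_fract)
    show "Rings.coprime (u * a) (u * b)"
      using cop u by (simp add: is_unit_left_imp_coprime)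
    show "Polynomial.lead_coeff (u * b) = 1"
      using b by (simp add: u_def lead_coeff_mult)
  qed
  thus ?thesis by blast
qed

definition num_den :: "'k::field poly fract \<Rightarrow> 'k poly \<times> 'k poly" where
  "num_den f = (THE (R, S). lowest_terms f R S)"

lemma num_den_eq_iff: "num_den f = (R, S) \<longleftrightarrow> lowest_terms f R S"
proof -
  obtain R' S' where 1: "lowest_terms f R' S'"
    using lowest_terms_exists by blast
  have "num_den f = (R', S')"
    unfolding num_den_def
  proof (rule the_equality)
    show "case (R', S') of (R, S) \<Rightarrow> lowest_terms f R S"
      using 1 by simp
    show "p = (R', S')" if "case p of (R, S) \<Rightarrow> lowest_terms f R S" for p
      using that 1 by (cases p) (simp add: lowest_terms_unique)
  qed
  with 1 show ?thesis
    by (metis lowest_terms_unique prod.inject)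
qed

definition rat_degree :: "'k::field poly fract \<Rightarrow> nat" where
  "rat_degree f = (case num_den f of (R, S) \<Rightarrow> max (Polynomial.degree R) (Polynomial.degree S))"

text \<open>
  Composition \<open>f \<circ> g\<close> substitutes \<open>g\<close> for \<open>X\<close> in \<open>f = R / S\<close>.  For non-constant \<open>g\<close> one has
  \<open>S(g) \<noteq> 0\<close>, so the division is a genuine one.
\<close>

definition poly_subst :: "'k::field poly \<Rightarrow> 'k poly fract \<Rightarrow> 'k poly fract" where
  "poly_subst p g = poly (map_poly (\<lambda>c. Fraction_Field.Fract [:c:] 1) p) g"

definition rat_compose :: "'k::field poly fract \<Rightarrow> 'k poly fract \<Rightarrow> 'k poly fract"
    (infixr \<open>\<circ>\<^sub>r\<close> 55) where
  "f \<circ>\<^sub>r g = (case num_den f of (R, S) \<Rightarrow> poly_subst R g / poly_subst S g)"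


text \<open>
  Places with a residue field to reduce to are the finite ones, i.e. the nonzero prime ideals
  of the ring of integers; the finitely many archimedean places play no role.
\<close>

definition integer_ring :: "'k::field_char_0 ring" where
  "integer_ring = ring_of_type_algebra \<lparr> carrier := {x. algebraic_int x} \<rparr>"

definition finite_places :: "'k::field_char_0 set set" where
  "finite_places = {P. primeideal P integer_ring \<and> P \<noteq> {0}}"

definition local_ring :: "'k::field_char_0 set \<Rightarrow> 'k ring" where
  "local_ring P = ring_of_type_algebra
     \<lparr> carrier := {a / b | a b. algebraic_int a \<and> algebraic_int b \<and> b \<notin> P} \<rparr>"

definition local_max_ideal :: "'k::field_char_0 set \<Rightarrow> 'k set" where
  "local_max_ideal P = {a / b | a b. a \<in> P \<and> algebraic_int b \<and> b \<notin> P}"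

definition residue_field :: "'k::field_char_0 set \<Rightarrow> 'k set ring" where
  "residue_field P = local_ring P Quot local_max_ideal P"

definition residue :: "'k::field_char_0 set \<Rightarrow> 'k \<Rightarrow> 'k set" where
  "residue P x = local_max_ideal P +>\<^bsub>local_ring P\<^esub> x"


text \<open>
  Polynomials over a ring structure are the coefficient lists of \<open>HOL-Algebra\<close>, highest
  coefficient first and without leading zeros.
\<close>

definition pcoprime :: "('a, 'b) ring_scheme \<Rightarrow> 'a list \<Rightarrow> 'a list \<Rightarrow> bool" where
  "pcoprime F r s \<longleftrightarrow>
     (\<forall>d \<in> carrier (poly_ring F).
        d pdivides\<^bsub>F\<^esub> r \<and> d pdivides\<^bsub>F\<^esub> s \<longrightarrow> d \<in> Units (poly_ring F))"

text \<open>The point at infinity is \<^const>\<open>None\<close>.\<close>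

definition proj_line :: "('a, 'b) ring_scheme \<Rightarrow> 'a option set" where
  "proj_line F = insert None (Some ` carrier F)"

definition proj_ratio :: "('a, 'b) ring_scheme \<Rightarrow> 'a \<Rightarrow> 'a \<Rightarrow> 'a option" where
  "proj_ratio F a b = (if b = \<zero>\<^bsub>F\<^esub> then None else Some (a \<otimes>\<^bsub>F\<^esub> inv\<^bsub>F\<^esub> b))"

text \<open>
  The map on the projective line given by \<open>r / s\<close>, for coprime \<open>r\<close> and \<open>s\<close>.  After homogenising
  both to degree \<open>n = max (deg r) (deg s)\<close>, infinity \<open>(1 : 0)\<close> goes to \<open>(r\<^sub>n : s\<^sub>n)\<close>.
\<close>

fun proj_map :: "('a, 'b) ring_scheme \<Rightarrow> 'a list \<Rightarrow> 'a list \<Rightarrow> 'a option \<Rightarrow> 'a option" where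
  "proj_map F r s (Some x) = proj_ratio F (ring.eval F r x) (ring.eval F s x)"
| "proj_map F r s None =
     (let n = max (Polynomials.degree r) (Polynomials.degree s)
      in proj_ratio F (ring.coeff F r n) (ring.coeff F s n))"


definition reduce_poly :: "'k::field_char_0 set \<Rightarrow> 'k poly \<Rightarrow> 'k set list" where
  "reduce_poly P p = ring.normalize (residue_field P) (map (residue P) (rev (coeffs p)))"

text \<open>
  The reduction of \<open>f = R / S\<close> is used only where the coefficients are integral at \<open>P\<close> and the
  reduced numerator and denominator are still coprime of the same degree as \<open>f\<close>; this excludes
  only finitely many places.
\<close>

definition good_reduction :: "'k::field_char_0 set \<Rightarrow> 'k poly fract \<Rightarrow> bool" where
  "good_reduction P f \<longleftrightarrow>
     (case num_den f of (R, S) \<Rightarrow>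
        (\<forall>i. Polynomial.coeff R i \<in> carrier (local_ring P)) \<and>
        (\<forall>i. Polynomial.coeff S i \<in> carrier (local_ring P)) \<and>
        pcoprime (residue_field P) (reduce_poly P R) (reduce_poly P S) \<and>
        max (Polynomials.degree (reduce_poly P R)) (Polynomials.degree (reduce_poly P S))
          = rat_degree f)"

definition reduced_map ::
    "'k::field_char_0 set \<Rightarrow> 'k poly fract \<Rightarrow> 'k set option \<Rightarrow> 'k set option" where
  "reduced_map P f =
     (case num_den f of (R, S) \<Rightarrow>
        proj_map (residue_field P) (reduce_poly P R) (reduce_poly P S))"

definition arithmetically_exceptional :: "'k::field_char_0 poly fract \<Rightarrow> bool" where
  "arithmetically_exceptional f \<longleftrightarrow>
     infinite {P \<in> finite_places. good_reduction P f \<and>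
       bij_betw (reduced_map P f) (proj_line (residue_field P)) (proj_line (residue_field P))}"

end

(*
  The maps are the x-coordinate maps of multiplication by 2 on curves y^2 = x^3 + A x + B. Modulo a
  prime p such a map permutes the projective line over F_p exactly when the cubic has no root in F_p.
  For primes l1, l2 = 1 mod 3 with cubic Gauss sums g1, g2 take the cubics with roots
  2 Re(omega^k gamma), where gamma is one of g1, g2, g1 g2, g1^2 g2. Frobenius at p shifts k by a
  combination s1, s2, s1 + s2, 2 s1 + s2 of the cubic indices of p modulo l1 and l2. One of these
  vanishes in Z/3, so that modulo every large p one of the four maps identifies two F_p-points and
  the composition is not bijective.

  For a single map one needs infinitely many places of K of degree one over primes p with nonzero
  shift. Let G be the minimal polynomial of an integral generator of K(omega). Almost all primes
  dividing a value of G carry a place of degree one and are 1 mod 3; l1 and l2 are chosen among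
  them. As G has a simple root t0 modulo l1, the quotient G(t)/l1 takes every residue modulo l1 for
  t = t0 mod l1, and a value of nonzero index has a prime factor of nonzero index.
*)

theory Submission
  imports Defs "Jordan_Normal_Form.Char_Poly" "HOL-Number_Theory.Number_Theory" "HOL-Library.Real_Mod"
begin

section \<open>Sums and products of algebraic integers\<close>

text \<open>For odd p, x in F_p is the x-coordinate of a point, unique up to sign, on the curve or
  on its quadratic twist. If the cubic has no root, both groups have odd order and doubling permutes
  them; a root e gives a point (e, 0) that doubles to infinity, as infinity itself does. The proof
  below uses explicit identities in place of these groups. The cubics must be cyclic, so that a
  nonzero Frobenius shift excludes every root. Gauss sums provide this: gamma^3 lies in Z[omega] and
  gamma times its conjugate is an integer, hence the cubic is integral and the product of its root
  differences is an integer too. Four maps occur because the shifts s1, s2, s1 + s2, 2 s1 + s2 are,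
  up to scaling, all nonzero linear forms on (Z/3)^2, and every vector is a zero of one of them. The
  obstacle is that K is arbitrary. If K contained a root of the cubic, every large place of degree
  one would see a root. Taking l1 and l2 unramified in K(omega) prevents this, and prescribing
  G(t)/l1 modulo l1 makes the independence explicit without a density theorem.\<close>

definition zspan :: "(nat \<Rightarrow> 'a::comm_ring_1) \<Rightarrow> nat \<Rightarrow> 'a set" where
  "zspan v n = {(\<Sum>k<n. of_int (c k) * v k) | c. True}"

lemma zspanI: "x = (\<Sum>k<n. of_int (c k) * v k) \<Longrightarrow> x \<in> zspan v n"
  unfolding zspan_def by blast

lemma zspan_0: "0 \<in> zspan v n"
  unfolding zspan_def by (intro CollectI exI[of _ "\<lambda>_. 0"]) simp

lemma zspan_add: "x \<in> zspan v n \<Longrightarrow> y \<in> zspan v n \<Longrightarrow> x + y \<in> zspan v n"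
proof -
  assume "x \<in> zspan v n" "y \<in> zspan v n"
  then obtain c d where "x = (\<Sum>k<n. of_int (c k) * v k)" "y = (\<Sum>k<n. of_int (d k) * v k)"
    unfolding zspan_def by blast
  hence "x + y = (\<Sum>k<n. of_int (c k + d k) * v k)"
    by (simp add: sum.distrib algebra_simps)
  thus ?thesis by (rule zspanI)
qed

lemma zspan_smult: "x \<in> zspan v n \<Longrightarrow> of_int m * x \<in> zspan v n"
proof -
  assume "x \<in> zspan v n"
  then obtain c where "x = (\<Sum>k<n. of_int (c k) * v k)"
    unfolding zspan_def by blast
  hence "of_int m * x = (\<Sum>k<n. of_int (m * c k) * v k)"
    by (simp add: sum_distrib_left algebra_simps)
  thus ?thesis by (rule zspanI)
qed

lemma zspan_sum: "(\<And>i. i \<in> I \<Longrightarrow> f i \<in> zspan v n) \<Longrightarrow> sum f I \<in> zspan v n"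
  by (induction I rule: infinite_finite_induct) (auto intro: zspan_0 zspan_add)

lemma zspan_base: "k < n \<Longrightarrow> v k \<in> zspan v n"
  by (rule zspanI[where c = "\<lambda>i. if i = k then 1 else 0"])
     (simp add: if_distrib[of of_int] if_distrib[of "\<lambda>x. x * _"] cong: if_cong)

lemma zspan_mult_closed:
  assumes "\<And>k. k < n \<Longrightarrow> z * v k \<in> zspan v n" "x \<in> zspan v n"
  shows "z * x \<in> zspan v n"
proof -
  obtain c where "x = (\<Sum>k<n. of_int (c k) * v k)"
    using assms(2) unfolding zspan_def by blast
  hence "z * x = (\<Sum>k<n. of_int (c k) * (z * v k))"
    by (simp add: sum_distrib_left algebra_simps)
  thus ?thesis using assms(1) by (auto intro!: zspan_sum zspan_smult)
qed

text \<open>The characteristic polynomial of the integer matrix of multiplication by \<open>z\<close> annihilates \<open>z\<close>.\<close>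

lemma algebraic_int_if_zspan_stable:
  fixes z :: "'a::field_char_0"
  assumes st: "\<And>k. k < n \<Longrightarrow> z * v k \<in> zspan v n" and nz: "k0 < n" "v k0 \<noteq> 0"
  shows "algebraic_int z"
proof -
  have "\<exists>c. z * v k = (\<Sum>l<n. of_int (c l) * v l)" if "k < n" for k
    using st[OF that] unfolding zspan_def by blast
  then obtain c where c: "\<And>k. k < n \<Longrightarrow> z * v k = (\<Sum>l<n. of_int (c k l) * v l)"
    by metis
  define A :: "int mat" where "A = mat n n (\<lambda>(k, l). c k l)"
  define A' :: "'a mat" where "A' = map_mat of_int A"
  have A: "A \<in> carrier_mat n n" and A': "A' \<in> carrier_mat n n"
    by (auto simp: A_def A'_def)
  have ev: "eigenvector A' (vec n v) z"
    unfolding eigenvector_def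
  proof (intro conjI)
    show "vec n v \<in> carrier_vec (dim_row A')" using A' by auto
    have "vec n v $ k0 \<noteq> 0\<^sub>v n $ k0" using nz by simp
    thus "vec n v \<noteq> 0\<^sub>v (dim_row A')" using A' by auto
    show "A' *\<^sub>v vec n v = z \<cdot>\<^sub>v vec n v"
      by (rule eq_vecI)
         (auto simp: A'_def A_def scalar_prod_def c atLeast0LessThan)
  qed
  hence "eigenvalue A' z" unfolding eigenvalue_def by blast
  hence 0: "poly (char_poly A') z = 0"
    using eigenvalue_root_char_poly[OF A'] by simp
  have "char_poly A' = map_poly of_int (char_poly A)"
    unfolding A'_def by (rule of_int_hom.char_poly_hom[OF A])
  with 0 have "poly (map_poly of_int (char_poly A)) z = 0" by simp
  moreover have "Polynomial.lead_coeff (char_poly A) = 1"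
    using degree_monic_char_poly[OF A] by (simp add: monic_degree_0)
  ultimately show ?thesis
    unfolding algebraic_int_altdef_ipoly by (intro exI[of _ "char_poly A"]) auto
qed

lemma algebraic_int_zspan_powers:
  fixes x :: "'a::field_char_0"
  assumes "algebraic_int x"
  obtains n where "n > 0" "x ^ n \<in> zspan (\<lambda>i. x ^ i) n"
proof -
  obtain p :: "int poly" where p: "poly (map_poly of_int p) x = 0" "Polynomial.lead_coeff p = 1"
    using assms unfolding algebraic_int_altdef_ipoly by blast
  define n where "n = Polynomial.degree p"
  have "n > 0"
  proof (rule ccontr)
    assume "\<not> n > 0"
    then obtain c where "p = [:c:]" unfolding n_def by (metis degree_eq_zeroE gr0I)
    with p show False by (simp add: map_poly_pCons)
  qed
  have "0 = (\<Sum>i\<le>n. of_int (Polynomial.coeff p i) * x ^ i)"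
    using p(1) by (simp add: poly_altdef n_def coeff_map_poly)
  also have "\<dots> = (\<Sum>i<n. of_int (Polynomial.coeff p i) * x ^ i) + x ^ n"
    using p(2) by (simp add: n_def lessThan_Suc_atMost[symmetric])
  finally have "x ^ n = (\<Sum>i<n. of_int (- Polynomial.coeff p i) * x ^ i)"
    by (simp add: sum_negf eq_neg_iff_add_eq_0 add.commute)
  hence "x ^ n \<in> zspan (\<lambda>i. x ^ i) n" by (rule zspanI)
  with \<open>n > 0\<close> show ?thesis by (rule that)
qed

text \<open>The products x^i y^j with i < a and j < b span the ring generated by x and y over the
  integers, which is stable under both; \<open>div\<close> and \<open>mod\<close> by b list these
  products in one sequence.\<close>

lemma algebraic_int_common_zspan:
  fixes x y :: "'a::field_char_0"
  assumes "algebraic_int x" "algebraic_int y"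
  obtains v n where "n > 0" "v 0 = 1" "\<And>k. k < n \<Longrightarrow> x * v k \<in> zspan v n" "\<And>k. k < n \<Longrightarrow> y * v k \<in> zspan v n"
proof -
  obtain a where a: "a > 0" "x ^ a \<in> zspan (\<lambda>i. x ^ i) a"
    using algebraic_int_zspan_powers[OF assms(1)] by blast
  obtain b where b: "b > 0" "y ^ b \<in> zspan (\<lambda>i. y ^ i) b"
    using algebraic_int_zspan_powers[OF assms(2)] by blast
  define v where "v = (\<lambda>k. x ^ (k div b) * y ^ (k mod b))"
  have base: "x ^ i * y ^ j \<in> zspan v (a * b)" if "i < a" "j < b" for i j
  proof -
    have "i * b + j < Suc i * b" using that by simp
    also have "\<dots> \<le> a * b" using that by (intro mult_le_mono1) simp
    finally have "i * b + j < a * b" .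
    from zspan_base[OF this, of v] show ?thesis
      using that by (simp add: v_def)
  qed
  have powx: "x ^ i * y ^ j \<in> zspan v (a * b)" if "i \<le> a" "j < b" for i j
  proof (cases "i = a")
    case True
    obtain c where "x ^ a = (\<Sum>k<a. of_int (c k) * x ^ k)"
      using a(2) unfolding zspan_def by blast
    hence "x ^ a * y ^ j = (\<Sum>k<a. of_int (c k) * (x ^ k * y ^ j))"
      by (simp add: sum_distrib_right mult.assoc)
    thus ?thesis using True base that by (auto intro!: zspan_sum zspan_smult)
  qed (use base that in auto)
  have powy: "x ^ i * y ^ j \<in> zspan v (a * b)" if "i < a" "j \<le> b" for i j
  proof (cases "j = b")
    case True
    obtain c where "y ^ b = (\<Sum>k<b. of_int (c k) * y ^ k)"
      using b(2) unfolding zspan_def by blast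
    hence "x ^ i * y ^ b = (\<Sum>k<b. of_int (c k) * (x ^ i * y ^ k))"
      by (simp add: sum_distrib_left algebra_simps)
    thus ?thesis using True base that by (auto intro!: zspan_sum zspan_smult)
  qed (use base that in auto)
  show ?thesis
  proof (rule that[of "a * b" v])
    show "a * b > 0" "v 0 = 1" using a b by (auto simp: v_def)
    fix k assume k: "k < a * b"
    hence kk: "k div b < a" "k mod b < b"
      using b(1) by (auto simp: less_mult_imp_div_less)
    have e: "x * v k = x ^ Suc (k div b) * y ^ (k mod b)" "y * v k = x ^ (k div b) * y ^ Suc (k mod b)"
      by (simp_all add: v_def algebra_simps)
    show "x * v k \<in> zspan v (a * b)" "y * v k \<in> zspan v (a * b)"
      unfolding e using kk by (intro powx powy; simp)+
  qed
qed

lemma algebraic_int_add: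
  fixes x y :: "'a::field_char_0"
  assumes "algebraic_int x" "algebraic_int y"
  shows "algebraic_int (x + y)"
proof -
  obtain v n where v: "n > 0" "v 0 = (1::'a)" "\<And>k. k < n \<Longrightarrow> x * v k \<in> zspan v n" "\<And>k. k < n \<Longrightarrow> y * v k \<in> zspan v n"
    using algebraic_int_common_zspan[OF assms] by metis
  show ?thesis
    by (rule algebraic_int_if_zspan_stable[of n _ v 0]) (use v in \<open>auto simp: distrib_right intro!: zspan_add\<close>)
qed

lemma algebraic_int_mult:
  fixes x y :: "'a::field_char_0"
  assumes "algebraic_int x" "algebraic_int y"
  shows "algebraic_int (x * y)"
proof -
  obtain v n where v: "n > 0" "v 0 = (1::'a)" "\<And>k. k < n \<Longrightarrow> x * v k \<in> zspan v n" "\<And>k. k < n \<Longrightarrow> y * v k \<in> zspan v n"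
    using algebraic_int_common_zspan[OF assms] by metis
  show ?thesis
    by (rule algebraic_int_if_zspan_stable[of n _ v 0]) (use v zspan_mult_closed[of n x v] in \<open>auto simp: mult.assoc\<close>)
qed

lemma algebraic_int_of_int [simp, intro]: "algebraic_int (of_int n :: 'a::field_char_0)"
  by (rule int_imp_algebraic_int) auto

lemma algebraic_int_of_nat [simp, intro]: "algebraic_int (of_nat n :: 'a::field_char_0)"
  by (rule int_imp_algebraic_int) auto

lemma algebraic_int_1 [simp, intro]: "algebraic_int (1 :: 'a::field_char_0)"
  by (rule int_imp_algebraic_int) auto

lemma algebraic_int_diff:
  fixes x y :: "'a::field_char_0"
  shows "algebraic_int x \<Longrightarrow> algebraic_int y \<Longrightarrow> algebraic_int (x - y)"
  using algebraic_int_add[of x "-y"] by simp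

lemma algebraic_int_power:
  fixes x :: "'a::field_char_0"
  shows "algebraic_int x \<Longrightarrow> algebraic_int (x ^ n)"
  by (induction n) (auto intro: algebraic_int_mult)

lemma algebraic_int_sum:
  fixes f :: "'b \<Rightarrow> 'a::field_char_0"
  shows "(\<And>i. i \<in> I \<Longrightarrow> algebraic_int (f i)) \<Longrightarrow> algebraic_int (sum f I)"
  by (induction I rule: infinite_finite_induct) (auto intro: algebraic_int_add)

lemma algebraic_int_prod:
  fixes f :: "'b \<Rightarrow> 'a::field_char_0"
  shows "(\<And>i. i \<in> I \<Longrightarrow> algebraic_int (f i)) \<Longrightarrow> algebraic_int (prod f I)"
  by (induction I rule: infinite_finite_induct) (auto intro: algebraic_int_mult)

lemmas algebraic_int_intros =
  algebraic_int_add algebraic_int_diff algebraic_int_mult algebraic_int_power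
  algebraic_int_sum algebraic_int_prod algebraic_int_of_int algebraic_int_of_nat algebraic_int_1

section \<open>Congruences between algebraic integers\<close>

text \<open>The modulus is taken in the ring of all complex algebraic integers, so that roots of
  unity of every order can be mixed without fixing a field. This ring modulo p is far from a domain,
  which shapes the later arguments.\<close>

definition acong :: "nat \<Rightarrow> complex \<Rightarrow> complex \<Rightarrow> bool" where
  "acong p a b \<longleftrightarrow> (\<exists>c. algebraic_int c \<and> a - b = of_nat p * c)"

lemma acong_refl [simp, intro]: "acong p a a"
  unfolding acong_def by (intro exI[of _ 0]) auto

lemma acong_sym: "acong p a b \<Longrightarrow> acong p b a"
  unfolding acong_def by (metis algebraic_int_minus minus_diff_eq mult_minus_right)

lemma acong_add: "acong p a b \<Longrightarrow> acong p c d \<Longrightarrow> acong p (a + c) (b + d)"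
  unfolding acong_def
proof (elim exE conjE)
  fix x y assume "algebraic_int x" "a - b = of_nat p * x" "algebraic_int y" "c - d = of_nat p * y"
  thus "\<exists>z. algebraic_int z \<and> a + c - (b + d) = of_nat p * z"
    by (intro exI[of _ "x + y"]) (auto intro: algebraic_int_add simp: algebra_simps)
qed

lemma acong_trans [trans]: "acong p a b \<Longrightarrow> acong p b c \<Longrightarrow> acong p a c"
  using acong_add[of p a b b c] unfolding acong_def by simp

lemma acong_minus: "acong p a b \<Longrightarrow> acong p (- a) (- b)"
  unfolding acong_def
  by (metis algebraic_int_minus minus_diff_eq mult_minus_right minus_diff_minus)

lemma acong_diff: "acong p a b \<Longrightarrow> acong p c d \<Longrightarrow> acong p (a - c) (b - d)"
  using acong_add[OF _ acong_minus, of p a b c d] by simp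

lemma acong_mult_left: "acong p a b \<Longrightarrow> algebraic_int c \<Longrightarrow> acong p (c * a) (c * b)"
  unfolding acong_def
proof (elim exE conjE)
  fix x assume "algebraic_int x" "a - b = of_nat p * x" "algebraic_int c"
  thus "\<exists>z. algebraic_int z \<and> c * a - c * b = of_nat p * z"
    by (intro exI[of _ "c * x"]) (auto intro: algebraic_int_mult simp: algebra_simps simp flip: right_diff_distrib)
qed

lemma acong_mult:
  assumes "acong p a b" "acong p c d" "algebraic_int a" "algebraic_int d"
  shows "acong p (a * c) (b * d)"
  using acong_trans[OF acong_mult_left[OF assms(2,3)], of "b * d"] acong_mult_left[OF assms(1,4)]
  by (simp add: mult.commute)

lemma acong_power:
  assumes "acong p a b" "algebraic_int a" "algebraic_int b"
  shows "acong p (a ^ n) (b ^ n)"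
  by (induction n) (use assms in \<open>auto intro!: acong_mult algebraic_int_power\<close>)

lemma acong_sum: "(\<And>i. i \<in> I \<Longrightarrow> acong p (f i) (g i)) \<Longrightarrow> acong p (sum f I) (sum g I)"
  by (induction I rule: infinite_finite_induct) (auto intro: acong_add)

lemma acong_cnj: "acong p a b \<Longrightarrow> acong p (cnj a) (cnj b)"
  unfolding acong_def
  by (metis algebraic_int_cnj complex_cnj_diff complex_cnj_mult complex_cnj_of_nat)

lemma acong_0_multiple: "algebraic_int c \<Longrightarrow> acong p (of_nat p * c) 0"
  unfolding acong_def by auto

text \<open>The way back to the integers: a / p is rational and an algebraic integer, hence an
  integer.\<close>

lemma acong_of_int_0_imp_dvd:
  assumes "acong p (of_int a) 0" "p > 0"
  shows "int p dvd a"
proof -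
  obtain c where c: "algebraic_int c" "(of_int a :: complex) = of_nat p * c"
    using assms(1) unfolding acong_def by auto
  have "c = of_rat (of_int a / of_nat p)"
    using c(2) assms(2) by (simp add: of_rat_divide field_simps)
  hence "c \<in> \<int>"
    using c(1) rational_algebraic_int_is_int Rats_of_rat by metis
  then obtain k where "c = of_int k" by (elim Ints_cases)
  with c(2) have "(of_int a :: complex) = of_int (int p * k)" by simp
  hence "a = int p * k" by (simp only: of_int_eq_iff)
  thus ?thesis by simp
qed

lemma acong_freshman:
  assumes p: "prime p" and a: "algebraic_int a" and b: "algebraic_int b"
  shows "acong p ((a + b) ^ p) (a ^ p + b ^ p)"
proof -
  have "p > 0" using p by (rule prime_gt_0_nat)
  have split: "{..p} = insert 0 (insert p {0<..<p})" using \<open>p > 0\<close> by auto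
  have "(a + b) ^ p = (\<Sum>k\<le>p. of_nat (p choose k) * a ^ k * b ^ (p - k))"
    by (rule binomial_ring)
  also have "\<dots> = (a ^ p + b ^ p) + (\<Sum>k\<in>{0<..<p}. of_nat (p choose k) * a ^ k * b ^ (p - k))"
    unfolding split using \<open>p > 0\<close> by simp
  finally have eq: "(a + b) ^ p = \<dots>" .
  have "acong p (\<Sum>k\<in>{0<..<p}. of_nat (p choose k) * a ^ k * b ^ (p - k)) (\<Sum>k\<in>{0<..<p}. 0)"
  proof (rule acong_sum)
    fix k assume "k \<in> {0<..<p}"
    hence "p dvd (p choose k)" using dvd_choose_prime[of k p] p by auto
    then obtain m where "p choose k = p * m" by blast
    hence "of_nat (p choose k) * a ^ k * b ^ (p - k) = of_nat p * (of_nat m * a ^ k * b ^ (p - k))"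
      by simp
    moreover have "acong p (of_nat p * (of_nat m * a ^ k * b ^ (p - k))) 0"
      using a b by (intro acong_0_multiple algebraic_int_intros)
    ultimately show "acong p (of_nat (p choose k) * a ^ k * b ^ (p - k)) 0" by (simp only:)
  qed
  hence "acong p (\<Sum>k\<in>{0<..<p}. of_nat (p choose k) * a ^ k * b ^ (p - k)) 0" by simp
  from acong_add[OF acong_refl this, of "a ^ p + b ^ p"] show ?thesis unfolding eq by simp
qed

lemma acong_freshman_sum:
  assumes p: "prime p" and f: "\<And>i. i \<in> I \<Longrightarrow> algebraic_int (f i)"
  shows "acong p ((\<Sum>i\<in>I. f i) ^ p) (\<Sum>i\<in>I. f i ^ p)"
  using f
proof (induction I rule: infinite_finite_induct)
  case (insert x F)
  have "acong p ((f x + (\<Sum>i\<in>F. f i)) ^ p) (f x ^ p + (\<Sum>i\<in>F. f i) ^ p)"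
    using insert by (intro acong_freshman p algebraic_int_sum) auto
  also have "acong p \<dots> (f x ^ p + (\<Sum>i\<in>F. f i ^ p))"
    using insert by (intro acong_add) auto
  finally show ?case using insert by simp
qed (use prime_gt_0_nat[OF p] in \<open>auto simp: zero_power\<close>)

section \<open>Cube roots of unity and Eisenstein integers\<close>

definition omega :: complex where "omega = cis (2 * pi / 3)"

lemma omega_cube: "omega ^ 3 = 1"
  by (simp add: omega_def DeMoivre)

lemma omega_neq_1: "omega \<noteq> 1"
proof
  assume "omega = 1"
  then obtain n :: int where "2 * pi / 3 = of_int n * (2 * pi)"
    unfolding omega_def cis_eq_1_iff by blast
  hence "1 = 3 * real_of_int n" by simp
  hence "1 = 3 * n" by linarith
  thus False by presburger
qed

lemma omega_quadratic: "omega\<^sup>2 + omega + 1 = 0"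
proof -
  have "(omega - 1) * (omega\<^sup>2 + omega + 1) = omega ^ 3 - 1"
    by (simp add: algebra_simps power2_eq_square power3_eq_cube)
  thus ?thesis using omega_cube omega_neq_1 by simp
qed

lemma omega_sq: "omega\<^sup>2 = - 1 - omega"
  using omega_quadratic by (simp add: algebra_simps add_eq_0_iff)

lemma cnj_omega: "cnj omega = omega\<^sup>2"
proof -
  have "omega * cnj omega = 1" by (simp add: omega_def cis_cnj cis_mult)
  moreover have "omega * omega\<^sup>2 = 1" using omega_cube by (simp add: power3_eq_cube power2_eq_square mult.assoc)
  moreover have "omega \<noteq> 0" by (simp add: omega_def)
  ultimately show ?thesis by (metis mult_left_cancel)
qed

lemma algebraic_int_cis_root:
  assumes "z ^ n = 1" "n > 0"
  shows "algebraic_int (z :: complex)"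
  by (rule algebraic_int_root[of 1 "Polynomial.monom 1 n"])
     (use assms in \<open>auto simp: poly_monom Polynomial.degree_monom_eq\<close>)

lemma algebraic_int_omega [simp, intro]: "algebraic_int omega"
  using omega_cube by (rule algebraic_int_cis_root) simp

lemma omega_power_mod: "omega ^ k = omega ^ (k mod 3)"
proof -
  have "omega ^ k = omega ^ (3 * (k div 3) + k mod 3)" by simp
  also have "\<dots> = omega ^ (k mod 3)" unfolding power_add power_mult omega_cube by simp
  finally show ?thesis .
qed

lemma omega_power_cong: "[j = k] (mod 3) \<Longrightarrow> omega ^ j = omega ^ k"
  by (metis omega_power_mod cong_def)

lemma sum_shift_periodic:
  fixes f :: "nat \<Rightarrow> 'a::ab_group_add"
  assumes "\<And>k. f (k + n) = f k"
  shows "(\<Sum>k<n. f (k + d)) = (\<Sum>k<n. f k)"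
proof (induction d)
  case (Suc d)
  have "(\<Sum>k<n. f (Suc k + d)) + f d = (\<Sum>k<Suc n. f (k + d))"
    by (subst sum.lessThan_Suc_shift) (simp add: add.commute)
  also have "\<dots> = (\<Sum>k<n. f (k + d)) + f d"
    using assms[of d] by (simp add: add.commute)
  finally show ?case using Suc by simp
qed simp

definition eisenstein :: "complex set" where
  "eisenstein = {of_int a + of_int b * omega | a b. True}"

lemma eisensteinI: "z = of_int a + of_int b * omega \<Longrightarrow> z \<in> eisenstein"
  unfolding eisenstein_def by blast

lemma eisenstein_of_int: "of_int a \<in> eisenstein"
  by (rule eisensteinI[of _ a 0]) simp

lemma eisenstein_omega: "omega \<in> eisenstein"
  by (rule eisensteinI[of _ 0 1]) simp

lemma eisenstein_add: "x \<in> eisenstein \<Longrightarrow> y \<in> eisenstein \<Longrightarrow> x + y \<in> eisenstein"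
proof -
  assume "x \<in> eisenstein" "y \<in> eisenstein"
  then obtain a b c d where "x = of_int a + of_int b * omega" "y = of_int c + of_int d * omega"
    unfolding eisenstein_def by blast
  thus ?thesis by (intro eisensteinI[of _ "a + c" "b + d"]) (simp add: algebra_simps)
qed

lemma eisenstein_mult: "x \<in> eisenstein \<Longrightarrow> y \<in> eisenstein \<Longrightarrow> x * y \<in> eisenstein"
proof -
  assume "x \<in> eisenstein" "y \<in> eisenstein"
  then obtain a b c d where xy: "x = of_int a + of_int b * omega" "y = of_int c + of_int d * omega"
    unfolding eisenstein_def by blast
  have "x * y = of_int (a * c) + of_int (a * d + b * c) * omega + of_int (b * d) * omega\<^sup>2"
    unfolding xy by (simp add: algebra_simps power2_eq_square)
  also have "\<dots> = of_int (a * c - b * d) + of_int (a * d + b * c - b * d) * omega"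
    unfolding omega_sq by (simp add: algebra_simps)
  finally show ?thesis by (rule eisensteinI)
qed

lemma eisenstein_power: "x \<in> eisenstein \<Longrightarrow> x ^ n \<in> eisenstein"
  using eisenstein_of_int[of 1] by (induction n) (auto intro: eisenstein_mult)

lemma eisenstein_sum: "(\<And>i. i \<in> I \<Longrightarrow> f i \<in> eisenstein) \<Longrightarrow> sum f I \<in> eisenstein"
  using eisenstein_of_int[of 0]
  by (induction I rule: infinite_finite_induct) (auto intro: eisenstein_add)

section \<open>Cubic Gauss sums\<close>

definition add_char :: "nat \<Rightarrow> int \<Rightarrow> complex" where
  "add_char l m = cis (2 * pi * of_int m / of_nat l)"

lemma add_char_add: "add_char l (a + b) = add_char l a * add_char l b"
  by (simp add: add_char_def cis_mult add_divide_distrib distrib_left)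

lemma add_char_minus: "add_char l (- a) = cnj (add_char l a)"
  by (simp add: add_char_def cis_cnj)

lemma add_char_mult_nat: "add_char l (a * int k) = add_char l a ^ k"
  by (simp add: add_char_def DeMoivre mult_ac)

lemma add_char_eq_1_iff:
  assumes "l > 0"
  shows "add_char l m = 1 \<longleftrightarrow> int l dvd m"
proof
  assume "add_char l m = 1"
  then obtain n :: int where "2 * pi * of_int m / of_nat l = of_int n * (2 * pi)"
    unfolding add_char_def cis_eq_1_iff by blast
  hence "real_of_int m = real_of_int (int l * n)" using assms by (simp add: field_simps)
  hence "m = int l * n" by (simp only: of_int_eq_iff)
  thus "int l dvd m" by simp
next
  assume "int l dvd m"
  then obtain n where m: "m = int l * n" by blast
  have "2 * pi * of_int m / of_nat l = 2 * pi * of_int n" using assms by (simp add: m)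
  hence "add_char l m = cis (2 * pi * of_int n)" by (simp only: add_char_def)
  also have "\<dots> = 1" by (rule cis_multiple_2pi) simp
  finally show "add_char l m = 1" .
qed

lemma add_char_cong:
  assumes "[a = b] (mod int l)" "l > 0"
  shows "add_char l a = add_char l b"
proof -
  have "add_char l (a - b) = 1"
    using assms by (subst add_char_eq_1_iff) (auto simp: cong_iff_dvd_diff)
  moreover have "add_char l a = add_char l (a - b) * add_char l b"
    by (simp flip: add_char_add)
  ultimately show ?thesis by simp
qed

lemma algebraic_int_add_char: "l > 0 \<Longrightarrow> algebraic_int (add_char l m)"
  by (rule algebraic_int_cis_root[of _ l])
     (auto simp flip: add_char_mult_nat simp: add_char_eq_1_iff)

text \<open>The powers r^k run through the units modulo l, so this is a full geometric sum over all
  residues minus its term 1 at the residue 0.\<close>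

lemma sum_add_char_units:
  assumes l: "prime l" and r: "residue_primroot l r"
  shows "(\<Sum>k<l - 1. add_char l (m * int (r ^ k))) = of_int (if int l dvd m then int l - 1 else -1)"
proof -
  have l1: "l > 1" using l by (rule prime_gt_1_nat)
  have bij: "bij_betw (\<lambda>i. r ^ i mod l) {..<l - 1} {0<..<l}"
    using residue_primroot_is_generator[OF l1 r] l by (simp add: totient_prime totatives_prime)
  have "(\<Sum>k<l - 1. add_char l (m * int (r ^ k))) = (\<Sum>k<l - 1. add_char l (m * int (r ^ k mod l)))"
    using l1 by (intro sum.cong refl add_char_cong cong_mult) (auto simp: cong_def zmod_int)
  also have "\<dots> = (\<Sum>j\<in>{0<..<l}. add_char l (m * int j))"
    by (rule sum.reindex_bij_betw[OF bij])
  also have "\<dots> = (\<Sum>j<l. add_char l m ^ j) - 1"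
  proof -
    have "{..<l} = insert 0 {0<..<l}" using l1 by auto
    thus ?thesis by (simp add: add_char_mult_nat)
  qed
  also have "\<dots> = of_int (if int l dvd m then int l - 1 else -1)"
  proof (cases "int l dvd m")
    case True
    thus ?thesis using l1 add_char_eq_1_iff[of l m] by simp
  next
    case False
    have "add_char l m \<noteq> 1" "add_char l m ^ l = 1"
      using False l1 by (auto simp flip: add_char_mult_nat simp: add_char_eq_1_iff)
    thus ?thesis using False by (simp add: geometric_sum)
  qed
  finally show ?thesis .
qed

lemma sum_omega_powers:
  assumes "3 dvd n" "n > 0"
  shows "(\<Sum>k<n. omega ^ k) = 0"
proof -
  have "omega ^ n = 1" using assms by (auto simp: power_mult omega_cube)
  thus ?thesis using omega_neq_1 by (simp add: geometric_sum)
qed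

text \<open>The Gauss sum of the cubic character that sends r^k to omega^k. Summing over exponents
  turns multiplication of residues into a shift of the index.\<close>

definition cubic_gauss :: "nat \<Rightarrow> nat \<Rightarrow> complex" where
  "cubic_gauss l r = (\<Sum>k<l - 1. omega ^ k * add_char l (int (r ^ k)))"

text \<open>Here omega^(2 s) is omega^(-s), the inverse of the cubic character at p when s is the
  index of p. For p = 2 modulo 3 the p-th power also conjugates omega, so that it leads from the
  Gauss sum to a multiple of its conjugate.\<close>

definition cubic_frob :: "nat \<Rightarrow> complex \<Rightarrow> nat \<Rightarrow> bool" where
  "cubic_frob p \<gamma> s \<longleftrightarrow>
     (if [p = 1] (mod 3) then acong p (\<gamma> ^ p) (omega ^ (2 * s) * \<gamma>)
      else acong p (\<gamma> ^ p) (omega ^ s * cnj \<gamma>))"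

locale cubic_gauss_sum =
  fixes l r :: nat
  assumes l: "prime l" and l3: "[l = 1] (mod 3)" and r: "residue_primroot l r"
begin

definition "n = l - 1"

lemma l_pos: "l > 1" "l > 0"
  using prime_gt_1_nat[OF l] by auto

lemma n_facts: "n > 0" "3 dvd n" "even n" "l = Suc n"
proof -
  show "n > 0" "l = Suc n" using l_pos by (auto simp: n_def)
  have "l mod 3 = 1" using l3 by (simp add: cong_def)
  thus "3 dvd n" unfolding n_def by presburger
  have "l \<noteq> 2" using l3 by (auto simp: cong_def)
  hence "odd l" using l prime_odd_nat[of l] l_pos(1) by (metis nat_less_le less_2_cases_iff prime_ge_2_nat)
  thus "even n" unfolding n_def by simp
qed

lemma omega_n: "omega ^ (k + n) = omega ^ k"
  using n_facts by (auto simp: power_add power_mult omega_cube)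

lemma r_pow_n: "[r ^ (k + n) = r ^ k] (mod l)"
proof -
  have "[r ^ n = 1] (mod l)"
    using euler_theorem[of r l] r l by (auto simp: residue_primroot_def totient_prime n_def coprime_commute)
  from cong_mult[OF cong_refl this, of "r ^ k"] show ?thesis by (simp add: power_add)
qed

lemma char_r_pow_n: "add_char l (m * int (r ^ (k + n))) = add_char l (m * int (r ^ k))"
proof (rule add_char_cong)
  have "[int (r ^ (k + n)) = int (r ^ k)] (mod int l)"
    using r_pow_n by (simp only: cong_int_iff)
  thus "[m * int (r ^ (k + n)) = m * int (r ^ k)] (mod int l)" by (rule cong_scalar_left)
qed (use l_pos in auto)

lemma generates:
  assumes "\<not> int l dvd a"
  obtains d where "[int (r ^ d) = a] (mod int l)"
proof -
  define b where "b = nat (a mod int l)"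
  have "b \<in> {0<..<l}"
  proof -
    have "a mod int l \<noteq> 0" "a mod int l \<ge> 0" "a mod int l < int l"
      using assms l_pos by (simp_all add: dvd_eq_mod_eq_0)
    thus ?thesis unfolding b_def by auto
  qed
  also have "\<dots> = (\<lambda>i. r ^ i mod l) ` {..<totient l}"
    using residue_primroot_is_generator[OF l_pos(1) r] l by (simp add: bij_betw_def totatives_prime)
  finally obtain d where d: "b = r ^ d mod l" by blast
  have "int b = a mod int l" using l_pos by (simp add: b_def)
  hence "[int (r ^ d) = a] (mod int l)" using d by (simp add: cong_def zmod_int)
  thus ?thesis by (rule that)
qed

text \<open>A discrete logarithm to the base r. The choice does not matter, because only its class
  modulo 3 is used and \<open>exponent_cong\<close> makes that class unique.\<close>

definition ind :: "int \<Rightarrow> nat" where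
  "ind a = (SOME d. [int (r ^ d) = a] (mod int l))"

lemma ind: "\<not> int l dvd a \<Longrightarrow> [int (r ^ ind a) = a] (mod int l)"
  unfolding ind_def by (rule someI_ex) (metis generates)

text \<open>Exponents of r are determined modulo l - 1, which is a multiple of 3.\<close>

lemma exponent_cong:
  assumes "[int (r ^ i) = int (r ^ j)] (mod int l)"
  shows "[i = j] (mod 3)"
proof -
  have "[r ^ i = r ^ j] (mod l)" using assms by (simp only: cong_int_iff)
  hence "[i = j] (mod ord l r)"
    using order_divides_expdiff[of l r i j] r by (simp add: residue_primroot_def coprime_commute)
  hence "[i = j] (mod n)" using r l by (simp add: residue_primroot_def totient_prime n_def)
  thus ?thesis using n_facts(2) cong_dvd_modulus_nat by blast
qed

lemma ind_eqI: "\<not> int l dvd a \<Longrightarrow> [int (r ^ d) = a] (mod int l) \<Longrightarrow> [ind a = d] (mod 3)"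
  by (rule exponent_cong) (metis ind cong_trans cong_sym)

lemma ind_mult:
  assumes "\<not> int l dvd a" "\<not> int l dvd b"
  shows "[ind (a * b) = ind a + ind b] (mod 3)"
proof (rule ind_eqI)
  show "\<not> int l dvd a * b" using assms l by (simp add: prime_dvd_mult_iff)
  show "[int (r ^ (ind a + ind b)) = a * b] (mod int l)"
    using cong_mult[OF ind[OF assms(1)] ind[OF assms(2)]] by (simp add: power_add)
qed

lemma ind_cong:
  assumes "\<not> int l dvd a" "[a = b] (mod int l)"
  shows "[ind a = ind b] (mod 3)"
proof (rule ind_eqI)
  have "\<not> int l dvd b" using assms cong_dvd_iff by blast
  from ind[OF this] assms(2) show "[int (r ^ ind b) = a] (mod int l)" by (metis cong_trans cong_sym)
qed fact

lemma not_dvd_r_pow: "\<not> int l dvd int (r ^ d)"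
proof -
  have "coprime l (r ^ d)" using r by (simp add: residue_primroot_def)
  hence "\<not> l dvd r ^ d" using l by (metis coprime_absorb_left not_prime_unit)
  thus ?thesis unfolding int_dvd_int_iff .
qed

lemma ind_surj: "\<exists>a. \<not> int l dvd a \<and> [ind a = d] (mod 3)"
  using ind_eqI[OF not_dvd_r_pow cong_refl] not_dvd_r_pow by blast

abbreviation "g \<equiv> cubic_gauss l r"

lemma algebraic_int_gauss: "algebraic_int g"
  unfolding cubic_gauss_def
  using l_pos by (intro algebraic_int_intros algebraic_int_add_char algebraic_int_omega) auto

lemma gauss_def': "g = (\<Sum>k<n. omega ^ k * add_char l (int (r ^ k)))"
  by (simp add: cubic_gauss_def n_def)

text \<open>Conjugation squares the cubic character and replaces each residue by its negative. As -1
  is r^h with h = (l - 1) / 2 divisible by 3, the negation is an index shift that the character does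
  not notice.\<close>

lemma cnj_gauss: "cnj g = (\<Sum>k<n. omega ^ (2 * k) * add_char l (int (r ^ k)))"
proof -
  define h where "h = n div 2"
  have "[r ^ h * r ^ h = 1] (mod l)"
    using r_pow_n[of 0] n_facts(3) by (simp add: h_def flip: power_add mult_2)
  hence "[int (r ^ h) * int (r ^ h) = 1] (mod int l)"
    by (metis cong_int_iff of_nat_1 of_nat_mult)
  hence "int l dvd (int (r ^ h) - 1) * (int (r ^ h) + 1)"
    by (simp add: cong_iff_dvd_diff algebra_simps)
  moreover have "\<not> int l dvd int (r ^ h) - 1"
  proof
    assume "int l dvd int (r ^ h) - 1"
    hence "[int (r ^ h) = int 1] (mod int l)" by (simp add: cong_iff_dvd_diff)
    hence "[r ^ h = 1] (mod l)" by (simp only: cong_int_iff)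
    hence "ord l r dvd h" using ord_divides by blast
    hence "n dvd h" using r l by (simp add: residue_primroot_def totient_prime n_def)
    thus False using n_facts h_def by (auto dest!: dvd_imp_le)
  qed
  ultimately have "int l dvd int (r ^ h) + 1"
    using l prime_dvd_mult_iff[of "int l"] by auto
  have neg: "[- int (r ^ k) = int (r ^ (k + h))] (mod int l)" for k
  proof -
    have "- int (r ^ k) - int (r ^ (k + h)) = - int (r ^ k) * (int (r ^ h) + 1)"
      by (simp add: power_add algebra_simps)
    thus ?thesis unfolding cong_iff_dvd_diff using \<open>int l dvd int (r ^ h) + 1\<close> by simp
  qed
  have "3 dvd h" using n_facts unfolding h_def by presburger
  hence om: "omega ^ (2 * k) = omega ^ (2 * (k + h))" for k
    by (intro omega_power_cong) (simp add: cong_def, presburger)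
  have "cnj g = (\<Sum>k<n. omega ^ (2 * (k + h)) * add_char l (int (r ^ (k + h))))"
    unfolding gauss_def' cnj_sum
  proof (rule sum.cong[OF refl])
    fix k
    have "cnj (omega ^ k * add_char l (int (r ^ k))) = omega ^ (2 * k) * add_char l (- int (r ^ k))"
      by (simp add: cnj_omega add_char_minus power_mult)
    also have "\<dots> = omega ^ (2 * (k + h)) * add_char l (int (r ^ (k + h)))"
      using add_char_cong[OF neg] om[of k] l_pos by simp
    finally show "cnj (omega ^ k * add_char l (int (r ^ k))) = \<dots>" .
  qed
  also have "\<dots> = (\<Sum>k<n. omega ^ (2 * k) * add_char l (int (r ^ k)))"
  proof (rule sum_shift_periodic)
    fix k
    have "omega ^ (2 * (k + n)) = omega ^ (2 * k)"
      using omega_n[of "2 * k + n"] omega_n[of "2 * k"] by (simp add: algebra_simps)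
    thus "omega ^ (2 * (k + n)) * add_char l (int (r ^ (k + n))) = omega ^ (2 * k) * add_char l (int (r ^ k))"
      using char_r_pow_n[of 1 k] by simp
  qed
  finally show ?thesis .
qed

text \<open>After the shift of k by j, the sum over j runs over all units: it is n for k = 0 and -1
  otherwise. The powers of omega cancel because 3 divides n, and n + 1 = l remains.\<close>

lemma gauss_norm: "g * cnj g = of_nat l"
proof -
  define w where "w = (\<lambda>m. \<Sum>k<n. add_char l (m * int (r ^ k)))"
  have w: "w m = of_int (if int l dvd m then int n else -1)" for m
    unfolding w_def using sum_add_char_units[OF l r, of m] n_facts(4) by (simp add: n_def)
  have "cnj g * g = (\<Sum>j<n. \<Sum>k<n. cnj (omega ^ j) * omega ^ k * add_char l (int (r ^ k) - int (r ^ j)))"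
    unfolding gauss_def' cnj_sum sum_product
    by (simp add: add_char_minus diff_conv_add_uminus add_char_add mult_ac del: add_uminus_conv_diff)
  also have "\<dots> = (\<Sum>j<n. \<Sum>k<n. cnj (omega ^ j) * omega ^ (k + j) * add_char l (int (r ^ (k + j)) - int (r ^ j)))"
  proof (rule sum.cong[OF refl])
    fix j
    show "(\<Sum>k<n. cnj (omega ^ j) * omega ^ k * add_char l (int (r ^ k) - int (r ^ j)))
        = (\<Sum>k<n. cnj (omega ^ j) * omega ^ (k + j) * add_char l (int (r ^ (k + j)) - int (r ^ j)))"
      by (rule sum_shift_periodic[symmetric, where f = "\<lambda>k. cnj (omega ^ j) * omega ^ k * add_char l (int (r ^ k) - int (r ^ j))"])
         (use char_r_pow_n[of 1] in \<open>simp add: omega_n diff_conv_add_uminus add_char_add del: add_uminus_conv_diff\<close>)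
  qed
  also have "\<dots> = (\<Sum>j<n. \<Sum>k<n. omega ^ k * add_char l ((int (r ^ k) - 1) * int (r ^ j)))"
  proof (intro sum.cong refl)
    fix j k
    have "cnj (omega ^ j) * omega ^ j = 1"
      by (simp add: cnj_omega flip: power_mult_distrib) (use omega_cube in \<open>simp add: power2_eq_square power3_eq_cube\<close>)
    hence "cnj (omega ^ j) * omega ^ (k + j) = omega ^ k"
      by (metis mult.commute mult.left_commute mult.right_neutral power_add)
    moreover have "int (r ^ (k + j)) - int (r ^ j) = (int (r ^ k) - 1) * int (r ^ j)"
      by (simp add: power_add algebra_simps)
    ultimately show "cnj (omega ^ j) * omega ^ (k + j) * add_char l (int (r ^ (k + j)) - int (r ^ j))
        = omega ^ k * add_char l ((int (r ^ k) - 1) * int (r ^ j))"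
      by (simp only:)
  qed
  also have "\<dots> = (\<Sum>k<n. omega ^ k * w (int (r ^ k) - 1))"
    unfolding w_def sum_distrib_left by (rule sum.swap)
  also have "\<dots> = (\<Sum>k<n. omega ^ k * (if k = 0 then of_nat l else 0) - omega ^ k)"
  proof (intro sum.cong refl)
    fix k assume k: "k \<in> {..<n}"
    have "int l dvd int (r ^ k) - 1 \<longleftrightarrow> k = 0"
    proof
      assume "int l dvd int (r ^ k) - 1"
      hence "[int (r ^ k) = int 1] (mod int l)" by (simp add: cong_iff_dvd_diff)
      hence "[r ^ k = 1] (mod l)" by (simp only: cong_int_iff)
      hence "ord l r dvd k" using ord_divides by blast
      hence "n dvd k" using r l by (simp add: residue_primroot_def totient_prime n_def)
      thus "k = 0" using k by (auto dest!: dvd_imp_le)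
    qed auto
    thus "omega ^ k * w (int (r ^ k) - 1) = omega ^ k * (if k = 0 then of_nat l else 0) - omega ^ k"
      using arg_cong[OF n_facts(4), of "of_nat :: nat \<Rightarrow> complex"] by (simp add: w algebra_simps)
  qed
  also have "\<dots> = of_nat l"
    using sum_omega_powers[of n] n_facts
    by (simp add: sum_subtractf if_distrib[of "\<lambda>x. _ * x"] cong: if_cong)
  finally show ?thesis by (simp add: mult.commute)
qed

text \<open>Shifting two of the three indices by the third one, k, produces omega^(3 k) = 1. So k
  survives only in the additive character, and the sum over k is a rational integer. The
  coefficients that remain are powers of omega.\<close>

lemma gauss_cube: "g ^ 3 \<in> eisenstein"
proof -
  define w where "w = (\<lambda>m. \<Sum>k<n. add_char l (m * int (r ^ k)))"
  have w: "w m \<in> eisenstein" for m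
    unfolding w_def using sum_add_char_units[OF l r, of m]
    by (simp only: n_def) (rule eisenstein_of_int)
  let ?F = "\<lambda>k. omega ^ k * add_char l (int (r ^ k))"
  have per: "?F (k + n) = ?F k" for k using char_r_pow_n[of 1] by (simp add: omega_n)
  have shift: "g = (\<Sum>a<n. ?F (a + k))" for k
    unfolding gauss_def' using per by (rule sum_shift_periodic[symmetric])
  have "g ^ 3 = (\<Sum>k<n. ?F k * (g * g))"
    by (simp add: power3_eq_cube gauss_def' sum_distrib_right mult.assoc)
  also have "\<dots> = (\<Sum>k<n. \<Sum>a<n. \<Sum>b<n. ?F k * (?F (a + k) * ?F (b + k)))"
  proof (rule sum.cong[OF refl])
    fix k
    have "g * g = (\<Sum>a<n. \<Sum>b<n. ?F (a + k) * ?F (b + k))"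
      by (subst (1 2) shift[of k]) (rule sum_product)
    thus "?F k * (g * g) = (\<Sum>a<n. \<Sum>b<n. ?F k * (?F (a + k) * ?F (b + k)))"
      by (simp only: sum_distrib_left)
  qed
  also have "\<dots> = (\<Sum>k<n. \<Sum>a<n. \<Sum>b<n. omega ^ (a + b) * add_char l ((1 + int (r ^ a) + int (r ^ b)) * int (r ^ k)))"
  proof (intro sum.cong refl)
    fix k a b
    have 1: "omega ^ k * omega ^ (a + k) * omega ^ (b + k) = omega ^ (a + b)"
      unfolding power_add[symmetric] by (rule omega_power_cong) (simp add: cong_def, presburger)
    have 2: "add_char l (int (r ^ k)) * add_char l (int (r ^ (a + k))) * add_char l (int (r ^ (b + k)))
        = add_char l ((1 + int (r ^ a) + int (r ^ b)) * int (r ^ k))"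
      by (simp add: power_add algebra_simps flip: add_char_add)
    show "?F k * (?F (a + k) * ?F (b + k)) = omega ^ (a + b) * add_char l ((1 + int (r ^ a) + int (r ^ b)) * int (r ^ k))"
      unfolding 1[symmetric] 2[symmetric] by (simp only: mult_ac)
  qed
  also have "\<dots> = (\<Sum>a<n. \<Sum>k<n. \<Sum>b<n. omega ^ (a + b) * add_char l ((1 + int (r ^ a) + int (r ^ b)) * int (r ^ k)))"
    by (rule sum.swap)
  also have "\<dots> = (\<Sum>a<n. \<Sum>b<n. omega ^ (a + b) * w (1 + int (r ^ a) + int (r ^ b)))"
    unfolding w_def sum_distrib_left by (intro sum.cong refl sum.swap)
  finally show ?thesis
    using w by (auto intro!: eisenstein_sum eisenstein_mult eisenstein_power eisenstein_omega)
qed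

text \<open>Modulo p the power is taken term by term. It multiplies the residue r^k by p = r^d, and
  undoing this index shift in the factor omega^(k p) costs omega^(-d p), written as omega^(2 d
  p).\<close>

lemma gauss_frob:
  assumes p: "prime p" "p \<noteq> l" "p \<noteq> 3"
  shows "cubic_frob p g (ind (int p))"
proof -
  define d where "d = ind (int p)"
  have "\<not> l dvd p" using p l primes_dvd_imp_eq by blast
  hence "\<not> int l dvd int p" unfolding int_dvd_int_iff .
  from ind[OF this] have d: "[int (r ^ d) = int p] (mod int l)" by (simp add: d_def)
  have "\<not> 3 dvd p" using p primes_dvd_imp_eq[of 3 p] by auto
  hence p3: "p mod 3 = 1 \<or> p mod 3 = 2" by presburger
  have pw: "add_char l (int (r ^ k)) ^ p = add_char l (int (r ^ (k + d)))" for k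
  proof -
    have "add_char l (int (r ^ k)) ^ p = add_char l (int (r ^ k) * int p)"
      by (simp add: add_char_mult_nat)
    also have "\<dots> = add_char l (int (r ^ k) * int (r ^ d))"
      using l_pos by (intro add_char_cong cong_scalar_left cong_sym[OF d]) auto
    finally show ?thesis by (simp add: power_add)
  qed
  have "acong p (g ^ p) (\<Sum>k<n. (omega ^ k * add_char l (int (r ^ k))) ^ p)"
    unfolding gauss_def' using p l_pos
    by (intro acong_freshman_sum algebraic_int_intros algebraic_int_add_char) auto
  also have "(\<Sum>k<n. (omega ^ k * add_char l (int (r ^ k))) ^ p)
      = (\<Sum>k<n. omega ^ (2 * d * p) * (omega ^ ((k + d) * p) * add_char l (int (r ^ (k + d)))))"
  proof (intro sum.cong refl)
    fix k
    have "omega ^ (k * p) = omega ^ (2 * d * p + (k + d) * p)"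
    proof (rule omega_power_cong)
      have "2 * d * p + (k + d) * p = k * p + 3 * (d * p)" by (simp add: algebra_simps)
      thus "[k * p = 2 * d * p + (k + d) * p] (mod 3)" by (simp add: cong_def)
    qed
    hence "omega ^ (k * p) = omega ^ (2 * d * p) * omega ^ ((k + d) * p)" by (simp add: power_add)
    thus "(omega ^ k * add_char l (int (r ^ k))) ^ p
      = omega ^ (2 * d * p) * (omega ^ ((k + d) * p) * add_char l (int (r ^ (k + d))))"
      unfolding power_mult_distrib pw by (simp only: power_mult[symmetric] mult.assoc)
  qed
  also have "\<dots> = omega ^ (2 * d * p) * (\<Sum>k<n. omega ^ ((k + d) * p) * add_char l (int (r ^ (k + d))))"
    by (simp add: sum_distrib_left)
  also have "(\<Sum>k<n. omega ^ ((k + d) * p) * add_char l (int (r ^ (k + d))))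
      = (\<Sum>k<n. omega ^ (k * p) * add_char l (int (r ^ k)))"
    by (rule sum_shift_periodic[where f = "\<lambda>k. omega ^ (k * p) * add_char l (int (r ^ k))"])
       (use omega_n char_r_pow_n[of 1] in \<open>simp add: power_mult\<close>)
  finally have *: "acong p (g ^ p) (omega ^ (2 * d * p) * (\<Sum>k<n. omega ^ (k * p) * add_char l (int (r ^ k))))" .
  show ?thesis
  proof (cases "p mod 3 = 1")
    case True
    have "omega ^ (j * p) = omega ^ j" for j
      using True by (intro omega_power_cong) (simp add: cong_def mod_mult_right_eq[of j p, symmetric])
    thus ?thesis using * True unfolding cubic_frob_def d_def[symmetric] gauss_def' by (simp add: cong_def)
  next
    case False
    hence F: "p mod 3 = 2" using p3 by simp
    have 1: "omega ^ (j * p) = omega ^ (2 * j)" for j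
      using F by (intro omega_power_cong) (simp add: cong_def mod_mult_right_eq[of j p, symmetric] mult.commute)
    have 2: "omega ^ (2 * (2 * d)) = omega ^ d"
      by (rule omega_power_cong) (simp add: cong_def, presburger)
    show ?thesis using * False
      unfolding cubic_frob_def d_def[symmetric] cnj_gauss 1 2 by (simp add: cong_def)
  qed
qed

end

section \<open>Cyclic cubics and Frobenius\<close>

text \<open>Lagrange's bound on the number of roots modulo p, by splitting off the factor X - n; the
  differences n - a with 0 <= a < n are smaller than p and hence invertible.\<close>

lemma int_poly_dvd_if_many_roots:
  fixes q :: "int poly"
  assumes p: "prime p"
  shows "n \<le> p \<Longrightarrow> q = 0 \<or> Polynomial.degree q < n \<Longrightarrow> (\<And>a. a < n \<Longrightarrow> int p dvd poly q (int a))
    \<Longrightarrow> \<exists>q'. q = Polynomial.smult (int p) q'"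
proof (induction n arbitrary: q)
  case 0
  thus ?case by (intro exI[of _ 0]) auto
next
  case (Suc n)
  define q1 where "q1 = synthetic_div q (int n)"
  have q: "q = [:- int n, 1:] * q1 + [:poly q (int n):]"
    unfolding q1_def by (rule synthetic_div_correct'[symmetric])
  have "\<exists>q'. q1 = Polynomial.smult (int p) q'"
  proof (rule Suc.IH)
    show "n \<le> p" using Suc.prems(1) by simp
    show "q1 = 0 \<or> Polynomial.degree q1 < n"
    proof (cases "Polynomial.degree q = 0")
      case True
      thus ?thesis by (auto simp: q1_def synthetic_div_eq_0_iff)
    next
      case False
      thus ?thesis using Suc.prems(2) by (auto simp: q1_def degree_synthetic_div)
    qed
    fix a assume a: "a < n"
    have "poly q (int a) = (int a - int n) * poly q1 (int a) + poly q (int n)"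
      by (subst q) (simp add: algebra_simps)
    moreover have "int p dvd poly q (int a)" "int p dvd poly q (int n)"
      using a Suc.prems(3) by auto
    ultimately have "int p dvd (int a - int n) * poly q1 (int a)"
      by (metis dvd_add_left_iff)
    moreover have "\<not> int p dvd int a - int n"
      using a Suc.prems(1) zdvd_imp_le[of "int p" "int n - int a"] by (auto simp: dvd_diff_commute)
    ultimately show "int p dvd poly q1 (int a)"
      using p prime_dvd_mult_iff[of "int p"] by auto
  qed
  then obtain q' where q': "q1 = Polynomial.smult (int p) q'" ..
  obtain c where c: "poly q (int n) = int p * c" using Suc.prems(3)[of n] by blast
  have "q = Polynomial.smult (int p) ([:- int n, 1:] * q' + [:c:])"
    by (subst q) (simp add: q' c smult_add_right)
  thus ?case by blast
qed

text \<open>Fermat's theorem, by applying the binomial congruence to n as a sum of n ones.\<close>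

lemma acong_of_nat_power:
  assumes "prime p"
  shows "acong p (of_nat n ^ p) (of_nat n)"
  using acong_freshman_sum[OF assms, of "{..<n}" "\<lambda>_. 1"] by simp

lemma dvd_imp_acong: "int p dvd a - b \<Longrightarrow> acong p (of_int a) (of_int b)"
proof -
  assume "int p dvd a - b"
  then obtain c where "a - b = int p * c" by blast
  hence "(of_int (a - b) :: complex) = of_int (int p * c)" by (simp only:)
  thus ?thesis unfolding acong_def by (intro exI[of _ "of_int c"]) auto
qed

lemma acong_of_int_power:
  assumes p: "prime p"
  shows "acong p (of_int x ^ p) (of_int x)"
proof -
  define n where "n = nat (x mod int p)"
  have n: "int n = x mod int p" using prime_gt_0_nat[OF p] by (simp add: n_def)
  have "int p dvd x - int n" unfolding n by (metis dvd_triv_left minus_mod_eq_mult_div)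
  hence xn: "acong p (of_int x) (of_nat n)" using dvd_imp_acong[of p x "int n"] by simp
  have "acong p (of_int x ^ p) (of_nat n ^ p)" by (intro acong_power xn) auto
  also have "acong p \<dots> (of_nat n)" by (rule acong_of_nat_power[OF p])
  also have "acong p \<dots> (of_int x)" by (rule acong_sym[OF xn])
  finally show ?thesis .
qed

text \<open>The integer polynomials on both sides differ by one of degree less than p that vanishes
  at all residues modulo p. Its coefficients are therefore multiples of p, and this persists after
  inserting an algebraic integer.\<close>

lemma acong_prod_linear:
  assumes p: "prime p" and z: "algebraic_int z"
  shows "acong p (\<Prod>a<p. z - of_nat a) (z ^ p - z)"
proof -
  have p1: "p > 1" using p by (rule prime_gt_1_nat)
  define f :: "int poly" where "f = (\<Prod>a<p. [:- int a, 1:])"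
  define q where "q = f - (Polynomial.monom 1 p - [:0, 1:])"
  have "Polynomial.lead_coeff f = 1" unfolding f_def lead_coeff_prod by simp
  moreover have "Polynomial.degree f = p"
    unfolding f_def by (simp add: Polynomial.degree_prod_eq_sum_degree)
  ultimately have f: "Polynomial.degree f = p" "Polynomial.lead_coeff f = 1" by simp_all
  have "Polynomial.coeff q i = 0" if "i \<ge> p" for i
    using that f p1 by (cases "i = p") (auto simp: q_def coeff_pCons coeff_eq_0 split: nat.splits)
  hence deg: "q = 0 \<or> Polynomial.degree q < p"
    by (metis leading_coeff_0_iff not_less)
  have "int p dvd poly q (int a)" if "a < p" for a
  proof -
    have "poly f (int a) = 0" using that by (auto simp: f_def poly_prod)
    hence "poly q (int a) = - (int a ^ p - int a)" by (simp add: q_def poly_monom)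
    moreover have "int p dvd int a ^ p - int a"
    proof (rule acong_of_int_0_imp_dvd)
      show "acong p (of_int (int a ^ p - int a)) 0"
        using acong_diff[OF acong_of_int_power[OF p, of "int a"] acong_refl[of p "of_nat a"]] by simp
    qed (use p1 in auto)
    ultimately show ?thesis by (simp add: dvd_diff_commute)
  qed
  with deg obtain q' where q': "q = Polynomial.smult (int p) q'"
    using int_poly_dvd_if_many_roots[OF p, of p q] by blast
  have "poly (map_poly of_int q) z = (\<Prod>a<p. z - of_nat a) - (z ^ p - z)"
  proof -
    have "map_poly of_int f = (\<Prod>a<p. [:- of_nat a, 1 :: complex:])"
      unfolding f_def by (simp add: of_int_poly_hom.hom_prod map_poly_pCons)
    hence "poly (map_poly of_int f) z = (\<Prod>a<p. z - of_nat a)"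
      by (simp add: poly_prod)
    thus ?thesis
      by (simp add: q_def of_int_poly_hom.hom_minus poly_monom map_poly_pCons)
  qed
  moreover have "poly (map_poly of_int q) z = of_nat p * poly (map_poly of_int q') z"
    by (simp add: q' of_int_hom.map_poly_hom_smult)
  moreover have "algebraic_int (poly (map_poly of_int q') z)"
    unfolding poly_altdef by (intro algebraic_int_sum algebraic_int_mult algebraic_int_power z) (auto simp: coeff_map_poly)
  ultimately show ?thesis unfolding acong_def by auto
qed

section \<open>The cyclic cubic of gamma and its roots modulo p\<close>

locale cubic_resolvent =
  fixes \<gamma> :: complex and a b :: int and N :: nat
  assumes alg: "algebraic_int \<gamma>" and cube: "\<gamma> ^ 3 = of_int a + of_int b * omega"
    and norm: "\<gamma> * cnj \<gamma> = of_nat N"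
begin

definition rt :: "nat \<Rightarrow> complex" where
  "rt k = omega ^ k * \<gamma> + cnj (omega ^ k * \<gamma>)"

lemma rt_cong: "[j = k] (mod 3) \<Longrightarrow> rt j = rt k"
  unfolding rt_def using omega_power_cong by metis

lemma algebraic_int_rt: "algebraic_int (rt k)"
  unfolding rt_def using alg by (intro algebraic_int_intros algebraic_int_omega algebraic_int_cnj)

lemma rt_simps: "rt 0 = \<gamma> + cnj \<gamma>" "rt 1 = omega * \<gamma> + omega\<^sup>2 * cnj \<gamma>"
  "rt 2 = omega\<^sup>2 * \<gamma> + omega * cnj \<gamma>"
proof -
  have "omega\<^sup>2 * omega\<^sup>2 = omega" using omega_power_cong[of 4 1] by (simp add: cong_def flip: power_add)
  thus "rt 0 = \<gamma> + cnj \<gamma>" "rt 1 = omega * \<gamma> + omega\<^sup>2 * cnj \<gamma>"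
    "rt 2 = omega\<^sup>2 * \<gamma> + omega * cnj \<gamma>"
    by (simp_all add: rt_def cnj_omega power2_eq_square)
qed

lemma cnj_cube: "cnj \<gamma> ^ 3 = of_int a + of_int b * omega\<^sup>2"
  using arg_cong[OF cube, of cnj] by (simp add: cnj_omega)

text \<open>Cardano's formula read backwards, with gamma and its conjugate as the two cube roots:
  the coefficients involve only their product N and the sum of their cubes.\<close>

lemma cubic_factor:
  "(z - rt 0) * (z - rt 1) * (z - rt 2) = z ^ 3 - 3 * of_nat N * z - of_int (2 * a - b)"
proof -
  define u v w where "u = \<gamma>" and "v = cnj \<gamma>" and "w = omega"
  have w: "w\<^sup>2 + w + 1 = 0" using omega_quadratic by (simp add: w_def)
  have "(z - (u + v)) * (z - (w * u + w\<^sup>2 * v)) * (z - (w\<^sup>2 * u + w * v)) = z ^ 3 - 3 * (u * v) * z - (u ^ 3 + v ^ 3)"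
  proof -
    have w2: "w * w = - 1 - w" using w by (simp add: power2_eq_square algebra_simps add_eq_0_iff)
    have s: "(w * u + w\<^sup>2 * v) + (w\<^sup>2 * u + w * v) = - (u + v)"
      unfolding power2_eq_square w2 by (simp add: algebra_simps)
    have "(w * u + w\<^sup>2 * v) * (w\<^sup>2 * u + w * v) = w * w\<^sup>2 * (u * u + v * v) + (w * w + w\<^sup>2 * w\<^sup>2) * (u * v)"
      by (simp add: algebra_simps)
    also have "w * w\<^sup>2 = 1" using omega_cube by (simp add: w_def power2_eq_square power3_eq_cube mult.assoc)
    also have "w * w + w\<^sup>2 * w\<^sup>2 = - 1"
      unfolding power2_eq_square w2 by (simp add: algebra_simps w2)
    finally have m: "(w * u + w\<^sup>2 * v) * (w\<^sup>2 * u + w * v) = u * u + v * v - u * v" by simp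
    have "(z - x) * (z - y) = z * z - (x + y) * z + x * y" for x y by (simp add: algebra_simps)
    note this[of "w * u + w\<^sup>2 * v" "w\<^sup>2 * u + w * v"]
    also have "z * z - ((w * u + w\<^sup>2 * v) + (w\<^sup>2 * u + w * v)) * z + (w * u + w\<^sup>2 * v) * (w\<^sup>2 * u + w * v)
        = z * z + (u + v) * z + (u * u + v * v - u * v)"
      unfolding s m by (simp add: algebra_simps)
    finally have "(z - (w * u + w\<^sup>2 * v)) * (z - (w\<^sup>2 * u + w * v)) = z * z + (u + v) * z + (u * u + v * v - u * v)" .
    hence "(z - (u + v)) * (z - (w * u + w\<^sup>2 * v)) * (z - (w\<^sup>2 * u + w * v))
        = (z - (u + v)) * (z * z + (u + v) * z + (u * u + v * v - u * v))"
      by (simp only: mult.assoc)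
    thus ?thesis by (simp add: algebra_simps power3_eq_cube)
  qed
  moreover have "u ^ 3 + v ^ 3 = of_int (2 * a - b)"
    unfolding u_def v_def cube cnj_cube omega_sq by (simp add: algebra_simps)
  ultimately show ?thesis unfolding rt_simps using norm by (simp add: u_def v_def w_def mult.assoc)
qed

text \<open>An integral square root of the discriminant, which is the mark of a cyclic cubic. It
  also shows that the roots can only coincide modulo primes that divide 9 b.\<close>

lemma cubic_disc: "(rt 0 - rt 1) * (rt 1 - rt 2) * (rt 2 - rt 0) = of_int (9 * b)"
proof -
  define u v w where "u = \<gamma>" and "v = cnj \<gamma>" and "w = omega"
  have w: "w\<^sup>2 + w + 1 = 0" using omega_quadratic by (simp add: w_def)
  have 1: "u ^ 3 = of_int a + of_int b * w" "v ^ 3 = of_int a + of_int b * w\<^sup>2"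
    using cube cnj_cube by (simp_all add: u_def v_def w_def)
  have "((u + v) - (w * u + w\<^sup>2 * v)) * ((w * u + w\<^sup>2 * v) - (w\<^sup>2 * u + w * v)) * ((w\<^sup>2 * u + w * v) - (u + v))
     = - 3 * (w - w\<^sup>2) * (u ^ 3 - v ^ 3)"
  proof -
    have w2: "w * w = - 1 - w" using w by (simp add: power2_eq_square algebra_simps add_eq_0_iff)
    have "((u + v) - (w * u + w\<^sup>2 * v)) * ((w\<^sup>2 * u + w * v) - (u + v)) = - 3 * (u * u + u * v + v * v)"
      unfolding power2_eq_square w2 by (simp add: algebra_simps w2)
    moreover have "(w * u + w\<^sup>2 * v) - (w\<^sup>2 * u + w * v) = (w - w\<^sup>2) * (u - v)"
      by (simp add: algebra_simps)
    moreover have "u ^ 3 - v ^ 3 = (u - v) * (u * u + u * v + v * v)"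
      by (simp add: algebra_simps power3_eq_cube)
    moreover have "x * y * z = (x * z) * y" for x y z :: complex by (simp only: mult_ac)
    ultimately show ?thesis by (simp only: mult_ac)
  qed
  also have "\<dots> = 9 * of_int b"
  proof -
    have w2: "w * w = - 1 - w" using w by (simp add: power2_eq_square algebra_simps add_eq_0_iff)
    have e: "w - w\<^sup>2 = 2 * w + 1" unfolding power2_eq_square w2 by simp
    have e': "(2 * w + 1) * (2 * w + 1) = 4 * (w * w) + 4 * w + 1" by (simp add: algebra_simps)
    have w3: "(w - w\<^sup>2) * (w - w\<^sup>2) = - 3" unfolding e e' w2 by simp
    have "- 3 * (w - w\<^sup>2) * (u ^ 3 - v ^ 3) = - 3 * ((w - w\<^sup>2) * (w - w\<^sup>2)) * of_int b"
      unfolding 1 by (simp add: algebra_simps)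
    thus ?thesis unfolding w3 by simp
  qed
  finally show ?thesis unfolding rt_simps by (simp add: u_def v_def w_def)
qed

text \<open>The two cases of \<open>cubic_frob\<close> send omega^k gamma to y or to its conjugate.
  The root is the sum of both, so the shift of roots does not depend on p modulo 3.\<close>

lemma rt_frob:
  assumes p: "prime p" "p \<noteq> 3" and fr: "cubic_frob p \<gamma> s"
  shows "acong p (rt k ^ p) (rt (k + 2 * s))"
proof -
  have "\<not> 3 dvd p" using p primes_dvd_imp_eq[of 3 p] by auto
  hence p3: "p mod 3 = 1 \<or> p mod 3 = 2" by presburger
  define y where "y = omega ^ (k + 2 * s) * \<gamma>"
  have y: "algebraic_int y" using alg by (auto simp: y_def intro!: algebraic_int_intros)
  have *: "acong p ((omega ^ k * \<gamma>) ^ p) y \<or> acong p ((omega ^ k * \<gamma>) ^ p) (cnj y)"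
  proof (cases "p mod 3 = 1")
    case True
    have 1: "omega ^ (k * p) = omega ^ k"
      using True by (intro omega_power_cong) (simp add: cong_def mod_mult_right_eq[of k p, symmetric])
    have "acong p (\<gamma> ^ p) (omega ^ (2 * s) * \<gamma>)"
      using fr True by (simp add: cubic_frob_def cong_def)
    hence "acong p (omega ^ (k * p) * \<gamma> ^ p) (omega ^ (k * p) * (omega ^ (2 * s) * \<gamma>))"
      by (intro acong_mult_left algebraic_int_intros algebraic_int_omega)
    moreover have "omega ^ (k * p) * (omega ^ (2 * s) * \<gamma>) = y"
      unfolding 1 y_def by (simp add: power_add)
    ultimately show ?thesis by (simp add: power_mult_distrib power_mult)
  next
    case False
    hence F: "p mod 3 = 2" using p3 by simp
    have 1: "omega ^ (k * p) = omega ^ (2 * k)"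
      using F by (intro omega_power_cong) (simp add: cong_def mod_mult_right_eq[of k p, symmetric] mult.commute)
    have 2: "omega ^ (2 * (2 * s)) = omega ^ s"
      by (rule omega_power_cong) (simp add: cong_def, presburger)
    have "acong p (\<gamma> ^ p) (omega ^ s * cnj \<gamma>)"
      using fr False by (simp add: cubic_frob_def cong_def)
    hence "acong p (omega ^ (k * p) * \<gamma> ^ p) (omega ^ (k * p) * (omega ^ s * cnj \<gamma>))"
      by (intro acong_mult_left algebraic_int_intros algebraic_int_omega)
    moreover have "omega ^ (k * p) * (omega ^ s * cnj \<gamma>) = cnj y"
      unfolding 1 2[symmetric] y_def by (simp add: cnj_omega power_add distrib_left flip: power_mult)
    ultimately show ?thesis by (simp add: power_mult_distrib power_mult)
  qed
  have "acong p (rt k ^ p) ((omega ^ k * \<gamma>) ^ p + cnj (omega ^ k * \<gamma>) ^ p)"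
    unfolding rt_def using alg
    by (intro acong_freshman p algebraic_int_intros algebraic_int_omega algebraic_int_cnj)
  also have "acong p \<dots> (y + cnj y)"
    using *
  proof
    assume "acong p ((omega ^ k * \<gamma>) ^ p) y"
    from acong_add[OF this acong_cnj[OF this]] show ?thesis by simp
  next
    assume "acong p ((omega ^ k * \<gamma>) ^ p) (cnj y)"
    from acong_add[OF this acong_cnj[OF this]] show ?thesis by (simp add: add.commute)
  qed
  finally show ?thesis by (simp add: rt_def y_def)
qed

definition \<Phi> :: "int \<Rightarrow> int" where
  "\<Phi> x = x ^ 3 - 3 * int N * x - (2 * a - b)"

lemma \<Phi>_factor: "of_int (\<Phi> x) = (of_int x - rt 0) * (of_int x - rt 1) * (of_int x - rt 2)"
  unfolding cubic_factor by (simp add: \<Phi>_def)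

text \<open>A root fixed by the p-th power annihilates the product of all rt 0 - c modulo p.
  Multiplying by the other two linear factors, with the sign (-1)^p, gives the product of the
  integers \<open>\<Phi> c\<close>, and p must divide one of them.\<close>

theorem root_if_frob_trivial:
  assumes p: "prime p" "p \<noteq> 3" and fr: "cubic_frob p \<gamma> s" and s: "3 dvd s"
  shows "\<exists>x. int p dvd \<Phi> x"
proof -
  have "rt (0 + 2 * s) = rt 0" using s by (intro rt_cong) (auto simp: cong_def)
  hence "acong p (rt 0 ^ p) (rt 0)" using rt_frob[OF p fr, of 0] by simp
  from acong_diff[OF this acong_refl[of p "rt 0"]]
  have "acong p (\<Prod>c<p. rt 0 - of_nat c) 0"
    using acong_prod_linear[OF p(1) algebraic_int_rt, of 0] by (metis acong_trans diff_self)
  from acong_mult_left[OF this, of "(-1) ^ p * (\<Prod>c<p. (of_nat c - rt 1) * (of_nat c - rt 2))"]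
  have "acong p (((-1) ^ p * (\<Prod>c<p. (of_nat c - rt 1) * (of_nat c - rt 2))) * (\<Prod>c<p. rt 0 - of_nat c)) 0"
    by (auto intro!: algebraic_int_intros algebraic_int_rt)
  also have "((-1) ^ p * (\<Prod>c<p. (of_nat c - rt 1) * (of_nat c - rt 2))) * (\<Prod>c<p. rt 0 - of_nat c)
      = (\<Prod>c<p. (-1) * ((of_nat c - rt 1) * (of_nat c - rt 2)) * (rt 0 - of_nat c))"
    by (simp only: prod.distrib) simp
  also have "\<dots> = (\<Prod>c<p. of_int (\<Phi> (int c)))"
    by (intro prod.cong refl) (simp add: \<Phi>_factor algebra_simps)
  also have "\<dots> = of_int (\<Prod>c<p. \<Phi> (int c))" by simp
  finally have "int p dvd (\<Prod>c<p. \<Phi> (int c))"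
    using acong_of_int_0_imp_dvd prime_gt_0_nat[OF p(1)] by blast
  thus ?thesis using p(1) prime_dvd_prod_iff[of "{..<p}" "int p"] by auto
qed

text \<open>If p divides \<open>\<Phi> x\<close>, put y k = x - rt k. The p-th power permutes these
  cyclically, so y k to the power 1 + p + p^2 is their product \<open>\<Phi> x\<close>, which is 0
  modulo p, while y k to the power p^3 is y k again. Hence each y k is itself 0 although the ring
  modulo p has nilpotents, all roots coincide, and p divides 9 b.\<close>

theorem no_root_if_frob_nontrivial:
  assumes p: "prime p" "p \<noteq> 3" and fr: "cubic_frob p \<gamma> s" and s: "\<not> 3 dvd s"
    and b: "\<not> int p dvd b"
  shows "\<not> int p dvd \<Phi> x"
proof
  assume dvd: "int p dvd \<Phi> x"
  have p1: "p > 1" using p(1) by (rule prime_gt_1_nat)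
  define y where "y = (\<lambda>k. of_int x - rt k)"
  have y: "algebraic_int (y k)" for k
    unfolding y_def by (intro algebraic_int_intros algebraic_int_rt)
  have y_cong: "y j = y k" if "[j = k] (mod 3)" for j k using rt_cong[OF that] by (simp add: y_def)
  have fy: "acong p (y k ^ p) (y (k + 2 * s))" for k
  proof -
    have "acong p ((of_int x + - rt k) ^ p) (of_int x ^ p + (- rt k) ^ p)"
      using algebraic_int_rt by (intro acong_freshman p) auto
    moreover have "acong p ((- rt k) ^ p) (- (rt k ^ p))"
    proof (cases "even p")
      case True
      \<comment> \<open>For p = 2 the sign is lost in the power but -1 and 1 agree modulo 2.\<close>
      hence "p = 2" using p(1) primes_dvd_imp_eq two_is_prime_nat by blast
      thus ?thesis unfolding acong_def
        by (intro exI[of _ "rt k ^ p"]) (auto intro: algebraic_int_power algebraic_int_rt)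
    qed auto
    ultimately have "acong p (y k ^ p) (of_int x ^ p - rt k ^ p)"
      using acong_add[OF acong_refl, of p _ _ "of_int x ^ p"] acong_trans
      unfolding y_def diff_conv_add_uminus by blast
    also have "acong p \<dots> (y (k + 2 * s))"
      unfolding y_def by (intro acong_diff acong_of_int_power rt_frob p fr)
    finally show ?thesis .
  qed
  have zero: "acong p (y k) 0" for k
  proof -
    have f1: "acong p (y k ^ p) (y (k + 2 * s))" by (rule fy)
    have "acong p ((y k ^ p) ^ p) (y (k + 2 * s) ^ p)"
      by (intro acong_power fy algebraic_int_power y)
    also have "acong p \<dots> (y (k + 2 * s + 2 * s))" by (rule fy)
    finally have f2: "acong p ((y k ^ p) ^ p) (y (k + 2 * s + 2 * s))" .
    have "acong p (((y k ^ p) ^ p) ^ p) (y (k + 2 * s + 2 * s) ^ p)"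
      by (intro acong_power f2 algebraic_int_power y)
    also have "acong p \<dots> (y (k + 2 * s + 2 * s + 2 * s))" by (rule fy)
    also have "y (k + 2 * s + 2 * s + 2 * s) = y k" by (rule y_cong) (simp add: cong_def, presburger)
    finally have f3: "acong p (y k ^ (p * p * p)) (y k)" by (simp add: power_mult)
    have "acong p (y k * y k ^ p * (y k ^ p) ^ p) (y k * y (k + 2 * s) * y (k + 2 * s + 2 * s))"
      by (intro acong_mult f1 f2 acong_refl algebraic_int_intros y)
    also have "y k * y (k + 2 * s) * y (k + 2 * s + 2 * s) = y 0 * y 1 * y 2"
    proof -
      obtain i t where it: "i = k mod 3" "t = s mod 3" by blast
      have c: "[k = i] (mod 3)" "[s = t] (mod 3)" by (simp_all add: it cong_def)
      have ym: "y j = y (m mod 3)" if "[j = m] (mod 3)" for j m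
        using that by (intro y_cong) (simp add: cong_def)
      have yk: "y k = y i" and yk': "y (k + 2 * s) = y ((i + 2 * t) mod 3)"
        "y (k + 2 * s + 2 * s) = y ((i + 2 * t + 2 * t) mod 3)"
        by (intro y_cong ym cong_add cong_scalar_left c)+
      have "t = 1 \<or> t = 2" "i = 0 \<or> i = 1 \<or> i = 2" using s unfolding it by presburger+
      thus ?thesis unfolding yk' yk by (elim disjE) (simp_all add: mult_ac numeral_2_eq_2)
    qed
    also have "acong p (y 0 * y 1 * y 2) 0"
      using dvd_imp_acong[of p "\<Phi> x" 0] dvd unfolding y_def \<Phi>_factor[symmetric] by simp
    finally have "acong p (y k ^ (1 + p + p * p)) 0"
      by (simp add: power_add power_mult mult_ac)
    hence "acong p (y k ^ (p * p * p - (1 + p + p * p)) * y k ^ (1 + p + p * p)) (y k ^ (p * p * p - (1 + p + p * p)) * 0)"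
      by (intro acong_mult_left algebraic_int_intros y)
    moreover have "1 + p + p * p \<le> p * p * p"
    proof -
      have "1 + p + p * p \<le> 2 * (p * p)"
        using p1 by (cases p) auto
      also have "\<dots> \<le> p * (p * p)" using p1 by (intro mult_right_mono) auto
      finally show ?thesis by (simp add: mult.assoc)
    qed
    ultimately have "acong p (y k ^ (p * p * p)) 0"
      by (simp only: power_add[symmetric] le_add_diff_inverse2 mult_zero_right)
    with f3 show ?thesis by (metis acong_trans acong_sym)
  qed
  have d: "acong p (rt i - rt j) 0" for i j
    using acong_diff[OF zero[of j] zero[of i]] by (simp add: y_def)
  have "acong p ((rt 0 - rt 1) * (rt 1 - rt 2) * (rt 2 - rt 0)) ((rt 0 - rt 1) * (rt 1 - rt 2) * 0)"
    by (intro acong_mult_left d algebraic_int_intros algebraic_int_rt)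
  hence "int p dvd 9 * b"
    unfolding cubic_disc using p1 by (intro acong_of_int_0_imp_dvd) auto
  hence "int p dvd 3 ^ 2" using b p(1) prime_dvd_mult_iff[of "int p" 9 b] by auto
  hence "int p dvd 3" using p(1) prime_dvd_power[of "int p" 3 2] by auto
  hence "p dvd 3" by presburger
  thus False using p primes_dvd_imp_eq[of p 3] by auto
qed

end

section \<open>Primitive elements\<close>

interpretation of_rat_poly_hom: map_poly_inj_idom_hom "of_rat :: rat \<Rightarrow> 'a::field_char_0" ..

lemma map_poly_of_rat_of_int: "map_poly (of_rat :: rat \<Rightarrow> 'a::field_char_0) (map_poly of_int p) = map_poly of_int p"
  by (rule poly_eqI) (simp add: coeff_map_poly)

lemma common_denominator:
  fixes c :: "'b \<Rightarrow> rat"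
  assumes "finite I"
  obtains m :: int and d :: "'b \<Rightarrow> int" where "m > 0" "\<And>i. i \<in> I \<Longrightarrow> of_int m * c i = of_int (d i)"
proof -
  define den where "den = (\<lambda>i. snd (quotient_of (c i)))"
  define m where "m = (\<Prod>i\<in>I. den i)"
  have den: "den i > 0" for i by (simp add: den_def quotient_of_denom_pos')
  have "\<exists>d. of_int m * c i = of_int d" if i: "i \<in> I" for i
  proof -
    obtain a where "c i = of_int a / of_int (den i)"
      unfolding den_def using quotient_of_div[of "c i"] by (metis prod.collapse)
    moreover have "m = den i * (\<Prod>j\<in>I - {i}. den j)"
      unfolding m_def using assms i by (rule prod.remove)
    ultimately have "of_int m * c i = of_int (a * (\<Prod>j\<in>I - {i}. den j))"
      using den[of i] by simp
    thus ?thesis ..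
  qed
  then obtain d where "\<And>i. i \<in> I \<Longrightarrow> of_int m * c i = of_int (d i)" by metis
  moreover have "m > 0" unfolding m_def using den by (intro prod_pos) auto
  ultimately show ?thesis using that by blast
qed

lemma common_denominator_poly:
  fixes q :: "rat poly"
  obtains m :: int and q' :: "int poly" where "m > 0" "Polynomial.smult (of_int m) q = map_poly of_int q'"
proof -
  obtain m :: int and d where md: "m > 0" "\<And>i. i \<in> {..Polynomial.degree q} \<Longrightarrow> of_int m * Polynomial.coeff q i = of_int (d i)"
    using common_denominator[of "{..Polynomial.degree q}" "Polynomial.coeff q"] by blast
  define q' where "q' = (\<Sum>i\<le>Polynomial.degree q. Polynomial.monom (d i) i)"
  have "Polynomial.smult (of_int m) q = map_poly of_int q'"
  proof (rule poly_eqI)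
    fix i
    have "Polynomial.coeff q' i = (if i \<le> Polynomial.degree q then d i else 0)"
      by (simp add: q'_def coeff_sum)
    thus "Polynomial.coeff (Polynomial.smult (of_int m) q) i = Polynomial.coeff (map_poly of_int q') i"
      using md(2)[of i] by (simp add: coeff_map_poly coeff_eq_0)
  qed
  with md(1) show ?thesis by (rule that)
qed

context
  fixes ty :: "'k::field_char_0 itself"
  assumes nf: "number_field ty"
begin

text \<open>Here d is the dimension over the rationals. The relation is stated for families, so a
  repeated member needs its own relation f i - f j = 0.\<close>

lemma number_field_relation:
  obtains d where "\<And>f :: nat \<Rightarrow> 'k. \<exists>c :: nat \<Rightarrow> rat. (\<exists>i\<le>d. c i \<noteq> 0) \<and> (\<Sum>i\<le>d. of_rat (c i) * f i) = 0"
proof -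
  obtain B where "finite_dimensional_vector_space (\<lambda>(q::rat) (x::'k). of_rat q * x) B"
    using nf unfolding number_field_def by blast
  then interpret V: finite_dimensional_vector_space "\<lambda>(q::rat) (x::'k). of_rat q * x" B .
  define d where "d = V.dim UNIV"
  have "\<exists>c :: nat \<Rightarrow> rat. (\<exists>i\<le>d. c i \<noteq> 0) \<and> (\<Sum>i\<le>d. of_rat (c i) * f i) = 0" for f :: "nat \<Rightarrow> 'k"
  proof (cases "inj_on f {..d}")
    case True
    have "card (f ` {..d}) > V.dim (f ` {..d})"
      using card_image[OF True] V.dim_subset_UNIV[of "f ` {..d}"] by (simp add: d_def V.dimension_def)
    hence "V.dependent (f ` {..d})"
      using V.independent_bound_general[of "f ` {..d}"] by auto
    then obtain u where u: "\<exists>v\<in>f ` {..d}. u v \<noteq> 0" "(\<Sum>v\<in>f ` {..d}. of_rat (u v) * v) = 0"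
      using V.dependent_finite[of "f ` {..d}"] by auto
    show ?thesis
      by (rule exI[of _ "\<lambda>i. u (f i)"]) (use u True in \<open>auto simp: sum.reindex\<close>)
  next
    case False
    then obtain i j where ij: "i \<le> d" "j \<le> d" "i \<noteq> j" "f i = f j" by (auto simp: inj_on_def)
    define c :: "nat \<Rightarrow> rat" where "c = (\<lambda>k. (if k = i then 1 else 0) - (if k = j then 1 else 0))"
    have "(\<Sum>k\<le>d. of_rat (c k) * f k) = (\<Sum>k\<le>d. (if k = i then f k else 0) - (if k = j then f k else 0))"
      by (intro sum.cong refl) (auto simp: c_def)
    also have "\<dots> = 0" using ij by (simp add: sum_subtractf)
    finally show ?thesis using ij by (intro exI[of _ c]) (auto simp: c_def)
  qed
  thus ?thesis using that by blast
qed

lemma number_field_int_relation: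
  obtains d where "\<And>f :: nat \<Rightarrow> 'k. \<exists>c :: nat \<Rightarrow> int. (\<exists>i\<le>d. c i \<noteq> 0) \<and> (\<Sum>i\<le>d. of_int (c i) * f i) = 0"
proof -
  obtain d where d: "\<And>f :: nat \<Rightarrow> 'k. \<exists>c :: nat \<Rightarrow> rat. (\<exists>i\<le>d. c i \<noteq> 0) \<and> (\<Sum>i\<le>d. of_rat (c i) * f i) = 0"
    using number_field_relation by blast
  have "\<exists>c :: nat \<Rightarrow> int. (\<exists>i\<le>d. c i \<noteq> 0) \<and> (\<Sum>i\<le>d. of_int (c i) * f i) = 0" for f :: "nat \<Rightarrow> 'k"
  proof -
    obtain c :: "nat \<Rightarrow> rat" where c: "\<exists>i\<le>d. c i \<noteq> 0" "(\<Sum>i\<le>d. of_rat (c i) * f i) = 0"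
      using d by blast
    obtain m :: int and c' where m: "m > 0" "\<And>i. i \<in> {..d} \<Longrightarrow> of_int m * c i = of_int (c' i)"
      using common_denominator[of "{..d}" c] by blast
    have "(\<Sum>i\<le>d. of_int (c' i) * f i) = (\<Sum>i\<le>d. of_int m * (of_rat (c i) * f i))"
    proof (intro sum.cong refl)
      fix i assume "i \<in> {..d}"
      from arg_cong[OF m(2)[OF this], of "of_rat :: rat \<Rightarrow> 'k"]
      show "of_int (c' i) * f i = of_int m * (of_rat (c i) * f i)" by (simp add: of_rat_mult)
    qed
    also have "\<dots> = 0" using c(2) by (simp flip: sum_distrib_left)
    finally have "(\<Sum>i\<le>d. of_int (c' i) * f i) = 0" .
    moreover have "\<exists>i\<le>d. c' i \<noteq> 0"
    proof -
      obtain i where i: "i \<le> d" "c i \<noteq> 0" using c(1) by blast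
      hence "of_int m * c i \<noteq> 0" using m(1) by simp
      hence "of_int (c' i) \<noteq> (0::rat)" using m(2)[of i] i by simp
      thus ?thesis using i by auto
    qed
    ultimately show ?thesis by blast
  qed
  thus ?thesis using that by blast
qed

lemma number_field_algebraic:
  fixes x :: 'k
  obtains p :: "int poly" where "p \<noteq> 0" "poly (map_poly of_int p) x = 0"
proof -
  obtain d where d: "\<And>f :: nat \<Rightarrow> 'k. \<exists>c :: nat \<Rightarrow> int. (\<exists>i\<le>d. c i \<noteq> 0) \<and> (\<Sum>i\<le>d. of_int (c i) * f i) = 0"
    using number_field_int_relation by blast
  obtain c :: "nat \<Rightarrow> int" where c: "\<exists>i\<le>d. c i \<noteq> 0" "(\<Sum>i\<le>d. of_int (c i) * x ^ i) = 0"
    using d[of "\<lambda>i. x ^ i"] by blast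
  define p where "p = (\<Sum>i\<le>d. Polynomial.monom (c i) i)"
  have cp: "Polynomial.coeff p i = (if i \<le> d then c i else 0)" for i
    by (simp add: p_def coeff_sum)
  have "p \<noteq> 0" using c(1) cp by (metis Polynomial.coeff_0)
  moreover have "poly (map_poly of_int p) x = (\<Sum>i\<le>d. of_int (c i) * x ^ i)"
    unfolding p_def by (simp add: of_int_poly_hom.hom_sum poly_sum poly_monom)
  ultimately show ?thesis using that c(2) by metis
qed

end

lemma algebraic_int_scaled:
  fixes x :: "'a::field_char_0" and p :: "int poly"
  assumes "p \<noteq> 0" "poly (map_poly of_int p) x = 0"
  obtains m :: int where "m \<noteq> 0" "algebraic_int (of_int m * x)"
proof -
  define n where "n = Polynomial.degree p"
  define m where "m = Polynomial.lead_coeff p"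
  have m: "m \<noteq> 0" using assms(1) by (simp add: m_def)
  have n: "n > 0"
  proof (rule ccontr)
    assume "\<not> n > 0"
    then obtain c where "p = [:c:]" unfolding n_def by (metis degree_eq_zeroE gr0I)
    with assms show False by (simp add: map_poly_pCons)
  qed
  define z where "z = of_int m * x"
  have "0 = (\<Sum>i\<le>n. of_int (Polynomial.coeff p i) * x ^ i)"
    using assms(2) by (simp add: poly_altdef n_def coeff_map_poly)
  also have "\<dots> = (\<Sum>i<n. of_int (Polynomial.coeff p i) * x ^ i) + of_int m * x ^ n"
    by (simp add: n_def m_def lessThan_Suc_atMost[symmetric])
  finally have "of_int m * x ^ n = (\<Sum>i<n. of_int (- Polynomial.coeff p i) * x ^ i)"
    by (simp add: sum_negf eq_neg_iff_add_eq_0 add.commute)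
  \<comment> \<open>The factor m^(n - 1) turns the equation for x into a monic one for z = m
    x.\<close>
  hence "of_int m ^ (n - 1) * (of_int m * x ^ n)
     = (\<Sum>i<n. of_int m ^ (n - 1) * (of_int (- Polynomial.coeff p i) * x ^ i))"
    by (simp only: sum_distrib_left)
  also have "of_int m ^ (n - 1) * (of_int m * x ^ n) = z ^ n"
    using n by (cases n) (simp_all add: z_def power_mult_distrib)
  also have "(\<Sum>i<n. of_int m ^ (n - 1) * (of_int (- Polynomial.coeff p i) * x ^ i))
     = (\<Sum>i<n. of_int (m ^ (n - 1 - i) * (- Polynomial.coeff p i)) * z ^ i)"
  proof (intro sum.cong refl)
    fix i assume "i \<in> {..<n}"
    hence "(of_int m :: 'a) ^ (n - 1) = of_int m ^ (n - 1 - i) * of_int m ^ i"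
      by (simp flip: power_add)
    thus "(of_int m :: 'a) ^ (n - 1) * (of_int (- Polynomial.coeff p i) * x ^ i)
      = of_int (m ^ (n - 1 - i) * (- Polynomial.coeff p i)) * z ^ i"
      by (simp add: z_def power_mult_distrib)
  qed
  finally have zn: "z ^ n \<in> zspan (\<lambda>i. z ^ i) n" by (rule zspanI)
  have "z * z ^ k \<in> zspan (\<lambda>i. z ^ i) n" if "k < n" for k
    using that zn zspan_base[of "Suc k" n "\<lambda>i. z ^ i"] by (cases "Suc k = n") auto
  hence "algebraic_int z" using n by (rule algebraic_int_if_zspan_stable[of n _ _ 0]) auto
  with m show ?thesis using that unfolding z_def by blast
qed

text \<open>Closure under \<open>inverse\<close> can be asked of every element, because
  \<open>inverse 0 = 0\<close>. Differences supply 0 and negatives, and with them sums.\<close>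

definition subfield_of :: "'a::field set \<Rightarrow> bool" where
  "subfield_of S \<longleftrightarrow> 1 \<in> S \<and> (\<forall>x\<in>S. \<forall>y\<in>S. x - y \<in> S \<and> x * y \<in> S \<and> inverse x \<in> S)"

lemma subfield_ofD:
  assumes "subfield_of S"
  shows "0 \<in> S" "1 \<in> S" "x \<in> S \<Longrightarrow> y \<in> S \<Longrightarrow> x + y \<in> S" "x \<in> S \<Longrightarrow> y \<in> S \<Longrightarrow> x - y \<in> S"
    "x \<in> S \<Longrightarrow> - x \<in> S"
    "x \<in> S \<Longrightarrow> y \<in> S \<Longrightarrow> x * y \<in> S" "x \<in> S \<Longrightarrow> inverse x \<in> S" "x \<in> S \<Longrightarrow> y \<in> S \<Longrightarrow> x / y \<in> S"
proof -
  have 0: "0 \<in> S" using assms unfolding subfield_of_def by (metis diff_self)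
  have m: "- x \<in> S" if "x \<in> S" for x using assms that 0 unfolding subfield_of_def by (metis diff_0)
  show "0 \<in> S" "1 \<in> S" "x \<in> S \<Longrightarrow> y \<in> S \<Longrightarrow> x - y \<in> S" "x \<in> S \<Longrightarrow> - x \<in> S"
    "x \<in> S \<Longrightarrow> y \<in> S \<Longrightarrow> x * y \<in> S" "x \<in> S \<Longrightarrow> inverse x \<in> S" "x \<in> S \<Longrightarrow> y \<in> S \<Longrightarrow> x / y \<in> S"
    using assms 0 m unfolding subfield_of_def divide_inverse by auto
  show "x \<in> S \<Longrightarrow> y \<in> S \<Longrightarrow> x + y \<in> S"
    using assms m[of y] unfolding subfield_of_def by (metis diff_minus_eq_add)
qed

lemma subfield_of_nat: "subfield_of S \<Longrightarrow> of_nat n \<in> S"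
  by (induction n) (auto intro: subfield_ofD)

lemma subfield_of_int: "subfield_of S \<Longrightarrow> of_int n \<in> S"
  by (cases n) (auto intro: subfield_ofD subfield_of_nat simp del: of_nat_Suc)

lemma subfield_of_rat:
  fixes S :: "'a::field_char_0 set"
  shows "subfield_of S \<Longrightarrow> of_rat q \<in> S"
  by (cases q) (auto simp: of_rat_rat intro: subfield_ofD subfield_of_int)

lemma subfield_sum: "subfield_of S \<Longrightarrow> (\<And>i. i \<in> I \<Longrightarrow> f i \<in> S) \<Longrightarrow> sum f I \<in> S"
  by (induction I rule: infinite_finite_induct) (auto intro: subfield_ofD)

definition field_gen :: "'a::field \<Rightarrow> 'a set" where
  "field_gen x = \<Inter>{S. subfield_of S \<and> x \<in> S}"

lemma subfield_field_gen: "subfield_of (field_gen x)"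
  unfolding field_gen_def by (subst subfield_of_def) (auto intro: subfield_ofD)

lemma field_gen_self: "x \<in> field_gen x"
  unfolding field_gen_def by auto

lemma field_gen_least: "subfield_of S \<Longrightarrow> x \<in> S \<Longrightarrow> field_gen x \<subseteq> S"
  unfolding field_gen_def by auto

definition coeffs_in :: "'a::zero set \<Rightarrow> 'a poly \<Rightarrow> bool" where
  "coeffs_in S p \<longleftrightarrow> (\<forall>i. Polynomial.coeff p i \<in> S)"

lemma coeffs_in_arith:
  assumes "subfield_of S" "coeffs_in S p" "coeffs_in S q"
  shows "coeffs_in S (p + q)" "coeffs_in S (p - q)" "coeffs_in S (p * q)"
  using assms subfield_ofD[OF assms(1)] unfolding coeffs_in_def
  by (auto simp: coeff_mult intro!: subfield_sum)

text \<open>The subfield is a set inside a larger type, so minimal polynomials over it need a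
  Euclidean division whose quotient and remainder stay in the set.\<close>

lemma division_over_subfield:
  assumes S: "subfield_of S" and h: "coeffs_in S h" "h \<noteq> 0"
  shows "coeffs_in S p \<Longrightarrow> \<exists>q r. coeffs_in S q \<and> coeffs_in S r \<and> p = q * h + r \<and> (r = 0 \<or> Polynomial.degree r < Polynomial.degree h)"
proof (induction "Polynomial.degree p" arbitrary: p rule: less_induct)
  case less
  show ?case
  proof (cases "p = 0 \<or> Polynomial.degree p < Polynomial.degree h")
    case True
    thus ?thesis using less.prems subfield_ofD(1)[OF S] by (intro exI[of _ 0] exI[of _ p]) (auto simp: coeffs_in_def)
  next
    case False
    define c where "c = Polynomial.lead_coeff p / Polynomial.lead_coeff h"
    define n where "n = Polynomial.degree p - Polynomial.degree h"
    define m where "m = Polynomial.monom c n"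
    have c: "c \<in> S" "c \<noteq> 0"
      using less.prems h False subfield_ofD(8)[OF S] by (auto simp: c_def coeffs_in_def)
    hence m: "coeffs_in S m" using subfield_ofD(1)[OF S] by (auto simp: m_def coeffs_in_def)
    define p' where "p' = p - m * h"
    have p': "coeffs_in S p'" unfolding p'_def using less.prems m h coeffs_in_arith[OF S] by blast
    have dm: "Polynomial.degree (m * h) = Polynomial.degree p"
      using c h False by (simp add: m_def degree_mult_eq Polynomial.degree_monom_eq n_def)
    have "Polynomial.lead_coeff (m * h) = Polynomial.lead_coeff p"
      using c h False by (simp add: lead_coeff_mult m_def Polynomial.degree_monom_eq c_def)
    hence "p' = 0 \<or> Polynomial.degree p' < Polynomial.degree p"
      unfolding p'_def using dm False
      by (metis (no_types, lifting) Polynomial.coeff_diff Polynomial.degree_diff_le diff_self le_refl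
          leading_coeff_0_iff order_le_imp_less_or_eq)
    then obtain q r where qr: "coeffs_in S q" "coeffs_in S r" "p' = q * h + r" "r = 0 \<or> Polynomial.degree r < Polynomial.degree h"
    proof
      assume "p' = 0"
      thus ?thesis using that[of 0 0] subfield_ofD(1)[OF S] by (auto simp: coeffs_in_def)
    next
      assume "Polynomial.degree p' < Polynomial.degree p"
      from less.hyps[OF this p'] show ?thesis using that by blast
    qed
    have "p = (q + m) * h + r" using qr(3) by (simp add: p'_def algebra_simps)
    thus ?thesis using qr m coeffs_in_arith[OF S] by blast
  qed
qed

text \<open>
  The usual argument: for all but finitely many \<open>k\<close> the minimal polynomial of \<open>\<beta>\<close> over
  \<open>\<rat>(\<theta> + k \<beta>)\<close> divides both \<open>g\<close> and \<open>f(\<theta> + k \<beta> - k X)\<close>, whose only common root is \<open>\<beta>\<close>.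
\<close>

lemma primitive_element:
  fixes \<theta> \<beta> :: "'a::{alg_closed_field, field_char_0}" and f g0 :: "rat poly"
  assumes f: "f \<noteq> 0" "poly (map_poly of_rat f) \<theta> = 0"
    and g0: "g0 \<noteq> 0" "poly (map_poly of_rat g0) \<beta> = 0"
  obtains k :: nat where "\<theta> \<in> field_gen (\<theta> + of_nat k * \<beta>)" "\<beta> \<in> field_gen (\<theta> + of_nat k * \<beta>)"
proof -
  obtain g :: "rat poly" where g: "g \<noteq> 0" "poly (map_poly of_rat g) \<beta> = 0"
    and g_min: "\<And>q :: rat poly. q \<noteq> 0 \<Longrightarrow> poly (map_poly of_rat q) \<beta> = 0 \<Longrightarrow> Polynomial.degree g \<le> Polynomial.degree q"
    using ex_has_least_nat[of "\<lambda>q :: rat poly. q \<noteq> 0 \<and> poly (map_poly of_rat q) \<beta> = 0" g0 Polynomial.degree] g0 by metis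
  define gL where "gL = map_poly (of_rat :: rat \<Rightarrow> 'a) g"
  define fL where "fL = map_poly (of_rat :: rat \<Rightarrow> 'a) f"
  have L0: "gL \<noteq> 0" "fL \<noteq> 0" using g(1) f(1) by (auto simp: gL_def fL_def)
  have dg: "Polynomial.degree g > 0"
  proof (rule ccontr)
    assume "\<not> Polynomial.degree g > 0"
    then obtain c where "g = [:c:]" by (metis degree_eq_zeroE gr0I)
    with g show False by (simp add: map_poly_pCons)
  qed
  have g': "poly (pderiv gL) \<beta> \<noteq> 0"
  proof
    assume 0: "poly (pderiv gL) \<beta> = 0"
    have "pderiv gL = map_poly of_rat (pderiv g)"
      unfolding gL_def by (rule of_rat_hom.map_poly_pderiv[symmetric])
    moreover have "pderiv g \<noteq> 0" using dg by (simp add: pderiv_eq_0_iff)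
    ultimately have "Polynomial.degree g \<le> Polynomial.degree (pderiv g)" using 0 by (intro g_min) simp_all
    thus False using dg by (simp add: degree_pderiv)
  qed
  \<comment> \<open>A value k is bad if theta + k beta = r + k s for roots r of f and s of g with s
    different from beta. Pairs with s = beta contribute only the value 0, because division by zero
    gives 0; this merely excludes k = 0.\<close>
  define bad where "bad = (\<lambda>(r, s). (r - \<theta>) / (\<beta> - s)) ` ({x. poly fL x = 0} \<times> {x. poly gL x = 0})"
  have "finite bad" unfolding bad_def using L0 by (intro finite_imageI finite_cartesian_product poly_roots_finite)
  hence "finite {k :: nat. of_nat k \<in> bad}"
    by (rule finite_vimageI[of bad "of_nat", unfolded vimage_def]) (simp add: inj_of_nat)
  then obtain k :: nat where k: "of_nat k \<notin> bad"
    using ex_new_if_finite[OF infinite_UNIV_nat] by blast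
  define \<gamma> where "\<gamma> = \<theta> + of_nat k * \<beta>"
  define E where "E = field_gen \<gamma>"
  have E: "subfield_of E" unfolding E_def by (rule subfield_field_gen)
  define F where "F = fL \<circ>\<^sub>p [:\<gamma>, - of_nat k:]"
  have coE: "coeffs_in E gL" "coeffs_in E fL"
    unfolding gL_def fL_def coeffs_in_def using subfield_of_rat[OF E] by (simp_all add: coeff_map_poly)
  have "coeffs_in E [:\<gamma>, - of_nat k:]"
    unfolding coeffs_in_def coeff_pCons
    using field_gen_self[of \<gamma>] subfield_ofD(1)[OF E] subfield_ofD(5)[OF E subfield_of_nat[OF E, of k]]
    by (auto simp: E_def split: nat.splits)
  hence coF: "coeffs_in E F"
    unfolding F_def using coE(2) subfield_ofD(1,3,6)[OF E]
    by (auto simp: coeffs_in_def intro!: coeff_pcompose_semiring_closed)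
  have F\<beta>: "poly F \<beta> = 0" using f(2) by (simp add: F_def poly_pcompose \<gamma>_def fL_def)
  obtain h where h: "h \<noteq> 0" "coeffs_in E h" "poly h \<beta> = 0"
    and h_min: "\<And>q. q \<noteq> 0 \<Longrightarrow> coeffs_in E q \<Longrightarrow> poly q \<beta> = 0 \<Longrightarrow> Polynomial.degree h \<le> Polynomial.degree q"
    using ex_has_least_nat[of "\<lambda>q. q \<noteq> 0 \<and> coeffs_in E q \<and> poly q \<beta> = 0" gL Polynomial.degree] L0 coE g(2)
    unfolding gL_def by metis
  have h_dvd: "h dvd p" if p: "coeffs_in E p" "poly p \<beta> = 0" for p
  proof -
    obtain q r where qr: "coeffs_in E r" "p = q * h + r" "r = 0 \<or> Polynomial.degree r < Polynomial.degree h"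
      using division_over_subfield[OF E h(2,1) p(1)] by blast
    have "poly r \<beta> = 0" using p(2) h(3) by (simp add: qr(2))
    hence "r = 0" using h_min[of r] qr by force
    thus ?thesis using qr(2) by simp
  qed
  have root: "x = \<beta>" if x: "poly h x = 0" for x
  proof (rule ccontr)
    assume ne: "x \<noteq> \<beta>"
    have "poly gL x = 0" using h_dvd[OF coE(1)] g(2) x by (auto simp: gL_def dvd_def)
    moreover have "poly F x = 0" using h_dvd[OF coF F\<beta>] x by (auto simp: dvd_def)
    hence "poly fL (\<gamma> - of_nat k * x) = 0" by (simp add: F_def poly_pcompose algebra_simps)
    ultimately have "((\<gamma> - of_nat k * x) - \<theta>) / (\<beta> - x) \<in> bad" unfolding bad_def by force
    moreover have "((\<gamma> - of_nat k * x) - \<theta>) / (\<beta> - x) = of_nat k"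
      using ne by (simp add: \<gamma>_def field_simps)
    ultimately show False using k by simp
  qed
  have "[:- \<beta>, 1:] dvd h" using h(3) by (simp add: poly_eq_0_iff_dvd)
  then obtain h2 where h2: "h = [:- \<beta>, 1:] * h2" by blast
  \<comment> \<open>A further root of h could only be beta again, which would make beta a double
    root of g, against the nonvanishing derivative. So h is linear and its two coefficients exhibit
    beta in E.\<close>
  have "Polynomial.degree h2 = 0"
  proof (rule ccontr)
    assume "Polynomial.degree h2 \<noteq> 0"
    then obtain x where "poly h2 x = 0" using alg_closed_imp_poly_has_root by blast
    hence "poly h2 \<beta> = 0" using root[of x] h2 by simp
    then obtain h3 where h3: "h2 = [:- \<beta>, 1:] * h3" by (auto simp: poly_eq_0_iff_dvd)
    obtain e where "gL = h * e" using h_dvd[OF coE(1)] g(2) by (auto simp: gL_def dvd_def)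
    hence "gL = [:- \<beta>, 1:] * ([:- \<beta>, 1:] * (h3 * e))" by (simp only: h2 h3 mult_ac)
    hence "poly (pderiv gL) \<beta> = 0" by (simp only: pderiv_mult poly_add poly_mult) simp
    thus False using g' by simp
  qed
  then obtain c where c: "h2 = [:c:]" by (rule degree_eq_zeroE)
  have "c \<noteq> 0" using h(1) h2 c by auto
  have "Polynomial.coeff h 0 \<in> E" "Polynomial.coeff h 1 \<in> E" using h(2) by (auto simp: coeffs_in_def)
  hence "- (\<beta> * c) \<in> E" "c \<in> E" by (simp_all add: h2 c coeff_pCons mult.commute)
  hence "- (- (\<beta> * c)) / c \<in> E" using subfield_ofD(5,8)[OF E] by blast
  hence \<beta>E: "\<beta> \<in> E" using \<open>c \<noteq> 0\<close> by simp
  hence "\<gamma> - of_nat k * \<beta> \<in> E"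
    using subfield_ofD(4,6)[OF E] subfield_of_nat[OF E] field_gen_self unfolding E_def by blast
  hence "\<theta> \<in> E" by (simp add: \<gamma>_def)
  with \<beta>E show ?thesis using that[of k] unfolding E_def \<gamma>_def by blast
qed

lemma algebraic_int_rat_poly:
  fixes x :: "'a::field_char_0"
  assumes "algebraic_int x"
  obtains q :: "rat poly" where "q \<noteq> 0" "poly (map_poly of_rat q) x = 0"
proof -
  obtain p :: "int poly" where p: "poly (map_poly of_int p) x = 0" "Polynomial.lead_coeff p = 1"
    using assms unfolding algebraic_int_altdef_ipoly by blast
  have "map_poly (of_int :: int \<Rightarrow> rat) p \<noteq> 0" using p(2) by auto
  thus ?thesis using that[of "map_poly of_int p"] p(1) by (simp add: map_poly_of_rat_of_int)
qed

lemma primitive_element_finite: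
  fixes A :: "'a::{alg_closed_field, field_char_0} set"
  assumes "finite A" "\<And>x. x \<in> A \<Longrightarrow> algebraic_int x"
  shows "\<exists>\<gamma>. algebraic_int \<gamma> \<and> A \<subseteq> field_gen \<gamma>"
  using assms
proof (induction A rule: finite_induct)
  case empty
  thus ?case by (intro exI[of _ 0]) auto
next
  case (insert x A)
  then obtain \<theta> where \<theta>: "algebraic_int \<theta>" "A \<subseteq> field_gen \<theta>" by auto
  have x: "algebraic_int x" using insert.prems by simp
  obtain f where f: "f \<noteq> 0" "poly (map_poly of_rat f) \<theta> = 0" using algebraic_int_rat_poly[OF \<theta>(1)] .
  obtain g where g: "g \<noteq> 0" "poly (map_poly of_rat g) x = 0" using algebraic_int_rat_poly[OF x] .
  obtain k where k: "\<theta> \<in> field_gen (\<theta> + of_nat k * x)" "x \<in> field_gen (\<theta> + of_nat k * x)"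
    using primitive_element[OF f g] .
  have "field_gen \<theta> \<subseteq> field_gen (\<theta> + of_nat k * x)"
    using k(1) by (intro field_gen_least subfield_field_gen)
  moreover have "algebraic_int (\<theta> + of_nat k * x)" using \<theta>(1) x by (intro algebraic_int_intros)
  ultimately show ?case using \<theta>(2) k(2) by blast
qed

section \<open>Finite places\<close>

lemma integer_ring_simps [simp]:
  "carrier integer_ring = {x :: 'k::field_char_0. algebraic_int x}"
  "x \<oplus>\<^bsub>integer_ring\<^esub> y = x + y" "x \<otimes>\<^bsub>integer_ring\<^esub> y = x * (y :: 'k)"
  "\<zero>\<^bsub>integer_ring\<^esub> = (0 :: 'k)" "\<one>\<^bsub>integer_ring\<^esub> = (1 :: 'k)"
  by (simp_all add: integer_ring_def ring_of_type_algebra_def)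

lemma cring_integer_ring: "cring (integer_ring :: 'k::field_char_0 ring)"
proof (rule cringI)
  show "abelian_group (integer_ring :: 'k ring)"
  proof (rule abelian_groupI)
    show "\<exists>y\<in>carrier integer_ring. y \<oplus>\<^bsub>integer_ring\<^esub> x = \<zero>\<^bsub>integer_ring\<^esub>"
      if "x \<in> carrier integer_ring" for x :: 'k
      using that by (intro bexI[of _ "- x"]) auto
  qed (auto intro: algebraic_int_add)
  show "comm_monoid (integer_ring :: 'k ring)"
    by (rule comm_monoidI) (auto intro: algebraic_int_mult)
qed (auto simp: distrib_right)

text \<open>The nonzero prime ideals of the ring of integers, spelled out for elements so that no
  ring record appears in the arguments; \<open>finite_places_iff\<close> identifies the two
  forms.\<close>

definition place_ideal :: "'k::field_char_0 set \<Rightarrow> bool" where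
  "place_ideal P \<longleftrightarrow>
     (\<forall>x\<in>P. algebraic_int x) \<and> 0 \<in> P \<and> 1 \<notin> P \<and> P \<noteq> {0} \<and>
     (\<forall>x\<in>P. \<forall>y\<in>P. x + y \<in> P) \<and> (\<forall>x\<in>P. \<forall>a. algebraic_int a \<longrightarrow> a * x \<in> P) \<and>
     (\<forall>a b. algebraic_int a \<longrightarrow> algebraic_int b \<longrightarrow> a * b \<in> P \<longrightarrow> a \<in> P \<or> b \<in> P)"

lemma finite_places_iff:
  fixes P :: "'k::field_char_0 set"
  shows "P \<in> finite_places \<longleftrightarrow> place_ideal P"
proof
  assume "P \<in> finite_places"
  hence P: "primeideal P integer_ring" "P \<noteq> {0}" by (auto simp: finite_places_def)
  interpret primeideal P integer_ring by (rule P(1))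
  show "place_ideal P"
    unfolding place_ideal_def
  proof (intro conjI ballI allI impI)
    show "algebraic_int x" if "x \<in> P" for x using Icarr[OF that] by simp
    show "1 \<notin> P" using one_imp_carrier I_notcarr by auto
    show "0 \<in> P" using additive_subgroup.zero_closed[OF is_additive_subgroup] by simp
    show "P \<noteq> {0}" by (rule P(2))
    show "x + y \<in> P" if "x \<in> P" "y \<in> P" for x y
      using additive_subgroup.a_closed[OF is_additive_subgroup that] by simp
    show "a * x \<in> P" if "x \<in> P" "algebraic_int a" for x a
      using I_l_closed[of x a] that by simp
    show "a \<in> P \<or> b \<in> P" if "algebraic_int a" "algebraic_int b" "a * b \<in> P" for a b
      using I_prime[of a b] that by simp
  qed
next
  assume P: "place_ideal P"
  have minus: "- x \<in> P" if "x \<in> P" for x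
  proof -
    have "(- 1) * x \<in> P" using P that unfolding place_ideal_def by (metis algebraic_int_1 algebraic_int_minus)
    thus ?thesis by simp
  qed
  interpret R: cring "integer_ring :: 'k ring" by (rule cring_integer_ring)
  have inv: "\<ominus>\<^bsub>integer_ring\<^esub> x = - x" if "algebraic_int x" for x :: 'k
    using that by (intro R.minus_equality) auto
  have "ideal P integer_ring"
  proof (rule idealI)
    show "ring (integer_ring :: 'k ring)" by (rule R.ring_axioms)
    show "subgroup P (add_monoid integer_ring)"
    proof (rule R.add.subgroupI)
      show "P \<subseteq> carrier integer_ring" "P \<noteq> {}" using P by (auto simp: place_ideal_def)
      show "\<ominus>\<^bsub>integer_ring\<^esub> a \<in> P" if "a \<in> P" for a
        using that inv[of a] minus[of a] P by (auto simp: place_ideal_def)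
      show "a \<oplus>\<^bsub>integer_ring\<^esub> b \<in> P" if "a \<in> P" "b \<in> P" for a b
        using that P by (auto simp: place_ideal_def)
    qed
    show "x \<otimes>\<^bsub>integer_ring\<^esub> a \<in> P" "a \<otimes>\<^bsub>integer_ring\<^esub> x \<in> P"
      if "a \<in> P" "x \<in> carrier integer_ring" for a x
      using that P by (auto simp: place_ideal_def mult.commute)
  qed
  hence "primeideal P integer_ring"
    using P by (intro primeidealI R.is_cring) (auto simp: place_ideal_def)
  thus "P \<in> finite_places" using P by (simp add: finite_places_def place_ideal_def)
qed

lemma place_idealD:
  assumes "place_ideal P"
  shows "x \<in> P \<Longrightarrow> algebraic_int x" "0 \<in> P" "1 \<notin> P" "P \<noteq> {0}"
    "x \<in> P \<Longrightarrow> y \<in> P \<Longrightarrow> x + y \<in> P" "x \<in> P \<Longrightarrow> y \<in> P \<Longrightarrow> x - y \<in> P" "x \<in> P \<Longrightarrow> - x \<in> P"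
    "x \<in> P \<Longrightarrow> algebraic_int a \<Longrightarrow> a * x \<in> P" "x \<in> P \<Longrightarrow> algebraic_int a \<Longrightarrow> x * a \<in> P"
    "algebraic_int a \<Longrightarrow> algebraic_int b \<Longrightarrow> a * b \<in> P \<Longrightarrow> a \<in> P \<or> b \<in> P"
proof -
  have minus: "- x \<in> P" if "x \<in> P" for x
  proof -
    have "(- 1) * x \<in> P" using assms that unfolding place_ideal_def by (metis algebraic_int_1 algebraic_int_minus)
    thus ?thesis by simp
  qed
  show "x \<in> P \<Longrightarrow> algebraic_int x" "0 \<in> P" "1 \<notin> P" "P \<noteq> {0}"
    "x \<in> P \<Longrightarrow> y \<in> P \<Longrightarrow> x + y \<in> P" "x \<in> P \<Longrightarrow> - x \<in> P"
    "x \<in> P \<Longrightarrow> algebraic_int a \<Longrightarrow> a * x \<in> P"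
    "algebraic_int a \<Longrightarrow> algebraic_int b \<Longrightarrow> a * b \<in> P \<Longrightarrow> a \<in> P \<or> b \<in> P"
    using assms minus unfolding place_ideal_def by auto
  show "x \<in> P \<Longrightarrow> algebraic_int a \<Longrightarrow> x * a \<in> P"
    using assms unfolding place_ideal_def by (auto simp: mult.commute)
  show "x \<in> P \<Longrightarrow> y \<in> P \<Longrightarrow> x - y \<in> P"
    using assms minus[of y] unfolding place_ideal_def by (metis diff_conv_add_uminus)
qed

lemma place_sum: "place_ideal P \<Longrightarrow> (\<And>i. i \<in> I \<Longrightarrow> f i \<in> P) \<Longrightarrow> sum f I \<in> P"
  by (induction I rule: infinite_finite_induct) (auto intro: place_idealD)

lemma place_prod:
  assumes P: "place_ideal P" and "finite I" "\<And>i. i \<in> I \<Longrightarrow> algebraic_int (f i)" "prod f I \<in> P"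
  shows "\<exists>i\<in>I. f i \<in> P"
  using assms(2-)
proof (induction I rule: finite_induct)
  case (insert i I)
  have "f i \<in> P \<or> prod f I \<in> P"
    using insert by (intro place_idealD(10)[OF P]) (auto intro: algebraic_int_prod)
  thus ?case using insert by auto
qed (use place_idealD(3)[OF P] in auto)

lemma place_of_int_iff:
  assumes P: "place_ideal P" and p: "prime p" "of_nat p \<in> P"
  shows "of_int a \<in> P \<longleftrightarrow> int p dvd a"
proof
  assume "int p dvd a"
  then obtain c where "a = int p * c" ..
  thus "of_int a \<in> P" using place_idealD(8)[OF P p(2), of "of_int c"] by (simp add: mult.commute)
next
  assume a: "of_int a \<in> P"
  show "int p dvd a"
  proof (rule ccontr)
    assume "\<not> int p dvd a"
    hence "coprime (int p) a" using p(1) by (simp add: prime_imp_coprime)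
    then obtain u v where uv: "u * int p + v * a = 1"
      using bezout_int[of "int p" a] by (auto simp: coprime_iff_gcd_eq_1)
    have "of_int u * of_nat p + of_int v * of_int a \<in> P"
      using P p(2) a by (intro place_idealD(5,8)) auto
    also have "of_int u * of_nat p + of_int v * of_int a = (of_int (u * int p + v * a) :: 'a)" by simp
    finally show False using uv place_idealD(3)[OF P] by simp
  qed
qed

text \<open>An integer polynomial of least degree that annihilates a nonzero x in P has a nonzero
  constant term, and this term is a multiple of x. So P contains a positive integer, and primality
  passes to one of its prime factors.\<close>

lemma place_rational_prime:
  assumes P: "place_ideal P"
  obtains p where "prime p" "of_nat p \<in> P"
proof -
  obtain x where x: "x \<in> P" "x \<noteq> 0" using place_idealD(2,4)[OF P] by blast
  have ax: "algebraic_int x" using place_idealD(1)[OF P x(1)] .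
  then obtain q0 :: "int poly" where q0: "poly (map_poly of_int q0) x = 0" "Polynomial.lead_coeff q0 = 1"
    unfolding algebraic_int_altdef_ipoly by blast
  hence "q0 \<noteq> 0" by auto
  with q0 obtain q :: "int poly" where q: "q \<noteq> 0" "poly (map_poly of_int q) x = 0"
    and q_min: "\<And>q'. q' \<noteq> 0 \<Longrightarrow> poly (map_poly of_int q') x = 0 \<Longrightarrow> Polynomial.degree q \<le> Polynomial.degree q'"
    using ex_has_least_nat[of "\<lambda>q. q \<noteq> 0 \<and> poly (map_poly of_int q) x = 0" q0 Polynomial.degree] by metis
  obtain c q1 where cq: "q = pCons c q1" by (cases q)
  have "c \<noteq> 0"
  proof
    assume "c = 0"
    hence "poly (map_poly of_int q1) x = 0" "q1 \<noteq> 0" using q x(2) cq by (auto simp: of_int_hom.map_poly_pCons_hom)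
    hence "Polynomial.degree q \<le> Polynomial.degree q1" by (rule q_min[rotated])
    thus False using cq \<open>q1 \<noteq> 0\<close> by simp
  qed
  have "of_int c = - (x * poly (map_poly of_int q1) x)"
    using q(2) cq by (simp add: of_int_hom.map_poly_pCons_hom eq_neg_iff_add_eq_0)
  moreover have "algebraic_int (poly (map_poly of_int q1) x)"
    unfolding poly_altdef using ax by (intro algebraic_int_intros) (auto simp: coeff_map_poly)
  ultimately have "of_int c \<in> P" using place_idealD(7,9)[OF P] x(1) by metis
  hence "of_nat (nat \<bar>c\<bar>) \<in> P" using place_idealD(7)[OF P, of "of_int c"] by (cases "c \<ge> 0") auto
  define n where "n = nat \<bar>c\<bar>"
  have n: "n > 0" "of_nat n \<in> P" using \<open>c \<noteq> 0\<close> \<open>of_nat (nat \<bar>c\<bar>) \<in> P\<close> by (auto simp: n_def)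
  have "\<exists>p. prime p \<and> of_nat p \<in> P" if "n > 0" "of_nat n \<in> P" for n
    using that
  proof (induction n rule: less_induct)
    case (less n)
    have "n \<noteq> 1" using less.prems place_idealD(3)[OF P] by auto
    then obtain p where p: "prime p" "p dvd n" using prime_factor_nat by blast
    then obtain m where m: "n = p * m" by blast
    hence "of_nat p \<in> P \<or> of_nat m \<in> P"
      using less.prems by (intro place_idealD(10)[OF P]) auto
    thus ?case
    proof
      assume "of_nat m \<in> P"
      moreover have "m < n" "m > 0" using m less.prems prime_gt_1_nat[OF p(1)] by (auto intro: Nat.gr0I)
      ultimately show ?thesis using less.IH by blast
    qed (use p in blast)
  qed
  thus ?thesis using n that by blast
qed

text \<open>For x in Q outside P take a monic q of least degree with q(x) in P. Its constant term
  lies in Q, so p divides it and it lies in P as well. Removing it and cancelling x contradicts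
  minimality.\<close>

lemma places_over_prime_incomparable:
  fixes P Q :: "'k::field_char_0 set"
  assumes P: "place_ideal P" and Q: "place_ideal Q" and p: "prime p" "of_nat p \<in> P" and PQ: "P \<subseteq> Q"
  shows "P = Q"
proof (rule ccontr)
  assume "P \<noteq> Q"
  then obtain x where x: "x \<in> Q" "x \<notin> P" using PQ by blast
  have ax: "algebraic_int x" using place_idealD(1)[OF Q x(1)] .
  define good where "good = (\<lambda>q :: int poly. Polynomial.lead_coeff q = 1 \<and> poly (map_poly of_int q) x \<in> P)"
  have "\<exists>q. good q"
    using ax place_idealD(2)[OF P] unfolding algebraic_int_altdef_ipoly good_def by metis
  then obtain q where q: "good q" and q_min: "\<And>q'. good q' \<Longrightarrow> Polynomial.degree q \<le> Polynomial.degree q'"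
    using ex_has_least_nat[of good _ Polynomial.degree] by metis
  obtain c q1 where cq: "q = pCons c q1" by (cases q)
  have q1: "q1 \<noteq> 0"
  proof
    assume "q1 = 0"
    hence "poly (map_poly of_int q) x = 1" using q cq by (simp add: good_def of_int_hom.map_poly_pCons_hom)
    thus False using q place_idealD(3)[OF P] by (simp add: good_def)
  qed
  define y where "y = poly (map_poly of_int q1) x"
  have ay: "algebraic_int y"
    unfolding y_def poly_altdef using ax by (intro algebraic_int_intros) (auto simp: coeff_map_poly)
  have cy: "of_int c + x * y \<in> P" using q cq by (simp add: good_def of_int_hom.map_poly_pCons_hom y_def)
  have "of_int c + x * y - x * y \<in> Q"
    using cy PQ x(1) ay by (intro place_idealD(6,9)[OF Q]) auto
  hence "int p dvd c" using place_of_int_iff[OF Q p(1), of c] p(2) PQ by auto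
  hence "of_int c \<in> P" using place_of_int_iff[OF P p] by blast
  hence "of_int c + x * y - of_int c \<in> P" using cy place_idealD(6)[OF P] by blast
  hence "y \<in> P" using place_idealD(10)[OF P ax ay] x(2) by simp
  hence "good q1" using q cq q1 by (simp add: good_def y_def)
  thus False using q_min[of q1] cq q1 by simp
qed

text \<open>Incomparability gives, for d + 1 places over p, elements x i that lie in every P j
  except P i. In an integer relation between them, reduction at P i shows that p divides the i-th
  coefficient. A relation with least sum of absolute values cannot be divisible by p
  throughout.\<close>

lemma finite_places_over_prime:
  assumes nf: "number_field TYPE('k::field_char_0)" and p: "prime p"
  shows "finite {P :: 'k set. P \<in> finite_places \<and> of_nat p \<in> P}" (is "finite ?S")
proof (rule ccontr)
  assume inf: "infinite ?S"
  obtain d where d: "\<And>f :: nat \<Rightarrow> 'k. \<exists>c :: nat \<Rightarrow> int. (\<exists>i\<le>d. c i \<noteq> 0) \<and> (\<Sum>i\<le>d. of_int (c i) * f i) = 0"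
    using number_field_int_relation[OF nf] by blast
  obtain T where T: "T \<subseteq> ?S" "finite T" "card T = Suc d"
    using infinite_arbitrarily_large[OF inf] by blast
  obtain P where P: "bij_betw P {..d} T"
    using ex_bij_betw_nat_finite[OF T(2)] T(3) by (metis atLeast0LessThan lessThan_Suc_atMost)
  have Pi: "place_ideal (P i)" "of_nat p \<in> P i" if "i \<le> d" for i
    using that P T(1) by (auto simp: finite_places_iff bij_betw_def)
  have Pne: "P i \<noteq> P j" if "i \<le> d" "j \<le> d" "i \<noteq> j" for i j
    using that P by (auto simp: bij_betw_def inj_on_def)
  have "\<exists>x. x \<in> P j \<and> x \<notin> P i" if "i \<le> d" "j \<le> d" "i \<noteq> j" for i j
    using places_over_prime_incomparable[of "P j" "P i" p] that Pi Pne p by blast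
  then obtain w where w: "\<And>i j. i \<le> d \<Longrightarrow> j \<le> d \<Longrightarrow> i \<noteq> j \<Longrightarrow> w i j \<in> P j \<and> w i j \<notin> P i"
    by metis
  have aw: "algebraic_int (w i j)" if "i \<le> d" "j \<le> d" "i \<noteq> j" for i j
    using w[OF that] place_idealD(1)[OF Pi(1)] that by blast
  define x where "x = (\<lambda>i. \<Prod>j\<in>{..d} - {i}. w i j)"
  have ax: "algebraic_int (x i)" if "i \<le> d" for i
    unfolding x_def using aw that by (intro algebraic_int_prod) auto
  have xi: "x i \<notin> P i" if "i \<le> d" for i
  proof
    assume "x i \<in> P i"
    hence "\<exists>j\<in>{..d} - {i}. w i j \<in> P i"
      unfolding x_def using aw that by (intro place_prod Pi) auto
    thus False using w that by auto
  qed
  have xj: "x i \<in> P j" if "i \<le> d" "j \<le> d" "i \<noteq> j" for i j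
  proof -
    have "x i = w i j * (\<Prod>k\<in>{..d} - {i} - {j}. w i k)"
      unfolding x_def using that by (intro prod.remove) auto
    moreover have "algebraic_int (\<Prod>k\<in>{..d} - {i} - {j}. w i k)"
      using aw that by (intro algebraic_int_prod) auto
    ultimately show ?thesis using w[OF that] place_idealD(9)[OF Pi(1)[OF that(2)]] by simp
  qed
  define rel where "rel = (\<lambda>c :: nat \<Rightarrow> int. (\<exists>i\<le>d. c i \<noteq> 0) \<and> (\<Sum>i\<le>d. of_int (c i) * x i) = 0)"
  have "\<exists>c. rel c" using d[of x] unfolding rel_def by blast
  then obtain c where c: "rel c" and c_min: "\<And>c'. rel c' \<Longrightarrow> (\<Sum>i\<le>d. nat \<bar>c i\<bar>) \<le> (\<Sum>i\<le>d. nat \<bar>c' i\<bar>)"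
    using ex_has_least_nat[of rel _ "\<lambda>c. \<Sum>i\<le>d. nat \<bar>c i\<bar>"] by metis
  have dvd: "int p dvd c i" if i: "i \<le> d" for i
  proof -
    have "(\<Sum>j\<le>d. of_int (c j) * x j) = of_int (c i) * x i + (\<Sum>j\<in>{..d} - {i}. of_int (c j) * x j)"
      using i by (intro sum.remove) auto
    hence "of_int (c i) * x i = - (\<Sum>j\<in>{..d} - {i}. of_int (c j) * x j)"
      using c by (simp add: rel_def eq_neg_iff_add_eq_0)
    moreover have "(\<Sum>j\<in>{..d} - {i}. of_int (c j) * x j) \<in> P i"
      using i xj by (intro place_sum place_idealD(8)[OF Pi(1)] Pi) auto
    ultimately have "of_int (c i) * x i \<in> P i" using place_idealD(7)[OF Pi(1)[OF i]] by simp
    hence "of_int (c i) \<in> P i" using place_idealD(10)[OF Pi(1)[OF i] _ ax[OF i]] xi[OF i] by blast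
    thus ?thesis using place_of_int_iff[OF Pi(1)[OF i] p Pi(2)[OF i]] by blast
  qed
  define c' where "c' = (\<lambda>i. c i div int p)"
  have cc': "c i = int p * c' i" if "i \<le> d" for i using dvd[OF that] by (simp add: c'_def)
  have p1: "p > 1" using p by (rule prime_gt_1_nat)
  have "of_nat p * (\<Sum>i\<le>d. of_int (c' i) * x i) = (\<Sum>i\<le>d. of_int (c i) * x i)"
    unfolding sum_distrib_left by (intro sum.cong refl) (simp add: cc')
  hence "(\<Sum>i\<le>d. of_int (c' i) * x i) = 0" using c p1 by (auto simp: rel_def)
  moreover obtain i where i: "i \<le> d" "c i \<noteq> 0" using c by (auto simp: rel_def)
  ultimately have "rel c'" unfolding rel_def using cc'[OF i(1)] by auto
  hence "(\<Sum>i\<le>d. nat \<bar>c i\<bar>) \<le> (\<Sum>i\<le>d. nat \<bar>c' i\<bar>)" by (rule c_min)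
  moreover have "(\<Sum>i\<le>d. nat \<bar>c' i\<bar>) < (\<Sum>i\<le>d. nat \<bar>c i\<bar>)"
  proof (rule sum_strict_mono_ex1)
    show "\<forall>i\<in>{..d}. nat \<bar>c' i\<bar> \<le> nat \<bar>c i\<bar>"
    proof
      fix i assume "i \<in> {..d}"
      have "1 * \<bar>c' i\<bar> \<le> int p * \<bar>c' i\<bar>" using p1 by (intro mult_right_mono) auto
      thus "nat \<bar>c' i\<bar> \<le> nat \<bar>c i\<bar>" using cc'[of i] \<open>i \<in> {..d}\<close> by (simp add: abs_mult)
    qed
    have "1 * \<bar>c' i\<bar> < int p * \<bar>c' i\<bar>" using p1 i cc'[OF i(1)] by (intro mult_strict_right_mono) auto
    thus "\<exists>i\<in>{..d}. nat \<bar>c' i\<bar> < nat \<bar>c i\<bar>" using cc'[OF i(1)] i(1) by (intro bexI[of _ i]) (auto simp: abs_mult)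
  qed simp
  ultimately show False by simp
qed

section \<open>Denominators in simple extensions\<close>

definition integral_poly :: "'a::field_char_0 poly \<Rightarrow> bool" where
  "integral_poly p \<longleftrightarrow> (\<forall>i. algebraic_int (Polynomial.coeff p i))"

lemma integral_poly_arith:
  "integral_poly p \<Longrightarrow> integral_poly q \<Longrightarrow> integral_poly (p * q)"
  "integral_poly p \<Longrightarrow> algebraic_int c \<Longrightarrow> integral_poly (Polynomial.smult c p)"
  by (auto simp: integral_poly_def coeff_mult intro!: algebraic_int_intros)

lemma integral_poly_sum: "(\<And>i. i \<in> I \<Longrightarrow> integral_poly (f i)) \<Longrightarrow> integral_poly (sum f I)"
  by (auto simp: integral_poly_def coeff_sum intro!: algebraic_int_sum)

lemma integral_poly_1: "integral_poly 1"
  by (auto simp: integral_poly_def)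

lemma integral_poly_linear: "algebraic_int x \<Longrightarrow> integral_poly [:- x, 1:]"
  by (auto simp: integral_poly_def coeff_pCons split: nat.splits)

lemma integral_poly_prod: "(\<And>i. i \<in> I \<Longrightarrow> integral_poly (f i)) \<Longrightarrow> integral_poly (prod f I)"
  by (induction I rule: infinite_finite_induct) (auto intro: integral_poly_arith integral_poly_1)

lemma integral_poly_prod_mset: "(\<And>i. i \<in># I \<Longrightarrow> integral_poly (f i)) \<Longrightarrow> integral_poly (\<Prod>i\<in>#I. f i)"
  by (induction I) (auto intro: integral_poly_arith integral_poly_1)

lemma integral_rat_poly_is_int:
  fixes q :: "rat poly"
  assumes "integral_poly (map_poly of_rat q :: 'a::field_char_0 poly)"
  obtains q' :: "int poly" where "q = map_poly of_int q'"
proof -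
  have "\<exists>n. Polynomial.coeff q i = of_int n" for i
  proof -
    have "algebraic_int (of_rat (Polynomial.coeff q i) :: 'a)"
      using assms by (simp add: integral_poly_def coeff_map_poly)
    hence "(of_rat (Polynomial.coeff q i) :: 'a) \<in> \<int>"
      by (rule rational_algebraic_int_is_int) simp
    then obtain n where "(of_rat (Polynomial.coeff q i) :: 'a) = of_int n" by (elim Ints_cases)
    hence "(of_rat (Polynomial.coeff q i) :: 'a) = of_rat (of_int n)" by simp
    thus ?thesis by (auto simp only: of_rat_eq_iff)
  qed
  then obtain n where n: "\<And>i. Polynomial.coeff q i = of_int (n i)" by metis
  define q' where "q' = (\<Sum>i\<le>Polynomial.degree q. Polynomial.monom (n i) i)"
  have "q = map_poly of_int q'"
  proof (rule poly_eqI)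
    fix i
    have "Polynomial.coeff q' i = (if i \<le> Polynomial.degree q then n i else 0)"
      by (simp add: q'_def coeff_sum)
    thus "Polynomial.coeff q i = Polynomial.coeff (map_poly of_int q') i"
      using n[of i] coeff_eq_0[of q i] by (cases "i \<le> Polynomial.degree q") (simp_all add: coeff_map_poly)
  qed
  thus ?thesis by (rule that)
qed

section \<open>Minimal polynomials of algebraic integers\<close>

locale integral_min_poly =
  fixes \<gamma> :: "'a::{alg_closed_field, field_char_0}" and G :: "int poly"
  assumes monic: "Polynomial.lead_coeff G = 1" and root: "poly (map_poly of_int G) \<gamma> = 0"
    and minimal: "\<And>q :: rat poly. q \<noteq> 0 \<Longrightarrow> poly (map_poly of_rat q) \<gamma> = 0 \<Longrightarrow> Polynomial.degree G \<le> Polynomial.degree q"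

text \<open>The rational minimal polynomial divides a monic integer polynomial, so its roots are
  algebraic integers. Its coefficients are then algebraic integers and rational, hence
  integers.\<close>

lemma integral_min_poly_exists:
  fixes \<gamma> :: "'a::{alg_closed_field, field_char_0}"
  assumes "algebraic_int \<gamma>"
  obtains G where "integral_min_poly \<gamma> G"
proof -
  obtain p :: "int poly" where p: "poly (map_poly of_int p) \<gamma> = 0" "Polynomial.lead_coeff p = 1"
    using assms unfolding algebraic_int_altdef_ipoly by blast
  obtain q0 :: "rat poly" where "q0 \<noteq> 0" "poly (map_poly of_rat q0) \<gamma> = 0"
    using algebraic_int_rat_poly[OF assms] .
  then obtain m0 :: "rat poly" where m0: "m0 \<noteq> 0" "poly (map_poly of_rat m0) \<gamma> = 0"
    and m0_min: "\<And>q :: rat poly. q \<noteq> 0 \<Longrightarrow> poly (map_poly of_rat q) \<gamma> = 0 \<Longrightarrow> Polynomial.degree m0 \<le> Polynomial.degree q"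
    using ex_has_least_nat[of "\<lambda>q :: rat poly. q \<noteq> 0 \<and> poly (map_poly of_rat q) \<gamma> = 0" q0 Polynomial.degree] by metis
  define m where "m = Polynomial.smult (inverse (Polynomial.lead_coeff m0)) m0"
  have m: "Polynomial.lead_coeff m = 1" "Polynomial.degree m = Polynomial.degree m0" "m \<noteq> 0"
    using m0(1) by (simp_all add: m_def)
  have m\<gamma>: "poly (map_poly of_rat m) \<gamma> = 0"
    using m0(2) by (simp add: m_def of_rat_hom.map_poly_hom_smult)
  define pQ where "pQ = map_poly (of_int :: int \<Rightarrow> rat) p"
  have p\<gamma>: "poly (map_poly of_rat pQ) \<gamma> = 0" using p(1) by (simp add: pQ_def map_poly_of_rat_of_int)
  have "pQ mod m = 0"
  proof (rule ccontr)
    assume nz: "pQ mod m \<noteq> 0"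
    have "pQ mod m = pQ - pQ div m * m" by (simp add: minus_div_mult_eq_mod)
    hence "poly (map_poly of_rat (pQ mod m)) \<gamma> = 0"
      using p\<gamma> m\<gamma> by (simp add: of_rat_poly_hom.hom_minus of_rat_poly_hom.hom_mult)
    hence "Polynomial.degree m0 \<le> Polynomial.degree (pQ mod m)" using nz by (rule m0_min[rotated])
    thus False using degree_mod_less'[OF m(3) nz] m(2) by simp
  qed
  then obtain e where e: "pQ = m * e" by (auto simp: mod_eq_0_iff_dvd)
  define mL where "mL = map_poly (of_rat :: rat \<Rightarrow> 'a) m"
  have lmL: "Polynomial.lead_coeff mL = 1" using m(1) by (simp add: mL_def)
  then obtain A where A: "mL = (\<Prod>x\<in>#A. [:- x, 1:])"
    using alg_closed_imp_factorization[of mL] by (metis leading_coeff_0_iff smult_1_left zero_neq_one)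
  have "algebraic_int x" if "x \<in># A" for x
  proof -
    have "poly mL x = 0" using that unfolding A by (auto simp: poly_prod_mset prod_mset_zero_iff)
    hence "poly (map_poly of_rat pQ) x = 0"
      unfolding e by (simp add: of_rat_poly_hom.hom_mult mL_def)
    thus ?thesis unfolding algebraic_int_altdef_ipoly using p(2) by (auto simp: pQ_def map_poly_of_rat_of_int)
  qed
  hence "integral_poly mL" unfolding A by (intro integral_poly_prod_mset integral_poly_linear)
  then obtain G where G: "m = map_poly of_int G" unfolding mL_def using integral_rat_poly_is_int by blast
  have "integral_min_poly \<gamma> G"
  proof
    have "Polynomial.degree G = Polynomial.degree m" by (simp add: G)
    thus "Polynomial.degree G \<le> Polynomial.degree q" if "q \<noteq> 0" "poly (map_poly of_rat q) \<gamma> = 0" for q :: "rat poly"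
      using m0_min[OF that] m(2) by simp
    have "of_int (Polynomial.lead_coeff G) = (1 :: rat)" using m(1) by (simp add: G)
    thus "Polynomial.lead_coeff G = 1" by simp
    show "poly (map_poly of_int G) \<gamma> = 0" using m\<gamma> by (simp add: G map_poly_of_rat_of_int)
  qed
  thus ?thesis by (rule that)
qed

context integral_min_poly
begin

text \<open>Pseudo-division by the monic G needs no denominators, so the quotient is integral as
  well.\<close>

lemma int_dvd:
  assumes "poly (map_poly of_int h) \<gamma> = 0"
  shows "G dvd h"
proof -
  have G0: "G \<noteq> 0" using monic by auto
  obtain q r where qr: "pseudo_divmod h G = (q, r)" by fastforce
  have eq: "h = G * q + r" and deg: "r = 0 \<or> Polynomial.degree r < Polynomial.degree G"
    using pseudo_divmod[OF G0 qr] monic by simp_all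
  have "poly (map_poly of_int r) \<gamma> = 0"
    using assms root by (simp add: eq of_int_poly_hom.hom_add of_int_poly_hom.hom_mult)
  hence r\<gamma>: "poly (map_poly of_rat (map_poly of_int r)) \<gamma> = 0" by (simp add: map_poly_of_rat_of_int)
  have "r = 0"
  proof (rule ccontr)
    assume "r \<noteq> 0"
    hence "map_poly (of_int :: int \<Rightarrow> rat) r \<noteq> 0" by simp
    from minimal[OF this r\<gamma>] deg \<open>r \<noteq> 0\<close> show False by simp
  qed
  with eq show ?thesis by simp
qed

definition GQ :: "rat poly" where "GQ = map_poly of_int G"
definition GL :: "'a poly" where "GL = map_poly of_int G"

lemma GL_GQ: "map_poly of_rat GQ = GL"
  by (simp add: GQ_def GL_def map_poly_of_rat_of_int)

lemma GQ_facts: "GQ \<noteq> 0" "Polynomial.lead_coeff GQ = 1" "Polynomial.degree GQ = Polynomial.degree G"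
  using monic by (auto simp: GQ_def)

lemma rat_dvd:
  fixes q :: "rat poly"
  assumes "poly (map_poly of_rat q) \<gamma> = 0"
  shows "GQ dvd q"
proof (rule ccontr)
  assume "\<not> GQ dvd q"
  hence nz: "q mod GQ \<noteq> 0" by (simp add: mod_eq_0_iff_dvd)
  have "q mod GQ = q - q div GQ * GQ" by (simp add: minus_div_mult_eq_mod)
  hence "poly (map_poly of_rat (q mod GQ)) \<gamma> = 0"
    using assms root by (simp add: of_rat_poly_hom.hom_minus of_rat_poly_hom.hom_mult GL_GQ GL_def)
  hence "Polynomial.degree G \<le> Polynomial.degree (q mod GQ)" by (rule minimal[OF nz])
  thus False using degree_mod_less'[OF GQ_facts(1) nz] GQ_facts(3) by simp
qed

lemma degree_pos: "Polynomial.degree G > 0"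
proof (rule ccontr)
  assume "\<not> Polynomial.degree G > 0"
  then obtain c where "G = [:c:]" by (metis degree_eq_zeroE gr0I)
  with monic root show False by (simp add: of_int_hom.map_poly_pCons_hom)
qed

lemma factor_trivial:
  assumes "GQ = d * e"
  shows "Polynomial.degree d = 0 \<or> Polynomial.degree d = Polynomial.degree GQ"
proof -
  have nz: "d \<noteq> 0" "e \<noteq> 0" using assms GQ_facts(1) by auto
  have deg: "Polynomial.degree GQ = Polynomial.degree d + Polynomial.degree e"
    using assms nz by (simp add: degree_mult_eq)
  have "poly (map_poly of_rat d) \<gamma> * poly (map_poly of_rat e) \<gamma> = 0"
    using root GL_GQ by (simp add: assms of_rat_poly_hom.hom_mult GL_def flip: poly_mult)
  hence "Polynomial.degree G \<le> Polynomial.degree d \<or> Polynomial.degree G \<le> Polynomial.degree e"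
    using minimal nz by auto
  thus ?thesis using deg GQ_facts(3) by auto
qed

lemma separable: "Rings.coprime (pderiv GQ) GQ"
proof (rule coprimeI)
  fix d assume d: "d dvd pderiv GQ" "d dvd GQ"
  have p0: "pderiv GQ \<noteq> 0" using degree_pos GQ_facts(3) by (simp add: pderiv_eq_0_iff)
  from d(1) p0 have "Polynomial.degree d \<le> Polynomial.degree GQ - 1"
    by (metis degree_pderiv dvd_imp_degree_le)
  hence "Polynomial.degree d \<noteq> Polynomial.degree GQ" using degree_pos GQ_facts(3) by simp
  moreover obtain e where "GQ = d * e" using d(2) by blast
  ultimately have "Polynomial.degree d = 0" using factor_trivial by blast
  moreover have "d \<noteq> 0" using d p0 by auto
  ultimately show "is_unit d" by (simp add: is_unit_iff_degree)
qed

text \<open>The constant D serves as a substitute for the discriminant: modulo primes that do not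
  divide it, G has only simple roots.\<close>

lemma int_bezout:
  obtains A B :: "int poly" and D :: int where "D \<noteq> 0" "A * G + B * pderiv G = [:D:]"
proof -
  obtain u v where uv: "u * pderiv GQ + v * GQ = 1"
    using coprime_poly_bezout[OF separable GQ_facts(1)] .
  obtain m1 u' where m1: "m1 > 0" "Polynomial.smult (of_int m1) u = map_poly of_int u'"
    using common_denominator_poly .
  obtain m2 v' where m2: "m2 > 0" "Polynomial.smult (of_int m2) v = map_poly of_int v'"
    using common_denominator_poly .
  define A where "A = Polynomial.smult m1 v'"
  define B where "B = Polynomial.smult m2 u'"
  have pd: "pderiv GQ = map_poly of_int (pderiv G)"
    unfolding GQ_def by (rule of_int_hom.map_poly_pderiv[symmetric])
  have "map_poly (of_int :: int \<Rightarrow> rat) (A * G + B * pderiv G)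
      = Polynomial.smult (of_int m1) (Polynomial.smult (of_int m2) v) * GQ
        + Polynomial.smult (of_int m2) (Polynomial.smult (of_int m1) u) * pderiv GQ"
    unfolding m1(2) m2(2) pd
    by (simp add: A_def B_def GQ_def of_int_poly_hom.hom_add of_int_poly_hom.hom_mult of_int_hom.map_poly_hom_smult)
  also have "\<dots> = Polynomial.smult (of_int (m1 * m2)) (u * pderiv GQ + v * GQ)"
    by (simp add: smult_add_right mult.commute)
  also have "\<dots> = map_poly of_int [:m1 * m2:]"
    by (simp add: uv of_int_hom.map_poly_pCons_hom)
  finally have "A * G + B * pderiv G = [:m1 * m2:]" by (simp only: of_int_poly_hom.eq_iff)
  thus ?thesis using that[of "m1 * m2" A B] m1(1) m2(1) by simp
qed

text \<open>If m is a monic integer polynomial for q(gamma), then m(q(X)) vanishes at gamma, is a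
  multiple of G, and so vanishes at every other root x.\<close>

lemma conjugate_integral:
  fixes q :: "rat poly"
  assumes "algebraic_int (poly (map_poly of_rat q) \<gamma>)" "poly GL x = 0"
  shows "algebraic_int (poly (map_poly of_rat q) x)"
proof -
  obtain m :: "int poly" where m: "poly (map_poly of_int m) (poly (map_poly of_rat q) \<gamma>) = 0" "Polynomial.lead_coeff m = 1"
    using assms(1) unfolding algebraic_int_altdef_ipoly by blast
  define c where "c = map_poly of_int m \<circ>\<^sub>p q"
  have c: "poly (map_poly of_rat c) y = poly (map_poly of_int m) (poly (map_poly of_rat q) y)" for y :: 'a
    unfolding c_def by (simp add: of_rat_hom.map_poly_pcompose poly_pcompose map_poly_of_rat_of_int)
  hence "GQ dvd c" using m(1) by (intro rat_dvd) simp
  then obtain e where "c = GQ * e" ..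
  hence "poly (map_poly of_rat c) x = 0"
    using assms(2) by (simp add: of_rat_poly_hom.hom_mult GL_GQ)
  thus ?thesis unfolding algebraic_int_altdef_ipoly using m(2) c by metis
qed

text \<open>At a repeated root both G and its derivative vanish, and the identity of
  \<open>int_bezout\<close> would give D = 0.\<close>

lemma roots_factorization:
  defines "R \<equiv> {x. poly GL x = 0}"
  shows "finite R" "GL = (\<Prod>x\<in>R. [:- x, 1:])" "card R = Polynomial.degree G"
proof -
  have GL0: "GL \<noteq> 0" "Polynomial.lead_coeff GL = 1" using monic by (auto simp: GL_def)
  show fin: "finite R" unfolding R_def using GL0(1) by (rule poly_roots_finite)
  obtain A where A: "GL = (\<Prod>x\<in>#A. [:- x, 1:])"
    using alg_closed_imp_factorization[OF GL0(1)] GL0(2) by (metis smult_1_left)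
  have RA: "set_mset A = R" unfolding R_def A by (auto simp: poly_prod_mset prod_mset_zero_iff)
  have "count A x = 1" if "x \<in># A" for x
  proof (rule ccontr)
    assume "count A x \<noteq> 1"
    hence "count A x \<ge> 2" using that by (metis count_greater_eq_one_iff le_neq_implies_less Suc_1 Suc_leI)
    hence "{#x, x#} \<subseteq># A" by (auto simp: subseteq_mset_def)
    then obtain B where "A = {#x, x#} + B" by (metis subset_mset.le_iff_add)
    hence GLx: "GL = [:- x, 1:] * ([:- x, 1:] * (\<Prod>x\<in>#B. [:- x, 1:]))" unfolding A by simp
    have "poly (pderiv GL) x = 0" unfolding GLx by (simp only: pderiv_mult poly_add poly_mult) simp
    moreover have "poly GL x = 0" unfolding GLx by simp
    moreover obtain C B' D where D: "D \<noteq> 0" "C * G + B' * pderiv G = [:D:]" using int_bezout .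
    have "poly (map_poly of_int (C * G + B' * pderiv G)) x = (of_int D :: 'a)" unfolding D(2) by (simp add: of_int_hom.map_poly_pCons_hom)
    hence "poly (map_poly of_int C) x * poly GL x + poly (map_poly of_int B') x * poly (pderiv GL) x = of_int D"
      by (simp add: of_int_poly_hom.hom_add of_int_poly_hom.hom_mult of_int_hom.map_poly_pderiv GL_def)
    ultimately show False using D(1) by simp
  qed
  hence "A = mset_set R"
    by (intro multiset_eqI) (metis RA count_mset_set(1,3) fin not_in_iff)
  thus eq: "GL = (\<Prod>x\<in>R. [:- x, 1:])" unfolding A by (simp add: prod_unfold_prod_mset)
  have "Polynomial.degree GL = card R" unfolding eq by (simp add: Polynomial.degree_prod_eq_sum_degree)
  thus "card R = Polynomial.degree G" by (simp add: GL_def)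
qed

text \<open>
  The polynomial of degree less than \<open>deg G\<close> with values \<open>q(x) G'(x)\<close> at the roots \<open>x\<close> of \<open>G\<close> is
  rational, being the remainder of \<open>q G'\<close>, and integral by Lagrange interpolation.
\<close>

lemma different_multiple_integral:
  fixes q :: "rat poly"
  assumes "algebraic_int (poly (map_poly of_rat q) \<gamma>)"
  obtains r :: "int poly" where
    "poly (map_poly of_rat q) \<gamma> * poly (map_poly of_int (pderiv G)) \<gamma> = poly (map_poly of_int r) \<gamma>"
proof -
  define R where "R = {x. poly GL x = 0}"
  note R = roots_factorization[folded R_def]
  define v where "v = (\<lambda>x. poly (map_poly of_rat q) x :: 'a)"
  define H where "H = (\<Sum>x\<in>R. Polynomial.smult (v x) (\<Prod>y\<in>R - {x}. [:- y, 1:]))"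
  have int_R: "algebraic_int x" if "x \<in> R" for x
    using that monic unfolding R_def GL_def algebraic_int_altdef_ipoly by auto
  have "algebraic_int (v x)" if "x \<in> R" for x
    using conjugate_integral[OF assms] that by (simp add: v_def R_def)
  hence "integral_poly H" unfolding H_def using int_R
    by (intro integral_poly_sum integral_poly_arith(2) integral_poly_prod integral_poly_linear) auto
  define r where "r = (q * pderiv GQ) mod GQ"
  define s where "s = (q * pderiv GQ) div GQ"
  have qs: "q * pderiv GQ = s * GQ + r" by (simp add: s_def r_def)
  have pd: "map_poly of_rat (pderiv GQ) = pderiv GL"
    by (simp add: of_rat_hom.map_poly_pderiv GL_GQ)
  have val: "v x * poly (pderiv GL) x = poly (map_poly of_rat r) x" if "poly GL x = 0" for x
  proof -
    have "poly (map_poly of_rat (q * pderiv GQ)) x = poly (map_poly of_rat (s * GQ + r)) x" using qs by simp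
    thus ?thesis using that
      by (simp add: of_rat_poly_hom.hom_mult of_rat_poly_hom.hom_add GL_GQ pd v_def)
  qed
  have Hval: "poly H x = v x * poly (pderiv GL) x" if x: "x \<in> R" for x
  proof -
    have GLx: "GL = [:- x, 1:] * (\<Prod>y\<in>R - {x}. [:- y, 1:])"
      by (subst R(2)) (rule prod.remove[OF R(1) x])
    have "poly (pderiv GL) x = poly (\<Prod>y\<in>R - {x}. [:- y, 1:]) x"
      unfolding GLx by (simp only: pderiv_mult poly_add poly_mult) (simp add: pderiv_pCons)
    moreover have "poly H x = v x * poly (\<Prod>y\<in>R - {x}. [:- y, 1:]) x
        + (\<Sum>z\<in>R - {x}. v z * poly (\<Prod>y\<in>R - {z}. [:- y, 1:]) x)"
      unfolding H_def poly_sum by (subst sum.remove[OF R(1) x]) simp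
    moreover have "(\<Sum>z\<in>R - {x}. v z * poly (\<Prod>y\<in>R - {z}. [:- y, 1:]) x) = 0"
      using x R(1) by (intro sum.neutral) (auto simp: poly_prod)
    ultimately show ?thesis by simp
  qed
  have "H = map_poly of_rat r"
  proof (rule ccontr)
    assume ne: "H \<noteq> map_poly of_rat r"
    define E where "E = H - map_poly of_rat r"
    have E0: "E \<noteq> 0" using ne by (simp add: E_def)
    have "R \<subseteq> {x. poly E x = 0}" using Hval val by (auto simp: E_def R_def)
    hence "card R \<le> card {x. poly E x = 0}" using poly_roots_finite[OF E0] by (intro card_mono)
    also have "\<dots> \<le> Polynomial.degree E" by (rule card_poly_roots_bound[OF E0])
    finally have "Polynomial.degree G \<le> Polynomial.degree E" using R(3) by simp
    moreover have "Polynomial.degree H \<le> Polynomial.degree G - 1"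
      unfolding H_def
    proof (rule degree_sum_le[OF R(1)])
      fix x assume x: "x \<in> R"
      have "Polynomial.degree (Polynomial.smult (v x) (\<Prod>y\<in>R - {x}. [:- y, 1:])) \<le> Polynomial.degree (\<Prod>y\<in>R - {x}. [:- y, 1:])"
        by (rule Polynomial.degree_smult_le)
      also have "\<dots> = card R - 1" using x R(1) by (simp add: Polynomial.degree_prod_eq_sum_degree)
      finally show "Polynomial.degree (Polynomial.smult (v x) (\<Prod>y\<in>R - {x}. [:- y, 1:])) \<le> Polynomial.degree G - 1"
        using R(3) by simp
    qed
    moreover have "Polynomial.degree r \<le> Polynomial.degree G - 1"
      unfolding r_def using degree_mod_less[OF GQ_facts(1), of "q * pderiv GQ"] GQ_facts(3) degree_pos by force
    hence "Polynomial.degree (map_poly of_rat r :: 'a poly) \<le> Polynomial.degree G - 1" by simp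
    ultimately show False using degree_pos Polynomial.degree_diff_le[of H "Polynomial.degree G - 1" "map_poly of_rat r"]
      unfolding E_def by simp
  qed
  then obtain r' where r': "r = map_poly of_int r'"
    using \<open>integral_poly H\<close> integral_rat_poly_is_int by metis
  have "poly GL \<gamma> = 0" using root by (simp add: GL_def)
  from val[OF this] show ?thesis
    using that[of r'] by (simp add: v_def r' map_poly_of_rat_of_int GL_def of_int_hom.map_poly_pderiv)
qed

text \<open>Irreducibility of G makes a polynomial that does not vanish at gamma coprime to it; the
  Bezout identity, evaluated at gamma, gives the inverse.\<close>

lemma subfield_rat_polys: "subfield_of {poly (map_poly of_rat q) \<gamma> | q :: rat poly. True}" (is "subfield_of ?S")
  unfolding subfield_of_def
proof (intro conjI ballI)
  show "1 \<in> ?S" by (intro CollectI exI[of _ 1]) simp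
  fix x y assume "x \<in> ?S" "y \<in> ?S"
  then obtain q r :: "rat poly" where q: "x = poly (map_poly of_rat q) \<gamma>" and r: "y = poly (map_poly of_rat r) \<gamma>"
    by blast
  show "x - y \<in> ?S" by (intro CollectI exI[of _ "q - r"]) (simp add: q r of_rat_poly_hom.hom_minus)
  show "x * y \<in> ?S" by (intro CollectI exI[of _ "q * r"]) (simp add: q r of_rat_poly_hom.hom_mult)
  show "inverse x \<in> ?S"
  proof (cases "x = 0")
    case True
    thus ?thesis by (intro CollectI exI[of _ 0]) simp
  next
    case False
    have "Rings.coprime q GQ"
    proof (rule coprimeI)
      fix d assume d: "d dvd q" "d dvd GQ"
      obtain e where e: "GQ = d * e" using d(2) by blast
      have "Polynomial.degree d \<noteq> Polynomial.degree GQ"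
      proof
        assume dd: "Polynomial.degree d = Polynomial.degree GQ"
        have nz: "d \<noteq> 0" "e \<noteq> 0" using e GQ_facts(1) by auto
        hence "Polynomial.degree e = 0" using e dd by (simp add: degree_mult_eq)
        then obtain c where "e = [:c:]" by (rule degree_eq_zeroE)
        hence "c \<noteq> 0" "GQ = Polynomial.smult c d" using nz e by auto
        hence "GQ dvd d" by (simp add: smult_dvd_iff)
        hence "GQ dvd q" using d(1) by (rule dvd_trans)
        then obtain f where "q = GQ * f" ..
        hence "x = 0" using root by (simp add: q of_rat_poly_hom.hom_mult GL_GQ GL_def)
        with False show False by simp
      qed
      hence "Polynomial.degree d = 0" using factor_trivial[OF e] by blast
      moreover have "d \<noteq> 0" using e GQ_facts(1) by auto
      ultimately show "is_unit d" by (simp add: is_unit_iff_degree)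
    qed
    then obtain u v where uv: "u * q + v * GQ = 1" using coprime_poly_bezout GQ_facts(1) by blast
    have "poly (map_poly of_rat (u * q + v * GQ)) \<gamma> = 1" unfolding uv by simp
    hence "poly (map_poly of_rat u) \<gamma> * x = 1"
      using root by (simp add: of_rat_poly_hom.hom_mult of_rat_poly_hom.hom_add GL_GQ q GL_def)
    hence "inverse x = poly (map_poly of_rat u) \<gamma>" using False by (metis inverse_unique mult.commute)
    thus ?thesis by blast
  qed
qed

text \<open>At gamma the Bezout identity reads D = B(gamma) G'(gamma), and
  \<open>different_multiple_integral\<close> says that G'(gamma) clears the denominators of every
  algebraic integer a of the field.\<close>

lemma denominator_bound:
  obtains D :: int and A B :: "int poly" where "D \<noteq> 0" "A * G + B * pderiv G = [:D:]"
    "\<And>a. a \<in> field_gen \<gamma> \<Longrightarrow> algebraic_int a \<Longrightarrow> \<exists>h. of_int D * a = poly (map_poly of_int h) \<gamma>"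
proof -
  obtain A B D where D: "D \<noteq> 0" "A * G + B * pderiv G = [:D:]" using int_bezout .
  have "\<exists>h. of_int D * a = poly (map_poly of_int h) \<gamma>" if a: "a \<in> field_gen \<gamma>" "algebraic_int a" for a
  proof -
    have "\<gamma> \<in> {poly (map_poly of_rat q) \<gamma> | q :: rat poly. True}"
      by (intro CollectI exI[of _ "[:0, 1:]"]) (simp add: of_rat_hom.map_poly_pCons_hom)
    from field_gen_least[OF subfield_rat_polys this] a(1)
    obtain q :: "rat poly" where q: "a = poly (map_poly of_rat q) \<gamma>" by blast
    obtain r where r: "a * poly (map_poly of_int (pderiv G)) \<gamma> = poly (map_poly of_int r) \<gamma>"
      using different_multiple_integral[of q] a(2) unfolding q by blast
    have "poly (map_poly of_int (A * G + B * pderiv G)) \<gamma> = (of_int D :: 'a)" unfolding D(2) by (simp add: of_int_hom.map_poly_pCons_hom)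
    hence "poly (map_poly of_int B) \<gamma> * poly (map_poly of_int (pderiv G)) \<gamma> = of_int D"
      using root by (simp add: of_int_poly_hom.hom_add of_int_poly_hom.hom_mult)
    hence "of_int D * a = poly (map_poly of_int B) \<gamma> * (a * poly (map_poly of_int (pderiv G)) \<gamma>)"
      by (metis mult.assoc mult.commute)
    also have "\<dots> = poly (map_poly of_int (B * r)) \<gamma>" unfolding r by (simp add: of_int_poly_hom.hom_mult)
    finally show ?thesis ..
  qed
  with D show ?thesis using that by blast
qed

end

section \<open>Places of degree one\<close>

lemma poly_of_int_to_ac: "poly (map_poly of_int p) (to_ac x) = to_ac (poly (map_poly of_int p) x)"
  by (induction p) (simp_all add: of_int_hom.map_poly_pCons_hom)

lemma algebraic_int_to_ac: "algebraic_int a \<Longrightarrow> algebraic_int (to_ac (a :: 'k::field_char_0))"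
  unfolding algebraic_int_altdef_ipoly by (metis poly_of_int_to_ac to_ac_0)

lemma to_ac_of_rat: "to_ac (of_rat q :: 'k::field_char_0) = of_rat q"
  by (cases q) (simp add: of_rat_rat)

text \<open>The field K is embedded in its algebraic closure, where w, a primitive cube root of
  unity, is available. A rational basis of K is scaled to algebraic integers, and gamma is a
  primitive element for these together with w.\<close>

lemma number_field_generator:
  assumes nf: "number_field TYPE('k::field_char_0)"
  obtains \<gamma> w :: "'k::field_char_0 alg_closure" where "algebraic_int \<gamma>" "range to_ac \<subseteq> field_gen \<gamma>"
    "w \<in> field_gen \<gamma>" "algebraic_int w" "w ^ 2 + w + 1 = 0"
proof -
  obtain B where B: "finite_dimensional_vector_space (\<lambda>(q::rat) (x::'k). of_rat q * x) B"
    using nf unfolding number_field_def by blast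
  then interpret V: finite_dimensional_vector_space "\<lambda>(q::rat) (x::'k). of_rat q * x" B .
  have "\<exists>m::int. m \<noteq> 0 \<and> algebraic_int (of_int m * b)" for b :: 'k
    using number_field_algebraic[OF nf, of b] algebraic_int_scaled[of _ b] by metis
  then obtain m :: "'k \<Rightarrow> int" where m: "\<And>b. m b \<noteq> 0" "\<And>b. algebraic_int (of_int (m b) * b)" by metis
  have "Polynomial.degree [:1, 1, 1 :: 'k alg_closure:] > 0" by simp
  then obtain w :: "'k alg_closure" where "poly [:1, 1, 1:] w = 0" using alg_closed_imp_poly_has_root by blast
  hence w: "w ^ 2 + w + 1 = 0" by (simp add: power2_eq_square algebra_simps)
  have aw: "algebraic_int w"
    unfolding algebraic_int_altdef_ipoly
    by (rule exI[of _ "[:1, 1, 1:]"]) (use w in \<open>simp add: of_int_hom.map_poly_pCons_hom power2_eq_square algebra_simps\<close>)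
  define A where "A = insert w ((\<lambda>b. to_ac (of_int (m b) * b)) ` B)"
  have "finite A" "\<And>x. x \<in> A \<Longrightarrow> algebraic_int x"
    using aw algebraic_int_to_ac m(2) V.finite_Basis by (auto simp: A_def simp del: to_ac_mult)
  then obtain \<gamma> where \<gamma>: "algebraic_int \<gamma>" "A \<subseteq> field_gen \<gamma>" using primitive_element_finite by blast
  note F = subfield_field_gen[of \<gamma>]
  have "to_ac x \<in> field_gen \<gamma>" for x
  proof -
    have "x \<in> V.span B" using V.span_Basis by simp
    then obtain u where x: "x = (\<Sum>b\<in>B. of_rat (u b) * b)"
      using V.span_finite[OF V.finite_Basis] by auto
    have "to_ac b \<in> field_gen \<gamma>" if "b \<in> B" for b
    proof -
      have "to_ac (of_int (m b) * b) \<in> field_gen \<gamma>" using that \<gamma>(2) by (auto simp: A_def)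
      hence "to_ac (of_int (m b) * b) / of_int (m b) \<in> field_gen \<gamma>"
        by (intro subfield_ofD(8)[OF F] subfield_of_int[OF F])
      thus ?thesis using m(1)[of b] by simp
    qed
    thus ?thesis unfolding x to_ac_sum
      by (intro subfield_sum[OF F]) (simp add: to_ac_of_rat subfield_ofD(6)[OF F] subfield_of_rat[OF F])
  qed
  hence "range to_ac \<subseteq> field_gen \<gamma>" by blast
  moreover have "w \<in> field_gen \<gamma>" using \<gamma>(2) by (simp add: A_def)
  ultimately show ?thesis using \<gamma>(1) aw w by (intro that)
qed

text \<open>The form divides s^3 - d^3. For p = 3 k + 2, Fermat's theorem recovers s from s^3 and
  s^2, and comparison with d gives p | s d (d - s). The case p | s forces p | d, and the case p | d
  - s forces p | 3 d^2.\<close>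

lemma prime_dvd_eisenstein_norm:
  fixes s d :: int
  assumes p: "prime p" "p \<noteq> 3" and dvd: "int p dvd s ^ 2 + s * d + d ^ 2" and d: "\<not> int p dvd d"
  shows "p mod 3 = 1"
proof (rule ccontr)
  assume "p mod 3 \<noteq> 1"
  moreover have "\<not> 3 dvd p" using p primes_dvd_imp_eq[of 3 p] by auto
  ultimately have "p mod 3 = 2" by presburger
  then obtain k where k: "p = 3 * k + 2" by (metis mult_div_mod_eq)
  have pp: "prime (int p)" using p(1) by simp
  have fermat: "[x ^ p = x] (mod int p)" for x
  proof -
    have "acong p (of_int (x ^ p - x)) 0"
      using acong_diff[OF acong_of_int_power[OF p(1), of x] acong_refl[of p "of_int x"]] by simp
    thus ?thesis using acong_of_int_0_imp_dvd prime_gt_0_nat[OF p(1)] by (simp add: cong_iff_dvd_diff)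
  qed
  have "s ^ 3 - d ^ 3 = (s - d) * (s ^ 2 + s * d + d ^ 2)"
    by (simp add: algebra_simps power2_eq_square power3_eq_cube)
  hence sd: "[s ^ 3 = d ^ 3] (mod int p)" using dvd by (simp add: cong_iff_dvd_diff)
  have c: "[(s ^ 3) ^ k * s ^ 2 = (d ^ 3) ^ k * s ^ 2] (mod int p)"
    by (rule cong_scalar_right[OF cong_pow[OF sd]])
  have "s ^ p = (s ^ 3) ^ k * s ^ 2" "d ^ p = (d ^ 3) ^ k * d ^ 2"
    unfolding k by (simp_all add: power_add power_mult power2_eq_square)
  hence "[s = (d ^ 3) ^ k * s ^ 2] (mod int p)" using cong_trans[OF cong_sym[OF fermat[of s]]] c by metis
  hence "[s * d ^ 2 = (d ^ 3) ^ k * s ^ 2 * d ^ 2] (mod int p)" by (rule cong_scalar_right)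
  also have "(d ^ 3) ^ k * s ^ 2 * d ^ 2 = d ^ p * s ^ 2" using \<open>d ^ p = _\<close> by (simp add: mult_ac)
  also have "[d ^ p * s ^ 2 = d * s ^ 2] (mod int p)" by (intro cong_mult fermat cong_refl)
  finally have "int p dvd s * d ^ 2 - d * s ^ 2" by (simp add: cong_iff_dvd_diff)
  also have "s * d ^ 2 - d * s ^ 2 = s * d * (d - s)" by (simp add: algebra_simps power2_eq_square)
  finally have "int p dvd s \<or> int p dvd d - s" using d by (simp add: prime_dvd_mult_iff[OF pp])
  thus False
  proof
    assume "int p dvd s"
    hence "int p dvd s ^ 2 + s * d" by (simp add: power2_eq_square)
    hence "int p dvd d ^ 2" using dvd by (metis dvd_add_right_iff)
    thus False using d prime_dvd_power[OF pp] by blast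
  next
    assume ds: "int p dvd d - s"
    have "s ^ 2 + s * d + d ^ 2 = 3 * d ^ 2 - (d - s) * (s + 2 * d)"
      by (simp add: algebra_simps power2_eq_square)
    hence "int p dvd 3 * d ^ 2" using dvd ds
      by (metis dvd_diff_commute dvd_mult2 dvd_add_right_iff diff_add_cancel add.commute)
    hence "int p dvd 3" using d by (auto simp: prime_dvd_mult_iff[OF pp] dest: prime_dvd_power[OF pp])
    hence "p dvd 3" by presburger
    thus False using p primes_dvd_imp_eq[of p 3] by auto
  qed
qed

context integral_min_poly
begin

lemma value_dvd:
  assumes "poly (map_poly of_int h) \<gamma> = 0" "int p dvd poly G t"
  shows "int p dvd poly h t"
proof -
  obtain e where "h = G * e" using int_dvd[OF assms(1)] ..
  thus ?thesis using assms(2) by simp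
qed

end

text \<open>A root t of G modulo p defines a reduction of the integers of K that sends gamma to t:
  if D a = h(gamma), then a goes to h(t) / D in F_p. P is the kernel, and every class contains a
  rational integer. By \<open>int_dvd\<close> the result does not depend on h.\<close>

theorem degree_one_places:
  assumes nf: "number_field TYPE('k::field_char_0)"
  obtains G :: "int poly" and D :: int where "D \<noteq> 0" "Polynomial.degree G > 0" "poly G 0 \<noteq> 0"
    "\<And>p t. prime p \<Longrightarrow> \<not> int p dvd D \<Longrightarrow> int p dvd poly G t \<Longrightarrow>
       p mod 3 = 1 \<and> \<not> int p dvd poly (pderiv G) t \<and>
       (\<exists>P :: 'k set. place_ideal P \<and> of_nat p \<in> P \<and> (\<forall>a. algebraic_int a \<longrightarrow> (\<exists>m. a - of_int m \<in> P)))"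
proof -
  obtain \<gamma> w :: "'k alg_closure" where \<gamma>: "algebraic_int \<gamma>" "range to_ac \<subseteq> field_gen \<gamma>"
    and w: "w \<in> field_gen \<gamma>" "algebraic_int w" "w ^ 2 + w + 1 = 0"
    using number_field_generator[OF nf] .
  obtain G where "integral_min_poly \<gamma> G" using integral_min_poly_exists[OF \<gamma>(1)] .
  then interpret integral_min_poly \<gamma> G .
  obtain D :: int and A B where D: "D \<noteq> 0" "A * G + B * pderiv G = [:D:]"
    and den: "\<And>a. a \<in> field_gen \<gamma> \<Longrightarrow> algebraic_int a \<Longrightarrow> \<exists>h. of_int D * a = poly (map_poly of_int h) \<gamma>"
    using denominator_bound by metis
  have main: "p mod 3 = 1 \<and> \<not> int p dvd poly (pderiv G) t \<and>
       (\<exists>P :: 'k set. place_ideal P \<and> of_nat p \<in> P \<and> (\<forall>a. algebraic_int a \<longrightarrow> (\<exists>m. a - of_int m \<in> P)))"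
    if p: "prime p" "\<not> int p dvd 3 * D" and t: "int p dvd poly G t" for p t
  proof (intro conjI)
    have pp: "prime (int p)" using p(1) by simp
    have pD: "\<not> int p dvd D" using p(2) by auto
    have p3: "p \<noteq> 3" using p(2) by auto
    note vd = value_dvd[OF _ t]
    \<comment> \<open>The element D w is a zero of X^2 + D X + D^2; its reduction at t is a value of
      the norm form divisible by p, which leaves only p = 1 modulo 3.\<close>
    obtain hw where hw: "of_int D * w = poly (map_poly of_int hw) \<gamma>" using den[OF w(1,2)] by blast
    have "poly (map_poly of_int (hw * hw + hw * [:D:] + [:D * D:])) \<gamma>
        = of_int D * w * (of_int D * w) + of_int D * w * of_int D + of_int D * of_int D"
      unfolding hw by (simp add: of_int_poly_hom.hom_add of_int_poly_hom.hom_mult of_int_hom.map_poly_pCons_hom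
          of_int_hom.map_poly_hom_smult mult.commute)
    also have "\<dots> = of_int D * of_int D * (w ^ 2 + w + 1)" by (simp add: algebra_simps power2_eq_square)
    finally have "int p dvd poly (hw * hw + hw * [:D:] + [:D * D:]) t" using w(3) by (intro vd) simp
    hence "int p dvd (poly hw t) ^ 2 + poly hw t * D + D ^ 2" by (simp add: power2_eq_square mult.commute)
    thus "p mod 3 = 1" using prime_dvd_eisenstein_norm[OF p(1) p3 _ pD] by blast
    show "\<not> int p dvd poly (pderiv G) t"
    proof
      assume "int p dvd poly (pderiv G) t"
      hence "int p dvd poly (A * G + B * pderiv G) t" using t by simp
      thus False using pD unfolding D(2) by simp
    qed
    define rep where "rep = (\<lambda>(a :: 'k) h. of_int D * to_ac a = poly (map_poly of_int h) \<gamma>)"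
    define P where "P = {a. algebraic_int a \<and> (\<exists>h. rep a h \<and> int p dvd poly h t)}"
    have rep_ex: "\<exists>h. rep a h" if "algebraic_int a" for a
      unfolding rep_def using den[of "to_ac a"] \<gamma>(2) algebraic_int_to_ac[OF that] by blast
    have rep_unique: "int p dvd poly h t - poly h' t" if "rep a h" "rep a h'" for a h h'
    proof -
      have "poly (map_poly of_int (h - h')) \<gamma> = 0" using that by (simp add: rep_def of_int_poly_hom.hom_minus)
      from vd[OF this] show ?thesis by simp
    qed
    have P_iff: "a \<in> P \<longleftrightarrow> int p dvd poly h t" if "algebraic_int a" "rep a h" for a h
    proof
      assume "a \<in> P"
      then obtain h' where h': "rep a h'" "int p dvd poly h' t" unfolding P_def by blast
      have "int p dvd (poly h t - poly h' t) + poly h' t" by (rule dvd_add[OF rep_unique[OF that(2) h'(1)] h'(2)])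
      thus "int p dvd poly h t" by simp
    qed (use that in \<open>auto simp: P_def\<close>)
    have rep_int: "rep (of_int n) [:D * n:]" for n
      by (simp add: rep_def of_int_hom.map_poly_pCons_hom)
    have rep_add: "rep (a + b) (h + h')" "rep (a - b) (h - h')" if "rep a h" "rep b h'" for a b h h'
      using that by (simp_all add: rep_def of_int_poly_hom.hom_add of_int_poly_hom.hom_minus distrib_left right_diff_distrib)
    \<comment> \<open>Each representative carries one factor D and a product of two carries two,
      hence the additional D on the left.\<close>
    have rep_mult: "int p dvd D * poly h'' t - poly h t * poly h' t"
      if "rep a h" "rep b h'" "rep (a * b) h''" for a b h h' h''
    proof -
      have "poly (map_poly of_int ([:D:] * h'' - h * h')) \<gamma>
          = of_int D * poly (map_poly of_int h'') \<gamma> - poly (map_poly of_int h) \<gamma> * poly (map_poly of_int h') \<gamma>"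
        by (simp add: of_int_poly_hom.hom_minus of_int_poly_hom.hom_mult of_int_hom.map_poly_hom_smult)
      also have "\<dots> = 0" unfolding that[unfolded rep_def, symmetric] by (simp add: mult_ac)
      finally have "poly (map_poly of_int ([:D:] * h'' - h * h')) \<gamma> = 0" .
      from vd[OF this] show ?thesis by simp
    qed
    have prod_iff: "a * b \<in> P \<longleftrightarrow> a \<in> P \<or> b \<in> P" if ab: "algebraic_int a" "algebraic_int b" for a b
    proof -
      obtain h h' h'' where h: "rep a h" "rep b h'" "rep (a * b) h''"
        using rep_ex ab algebraic_int_mult[OF ab] by metis
      have "a * b \<in> P \<longleftrightarrow> int p dvd D * poly h'' t"
        using P_iff[OF algebraic_int_mult[OF ab] h(3)] pD by (simp add: prime_dvd_mult_iff[OF pp])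
      also have "\<dots> \<longleftrightarrow> int p dvd poly h t * poly h' t"
      proof -
        have "D * poly h'' t = (D * poly h'' t - poly h t * poly h' t) + poly h t * poly h' t" by simp
        thus ?thesis using dvd_add_right_iff[OF rep_mult[OF h]] by metis
      qed
      also have "\<dots> \<longleftrightarrow> a \<in> P \<or> b \<in> P"
        using P_iff[OF ab(1) h(1)] P_iff[OF ab(2) h(2)] by (simp add: prime_dvd_mult_iff[OF pp])
      finally show ?thesis .
    qed
    have int_iff: "of_int n \<in> P \<longleftrightarrow> int p dvd n" for n
      using P_iff[OF algebraic_int_of_int rep_int] pD by (simp add: prime_dvd_mult_iff[OF pp])
    have "place_ideal P"
      unfolding place_ideal_def
    proof (intro conjI ballI allI impI)
      show "algebraic_int x" if "x \<in> P" for x using that by (simp add: P_def)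
      show "0 \<in> P" using int_iff[of 0] by simp
      show "1 \<notin> P" using int_iff[of 1] prime_gt_1_nat[OF p(1)] by simp
      have "of_nat p \<in> P" using int_iff[of "int p"] by simp
      moreover have "(of_nat p :: 'k) \<noteq> 0" using prime_gt_0_nat[OF p(1)] by simp
      ultimately show "P \<noteq> {0}" by blast
      show "x + y \<in> P" if xy: "x \<in> P" "y \<in> P" for x y
      proof -
        obtain h h' where h: "rep x h" "int p dvd poly h t" "rep y h'" "int p dvd poly h' t"
          using xy unfolding P_def by blast
        have "algebraic_int x" "algebraic_int y" using xy unfolding P_def by blast+
        hence "algebraic_int (x + y)" by (rule algebraic_int_add)
        from P_iff[OF this rep_add(1)[OF h(1,3)]] show ?thesis using h(2,4) by simp
      qed
      show "a * x \<in> P" if "x \<in> P" "algebraic_int a" for a x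
        using prod_iff[of a x] that by (auto simp: P_def)
      show "a \<in> P \<or> b \<in> P" if "algebraic_int a" "algebraic_int b" "a * b \<in> P" for a b
        using prod_iff[of a b] that by blast
    qed
    moreover have "of_nat p \<in> P" using int_iff[of "int p"] by simp
    moreover have "\<exists>m. a - of_int m \<in> P" if a: "algebraic_int a" for a
    proof -
      obtain h where h: "rep a h" using rep_ex[OF a] ..
      have "coprime D (int p)" using prime_imp_coprime[OF pp pD] by (simp add: coprime_commute)
      then obtain e where e: "[D * e = 1] (mod int p)" using cong_solve_coprime_int by blast
      have "[D * e * poly h t = 1 * poly h t] (mod int p)" using e by (rule cong_scalar_right)
      hence "int p dvd 1 * poly h t - D * e * poly h t" by (simp add: cong_iff_dvd_diff dvd_diff_commute)
      hence "int p dvd poly (h - [:D * (e * poly h t):]) t" by (simp add: mult.assoc)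
      hence "a - of_int (e * poly h t) \<in> P"
        using P_iff[OF algebraic_int_diff[OF a algebraic_int_of_int] rep_add(2)[OF h rep_int]] by blast
      thus ?thesis ..
    qed
    ultimately show "\<exists>P :: 'k set. place_ideal P \<and> of_nat p \<in> P \<and> (\<forall>a. algebraic_int a \<longrightarrow> (\<exists>m. a - of_int m \<in> P))"
      by blast
  qed
  have G0: "G \<noteq> 0" using degree_pos by auto
  have "finite {x. poly G x = 0}" using G0 by (rule poly_roots_finite)
  then obtain c where c: "poly G c \<noteq> 0" using ex_new_if_finite[OF infinite_UNIV_int] by blast
  \<comment> \<open>A translation that makes the value at 0 nonzero, since Schur's argument factors
    this value out.\<close>
  define G' where "G' = G \<circ>\<^sub>p [:c, 1:]"
  have pd: "poly (pderiv G') t = poly (pderiv G) (c + t)" for t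
    by (simp add: G'_def pderiv_pcompose poly_pcompose pderiv_pCons)
  show ?thesis
  proof (rule that[of "3 * D" G'])
    show "3 * D \<noteq> 0" using D(1) by simp
    show "Polynomial.degree G' > 0" using degree_pos by (simp add: G'_def)
    show "poly G' 0 \<noteq> 0" using c by (simp add: G'_def poly_pcompose)
    fix p t assume "prime p" "\<not> int p dvd 3 * D" "int p dvd poly G' t"
    from main[OF this(1,2), of "c + t"] this(3)
    show "p mod 3 = 1 \<and> \<not> int p dvd poly (pderiv G') t \<and>
       (\<exists>P :: 'k set. place_ideal P \<and> of_nat p \<in> P \<and> (\<forall>a. algebraic_int a \<longrightarrow> (\<exists>m. a - of_int m \<in> P)))"
      unfolding pd by (simp add: G'_def poly_pcompose)
  qed
qed

section \<open>Prime divisors of polynomial values\<close>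

lemma int_prime_divisor:
  fixes x :: int
  assumes "\<bar>x\<bar> \<noteq> 1"
  obtains p where "prime p" "int p dvd x"
proof -
  have "nat \<bar>x\<bar> \<noteq> 1" using assms by simp
  then obtain p where p: "prime p" "p dvd nat \<bar>x\<bar>" using prime_factor_nat by blast
  hence "int p dvd x" by simp
  with p(1) show ?thesis by (rule that)
qed

lemma poly_dvd_diff: "(a - b :: int) dvd poly G a - poly G b"
proof (induction G)
  case (pCons c G)
  have "poly (pCons c G) a - poly (pCons c G) b = a * (poly G a - poly G b) + (a - b) * poly G b"
    by (simp add: algebra_simps)
  thus ?case using pCons.IH by (metis dvd_add dvd_mult dvd_triv_left)
qed simp

text \<open>Schur's argument for the infinitude of prime divisors of polynomial values.\<close>

lemma poly_value_new_factor:
  fixes G :: "int poly"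
  obtains k where "poly G (poly G 0 * m * s) = poly G 0 * (1 + m * k)"
proof -
  obtain e where "G = pCons (poly G 0) e" by (cases G) auto
  hence "poly G (poly G 0 * m * s) = poly G 0 + poly G 0 * m * s * poly e (poly G 0 * m * s)"
    by (metis poly_pCons)
  thus ?thesis using that[of "s * poly e (poly G 0 * m * s)"] by (simp add: algebra_simps)
qed

text \<open>At G(0) m s the value is G(0) (1 + m k), and 1 + m k is coprime to m. It differs from 1
  and -1 for suitable s, because G takes the values G(0) and -G(0) only finitely often.\<close>

lemma prime_dividing_value_avoiding:
  fixes G :: "int poly"
  assumes G: "Polynomial.degree G > 0" "poly G 0 \<noteq> 0" and m: "m \<noteq> 0"
  obtains p t where "prime p" "\<not> int p dvd m" "int p dvd poly G t"
proof -
  define bad where "bad = {x. poly (G - [:poly G 0:]) x = 0} \<union> {x. poly (G + [:poly G 0:]) x = 0}"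
  have "G - [:c:] \<noteq> 0" "G + [:c:] \<noteq> 0" for c
    using G(1) by (auto simp flip: eq_neg_iff_add_eq_0)
  hence "finite bad" unfolding bad_def by (intro finite_UnI poly_roots_finite)
  hence "finite {s. poly G 0 * m * s \<in> bad}"
    using finite_vimageI[of bad "\<lambda>s. poly G 0 * m * s"] G(2) m by (auto simp: vimage_def inj_on_def)
  then obtain s where s: "poly G 0 * m * s \<notin> bad" using ex_new_if_finite[OF infinite_UNIV_int] by blast
  obtain k where k: "poly G (poly G 0 * m * s) = poly G 0 * (1 + m * k)" using poly_value_new_factor .
  have "poly G (poly G 0 * m * s) \<noteq> poly G 0" "poly G (poly G 0 * m * s) \<noteq> - poly G 0"
    using s by (auto simp: bad_def eq_neg_iff_add_eq_0)
  hence "1 + m * k \<noteq> 1" "1 + m * k \<noteq> - 1" unfolding k by (metis mult.right_neutral, metis mult_minus1_right)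
  hence "\<bar>1 + m * k\<bar> \<noteq> 1" by linarith
  then obtain p where p: "prime p" "int p dvd 1 + m * k" using int_prime_divisor by blast
  have "\<not> int p dvd m"
  proof
    assume "int p dvd m"
    hence "int p dvd 1" using p(2) by (metis dvd_add_left_iff dvd_mult2)
    thus False using prime_gt_1_nat[OF p(1)] by simp
  qed
  moreover have "int p dvd poly G (poly G 0 * m * s)" unfolding k using p(2) by simp
  ultimately show ?thesis using that p(1) by blast
qed

text \<open>
  Here \<open>t\<close> is a multiple of \<open>m G(0)\<close>, as in Schur's argument; since \<open>t0\<close> is a simple root, its
  residue modulo \<open>l\<^sup>2\<close> can be adjusted to give \<open>M\<close> any residue modulo \<open>l\<close>.
\<close>

lemma poly_value_prescribed:
  fixes G :: "int poly"
  assumes G0: "poly G 0 \<noteq> 0" and l: "prime l" and t0: "int l dvd poly G t0" "\<not> int l dvd poly (pderiv G) t0"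
    and lG: "\<not> int l dvd poly G 0" and m: "coprime m (int l)"
  obtains t M where "poly G t = int l * poly G 0 * M" "[M = r] (mod int l)" "[int l * M = 1] (mod m)"
proof -
  have lp: "prime (int l)" using l by simp
  have l0: "l > 0" using l by (rule prime_gt_0_nat)
  define c where "c = poly G 0 * m"
  have "coprime c (int l)" unfolding c_def using m lp lG by (simp add: prime_imp_coprime coprime_commute)
  hence cl: "coprime c (int l ^ 2)" by simp
  obtain u where u: "poly G t0 = int l * u" using t0(1) ..
  have "coprime (poly (pderiv G) t0) (int l)" using t0(2) lp by (simp add: prime_imp_coprime coprime_commute)
  then obtain g where g: "[poly (pderiv G) t0 * g = 1] (mod int l)" using cong_solve_coprime_int by blast
  \<comment> \<open>Solves u + v G'(t0) = G(0) r modulo l: the linear Taylor term moves G / l to the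
    prescribed class.\<close>
  define v where "v = g * (poly G 0 * r - u)"
  obtain e where e: "[c * e = 1] (mod int l ^ 2)" using cong_solve_coprime_int[OF cl] by blast
  \<comment> \<open>Then c s is a multiple of m G(0) and congruent to t0 + l v modulo l^2; the
    square is needed because G is divided by l afterwards.\<close>
  define s where "s = e * (t0 + int l * v)"
  have "[c * e * (t0 + int l * v) = 1 * (t0 + int l * v)] (mod int l ^ 2)" using e by (rule cong_scalar_right)
  hence cs: "[c * s = t0 + int l * v] (mod int l ^ 2)" by (simp add: s_def mult.assoc)
  obtain k where k: "poly G (c * s) = poly G 0 * (1 + m * k)"
    using poly_value_new_factor[of G m s] unfolding c_def by blast
  have "int l ^ 2 dvd poly G (c * s) - poly G (t0 + int l * v)"
    using cs poly_dvd_diff dvd_trans unfolding cong_iff_dvd_diff by blast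
  moreover have "int l ^ 2 dvd poly G (t0 + int l * v) - (poly G t0 + int l * v * poly (pderiv G) t0)"
  proof -
    have "x ^ 2 dvd poly G (y + x) - (poly G y + x * poly (pderiv G) y)" for x y :: int
    proof (induction G)
      case (pCons a G)
      have "poly (pCons a G) (y + x) - (poly (pCons a G) y + x * poly (pderiv (pCons a G)) y)
        = (y + x) * (poly G (y + x) - (poly G y + x * poly (pderiv G) y)) + x ^ 2 * poly (pderiv G) y"
        by (simp add: pderiv_pCons algebra_simps power2_eq_square)
      thus ?case using pCons.IH by simp
    qed simp
    from this[of "int l * v" t0] show ?thesis by (metis dvd_mult_left power_mult_distrib)
  qed
  ultimately have "int l ^ 2 dvd poly G (c * s) - (poly G t0 + int l * v * poly (pderiv G) t0)"
    by (metis (no_types, lifting) diff_add_cancel add_diff_eq dvd_add)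
  then obtain w where w: "poly G (c * s) - (int l * u + int l * v * poly (pderiv G) t0) = int l ^ 2 * w"
    unfolding u ..
  hence Gl: "poly G (c * s) = int l * (u + v * poly (pderiv G) t0 + int l * w)"
    by (simp add: algebra_simps power2_eq_square)
  hence "int l dvd poly G 0 * (1 + m * k)" unfolding k[symmetric] by simp
  hence "int l dvd 1 + m * k" using lG by (simp add: prime_dvd_mult_iff[OF lp])
  then obtain M where M: "1 + m * k = int l * M" ..
  have GM: "poly G (c * s) = int l * poly G 0 * M" unfolding k M by (simp add: mult_ac)
  have "poly G 0 * M = u + v * poly (pderiv G) t0 + int l * w"
    using Gl GM l0 by (simp add: mult.assoc)
  hence "[poly G 0 * M = u + v * poly (pderiv G) t0] (mod int l)" by (simp add: cong_iff_dvd_diff)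
  also have "u + v * poly (pderiv G) t0 = u + poly (pderiv G) t0 * g * (poly G 0 * r - u)"
    by (simp add: v_def mult_ac)
  also have "[\<dots> = u + 1 * (poly G 0 * r - u)] (mod int l)"
    using g by (intro cong_add cong_refl cong_scalar_right)
  finally have "[poly G 0 * M = poly G 0 * r] (mod int l)" by simp
  hence "int l dvd poly G 0 * (M - r)" by (simp add: cong_iff_dvd_diff right_diff_distrib)
  hence "[M = r] (mod int l)" using lG by (simp add: prime_dvd_mult_iff[OF lp] cong_iff_dvd_diff)
  moreover have "[int l * M = 1] (mod m)" unfolding M[symmetric] by (simp add: cong_iff_dvd_diff)
  ultimately show ?thesis using that GM by blast
qed

section \<open>Reduction at a place\<close>

locale place =
  fixes P :: "'k::field_char_0 set"
  assumes P: "place_ideal P"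
begin

definition \<O> :: "'k set" where
  "\<O> = {a / b | a b. algebraic_int a \<and> algebraic_int b \<and> b \<notin> P}"

abbreviation "\<MM> \<equiv> local_max_ideal P"
abbreviation "F \<equiv> residue_field P"
abbreviation "res \<equiv> residue P"

lemma local_ring_simps [simp]:
  "carrier (local_ring P) = \<O>"
  "x \<oplus>\<^bsub>local_ring P\<^esub> y = x + y" "x \<otimes>\<^bsub>local_ring P\<^esub> y = x * (y :: 'k)"
  "\<zero>\<^bsub>local_ring P\<^esub> = 0" "\<one>\<^bsub>local_ring P\<^esub> = 1"
  by (simp_all add: local_ring_def ring_of_type_algebra_def \<O>_def)

lemma OI: "algebraic_int a \<Longrightarrow> algebraic_int b \<Longrightarrow> b \<notin> P \<Longrightarrow> a / b \<in> \<O>"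
  unfolding \<O>_def by blast

lemma MI: "a \<in> P \<Longrightarrow> algebraic_int b \<Longrightarrow> b \<notin> P \<Longrightarrow> a / b \<in> \<MM>"
  unfolding local_max_ideal_def by blast

lemma not_P: "b \<notin> P \<Longrightarrow> b \<noteq> 0" "b \<notin> P \<Longrightarrow> c \<notin> P \<Longrightarrow> algebraic_int b \<Longrightarrow> algebraic_int c \<Longrightarrow> b * c \<notin> P"
  using place_idealD(2,10)[OF P] by blast+

lemma O_algebraic_int: "algebraic_int a \<Longrightarrow> a \<in> \<O>"
  using OI[of a 1] place_idealD(3)[OF P] by simp

lemma O_add: "x \<in> \<O> \<Longrightarrow> y \<in> \<O> \<Longrightarrow> x + y \<in> \<O>"
proof -
  assume "x \<in> \<O>" "y \<in> \<O>"
  then obtain a b c d where x: "x = a / b" "algebraic_int a" "algebraic_int b" "b \<notin> P"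
    and y: "y = c / d" "algebraic_int c" "algebraic_int d" "d \<notin> P" unfolding \<O>_def by blast
  have "x + y = (a * d + c * b) / (b * d)"
    using not_P(1)[OF x(4)] not_P(1)[OF y(4)] by (simp add: x(1) y(1) field_simps)
  moreover have "\<dots> \<in> \<O>" using x y by (intro OI algebraic_int_intros not_P(2))
  ultimately show ?thesis by simp
qed

lemma O_mult: "x \<in> \<O> \<Longrightarrow> y \<in> \<O> \<Longrightarrow> x * y \<in> \<O>"
proof -
  assume "x \<in> \<O>" "y \<in> \<O>"
  then obtain a b c d where x: "x = a / b" "algebraic_int a" "algebraic_int b" "b \<notin> P"
    and y: "y = c / d" "algebraic_int c" "algebraic_int d" "d \<notin> P" unfolding \<O>_def by blast
  have "x * y = (a * c) / (b * d)" by (simp add: x(1) y(1))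
  moreover have "\<dots> \<in> \<O>" using x y by (intro OI algebraic_int_intros not_P(2))
  ultimately show ?thesis by simp
qed

lemma M_subset_O: "x \<in> \<MM> \<Longrightarrow> x \<in> \<O>"
  unfolding \<O>_def local_max_ideal_def using place_idealD(1)[OF P] by blast

lemma M_add: "x \<in> \<MM> \<Longrightarrow> y \<in> \<MM> \<Longrightarrow> x + y \<in> \<MM>"
proof -
  assume "x \<in> \<MM>" "y \<in> \<MM>"
  then obtain a b c d where x: "x = a / b" "a \<in> P" "algebraic_int b" "b \<notin> P"
    and y: "y = c / d" "c \<in> P" "algebraic_int d" "d \<notin> P" unfolding local_max_ideal_def by blast
  have "x + y = (a * d + c * b) / (b * d)"
    using not_P(1)[OF x(4)] not_P(1)[OF y(4)] by (simp add: x(1) y(1) field_simps)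
  moreover have "\<dots> \<in> \<MM>" using x y by (intro MI algebraic_int_intros not_P(2) place_idealD(5,9)[OF P])
  ultimately show ?thesis by simp
qed

lemma M_mult: "x \<in> \<MM> \<Longrightarrow> y \<in> \<O> \<Longrightarrow> x * y \<in> \<MM>" "x \<in> \<MM> \<Longrightarrow> y \<in> \<O> \<Longrightarrow> y * x \<in> \<MM>"
proof -
  show *: "x * y \<in> \<MM>" if xy: "x \<in> \<MM>" "y \<in> \<O>"
  proof -
    obtain a b where x: "x = a / b" "a \<in> P" "algebraic_int b" "b \<notin> P"
      using xy(1) unfolding local_max_ideal_def by blast
    obtain c d where y: "y = c / d" "algebraic_int c" "algebraic_int d" "d \<notin> P"
      using xy(2) unfolding \<O>_def by blast
    have "x * y = (a * c) / (b * d)" by (simp add: x(1) y(1))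
    moreover have "\<dots> \<in> \<MM>" using x y by (intro MI algebraic_int_intros not_P(2) place_idealD(9)[OF P])
    ultimately show ?thesis by simp
  qed
  thus "y * x \<in> \<MM>" if "x \<in> \<MM>" "y \<in> \<O>" using that by (simp add: mult.commute)
qed

lemma O_basic [simp]: "0 \<in> \<O>" "1 \<in> \<O>" "of_nat n \<in> \<O>" "of_int k \<in> \<O>"
  by (auto intro: O_algebraic_int)

lemma O_uminus: "x \<in> \<O> \<Longrightarrow> - x \<in> \<O>"
  using O_mult[of "of_int (-1)" x] O_basic(4)[of "-1"] by simp

lemma M_uminus: "x \<in> \<MM> \<Longrightarrow> - x \<in> \<MM>"
  using M_mult(1)[of x "of_int (-1)"] O_basic(4)[of "-1"] by simp

lemma M_diff: "x \<in> \<MM> \<Longrightarrow> y \<in> \<MM> \<Longrightarrow> x - y \<in> \<MM>"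
  using M_add[of x "- y"] M_uminus by simp

lemma O_sum: "(\<And>i. i \<in> I \<Longrightarrow> f i \<in> \<O>) \<Longrightarrow> sum f I \<in> \<O>"
  by (induction I rule: infinite_finite_induct) (auto intro: O_add)

lemma O_power: "x \<in> \<O> \<Longrightarrow> x ^ n \<in> \<O>"
  by (induction n) (auto intro: O_mult)

lemma M_algebraic_int_iff: "algebraic_int a \<Longrightarrow> a \<in> \<MM> \<longleftrightarrow> a \<in> P"
proof
  assume a: "algebraic_int a" "a \<in> \<MM>"
  then obtain c b where c: "a = c / b" "c \<in> P" "algebraic_int b" "b \<notin> P"
    unfolding local_max_ideal_def by blast
  hence "a * b \<in> P" using not_P(1)[OF c(4)] by simp
  thus "a \<in> P" using place_idealD(10)[OF P a(1) c(3)] c(4) by blast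
next
  assume "algebraic_int a" "a \<in> P"
  thus "a \<in> \<MM>" using MI[of a 1] place_idealD(3)[OF P] by simp
qed

lemma M_0: "0 \<in> \<MM>" and M_1: "1 \<notin> \<MM>"
  using M_algebraic_int_iff[of 0] M_algebraic_int_iff[of 1] place_idealD(2,3)[OF P] by auto

lemma inverse_O:
  assumes "x \<in> \<O>" "x \<notin> \<MM>"
  shows "inverse x \<in> \<O>" "x \<noteq> 0"
proof -
  show "x \<noteq> 0" using assms(2) M_0 by auto
  obtain a b where x: "x = a / b" "algebraic_int a" "algebraic_int b" "b \<notin> P"
    using assms(1) unfolding \<O>_def by blast
  have "a \<notin> P" using MI[OF _ x(3,4)] x(1) assms(2) by blast
  thus "inverse x \<in> \<O>" using OI[OF x(3,2)] by (simp add: x(1) inverse_eq_divide)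
qed

lemma M_prime:
  assumes "x \<in> \<O>" "y \<in> \<O>" "x * y \<in> \<MM>"
  shows "x \<in> \<MM> \<or> y \<in> \<MM>"
proof (rule ccontr)
  assume "\<not> ?thesis"
  hence "inverse x \<in> \<O>" "x \<noteq> 0" using inverse_O assms(1) by blast+
  hence "y = inverse x * (x * y)" by simp
  hence "y \<in> \<MM>" using M_mult(2)[OF assms(3) \<open>inverse x \<in> \<O>\<close>] by metis
  with \<open>\<not> ?thesis\<close> show False by blast
qed

lemma cring_local_ring: "cring (local_ring P)"
proof (rule cringI)
  show "abelian_group (local_ring P)"
  proof (rule abelian_groupI)
    show "\<exists>y\<in>carrier (local_ring P). y \<oplus>\<^bsub>local_ring P\<^esub> x = \<zero>\<^bsub>local_ring P\<^esub>"
      if "x \<in> carrier (local_ring P)" for x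
      using that O_uminus by (intro bexI[of _ "- x"]) auto
  qed (auto intro: O_add)
  show "comm_monoid (local_ring P)"
    by (rule comm_monoidI) (auto intro: O_mult)
qed (auto simp: distrib_right)

interpretation L: cring "local_ring P" by (rule cring_local_ring)

lemma local_ring_inv: "x \<in> \<O> \<Longrightarrow> \<ominus>\<^bsub>local_ring P\<^esub> x = - x"
  using O_uminus by (intro L.minus_equality) auto

lemma local_ring_minus: "x \<in> \<O> \<Longrightarrow> y \<in> \<O> \<Longrightarrow> x \<ominus>\<^bsub>local_ring P\<^esub> y = x - y"
  by (simp add: a_minus_def local_ring_inv)

lemma ideal_M: "ideal \<MM> (local_ring P)"
proof (rule idealI)
  show "ring (local_ring P)" by (rule L.ring_axioms)
  show "subgroup \<MM> (add_monoid (local_ring P))"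
  proof (rule L.add.subgroupI)
    show "\<MM> \<subseteq> carrier (local_ring P)" "\<MM> \<noteq> {}" using M_subset_O M_0 by auto
    show "\<ominus>\<^bsub>local_ring P\<^esub> a \<in> \<MM>" if "a \<in> \<MM>" for a
      using that local_ring_inv M_subset_O M_uminus by simp
    show "a \<oplus>\<^bsub>local_ring P\<^esub> b \<in> \<MM>" if "a \<in> \<MM>" "b \<in> \<MM>" for a b
      using that M_add by simp
  qed
qed (use M_mult in auto)

lemma maximalideal_M: "maximalideal \<MM> (local_ring P)"
proof (rule maximalidealI[OF ideal_M])
  show "carrier (local_ring P) \<noteq> \<MM>" using M_1 O_basic(2) by auto
  fix J assume J: "ideal J (local_ring P)" "\<MM> \<subseteq> J" "J \<subseteq> carrier (local_ring P)"
  show "J = \<MM> \<or> J = carrier (local_ring P)"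
  proof (rule ccontr)
    assume n: "\<not> ?thesis"
    then obtain x where x: "x \<in> J" "x \<notin> \<MM>" using J(2) by blast
    have xO: "x \<in> \<O>" using x(1) J(3) by auto
    have "x * inverse x \<in> J"
      using ideal.I_r_closed[OF J(1) x(1), of "inverse x"] inverse_O[OF xO x(2)] by simp
    hence "\<one>\<^bsub>local_ring P\<^esub> \<in> J" using inverse_O(2)[OF xO x(2)] by simp
    hence "J = carrier (local_ring P)" by (rule ideal.one_imp_carrier[OF J(1)])
    with n show False by blast
  qed
qed

lemma field_F: "field F"
  unfolding residue_field_def by (rule maximalideal.quotient_is_field[OF maximalideal_M cring_local_ring])

sublocale F: field F by (rule field_F)

lemma res_hom: "res \<in> Ring.ring_hom (local_ring P) F"
  unfolding residue_field_def residue_def[abs_def] by (rule ideal.rcos_ring_hom[OF ideal_M])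

lemma res_closed [simp]: "x \<in> \<O> \<Longrightarrow> res x \<in> carrier F"
  using Ring.ring_hom_closed[OF res_hom] by simp

lemma res_add: "x \<in> \<O> \<Longrightarrow> y \<in> \<O> \<Longrightarrow> res (x + y) = res x \<oplus>\<^bsub>F\<^esub> res y"
  using Ring.ring_hom_add[OF res_hom] by simp

lemma res_mult: "x \<in> \<O> \<Longrightarrow> y \<in> \<O> \<Longrightarrow> res (x * y) = res x \<otimes>\<^bsub>F\<^esub> res y"
  using Ring.ring_hom_mult[OF res_hom] by simp

lemma res_1: "res 1 = \<one>\<^bsub>F\<^esub>"
  using Ring.ring_hom_one[OF res_hom] by simp

lemma res_0: "res 0 = \<zero>\<^bsub>F\<^esub>"
  using Ring.ring_hom_zero[OF res_hom L.ring_axioms F.ring_axioms] by simp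

lemma res_eq_iff: "x \<in> \<O> \<Longrightarrow> y \<in> \<O> \<Longrightarrow> res x = res y \<longleftrightarrow> x - y \<in> \<MM>"
  unfolding residue_def using L.quotient_eq_iff_same_a_r_cos[OF ideal_M, of x y] local_ring_minus by simp

lemma res_eq_0_iff: "x \<in> \<O> \<Longrightarrow> res x = \<zero>\<^bsub>F\<^esub> \<longleftrightarrow> x \<in> \<MM>"
  using res_eq_iff[of x 0] by (simp add: res_0)

lemma carrier_F: "carrier F = res ` \<O>"
  by (auto simp: residue_field_def FactRing_def A_RCOSETS_def' residue_def)

lemma res_power: "x \<in> \<O> \<Longrightarrow> res (x ^ n) = res x [^]\<^bsub>F\<^esub> n"
proof (induction n)
  case (Suc n)
  thus ?case using res_mult[of "x ^ n" x] O_power by (simp add: mult.commute)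
qed (simp add: res_1)

lemma res_sum:
  fixes f :: "nat \<Rightarrow> 'k"
  assumes "\<And>k. k \<le> n \<Longrightarrow> f k \<in> \<O>"
  shows "res (\<Sum>k\<le>n. f k) = (\<Oplus>\<^bsub>F\<^esub>k\<in>{..n}. res (f k))"
  using assms
proof (induction n)
  case (Suc n)
  have "res (\<Sum>k\<le>Suc n. f k) = res (f (Suc n)) \<oplus>\<^bsub>F\<^esub> res (\<Sum>k\<le>n. f k)"
    using Suc.prems by (subst res_add[symmetric]) (auto intro: O_sum simp: add.commute)
  also have "\<dots> = (\<Oplus>\<^bsub>F\<^esub>k\<in>{..Suc n}. res (f k))"
    using Suc by (subst F.finsum_Suc) auto
  finally show ?case .
qed auto

definition O_poly :: "'k poly \<Rightarrow> bool" where
  "O_poly p \<longleftrightarrow> (\<forall>i. Polynomial.coeff p i \<in> \<O>)"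

lemma O_poly_mult: "O_poly p \<Longrightarrow> O_poly q \<Longrightarrow> O_poly (p * q)"
  and O_poly_add: "O_poly p \<Longrightarrow> O_poly q \<Longrightarrow> O_poly (p + q)"
  and O_poly_smult: "O_poly p \<Longrightarrow> c \<in> \<O> \<Longrightarrow> O_poly (Polynomial.smult c p)"
  and O_poly_const: "c \<in> \<O> \<Longrightarrow> O_poly [:c:]"
  and O_poly_int: "O_poly (map_poly of_int h)"
  by (auto simp: O_poly_def coeff_mult coeff_pCons coeff_map_poly intro!: O_sum O_mult O_add split: nat.splits)

lemma poly_O: "O_poly p \<Longrightarrow> x \<in> \<O> \<Longrightarrow> poly p x \<in> \<O>"
  unfolding poly_altdef O_poly_def by (intro O_sum O_mult O_power) auto

lemma reduce_poly_set: "O_poly p \<Longrightarrow> set (map res (rev (coeffs p))) \<subseteq> carrier F"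
  unfolding O_poly_def by (auto simp: coeffs_def split: if_splits)

lemma reduce_poly_carrier: "O_poly p \<Longrightarrow> reduce_poly P p \<in> carrier (poly_ring F)"
  unfolding reduce_poly_def univ_poly_carrier[symmetric]
  by (intro F.normalize_gives_polynomial reduce_poly_set)

lemma reduce_poly_coeff:
  assumes "O_poly p"
  shows "F.coeff (reduce_poly P p) i = res (Polynomial.coeff p i)"
proof -
  have "F.coeff (reduce_poly P p) i = F.coeff (map res (rev (coeffs p))) i"
    unfolding reduce_poly_def by (rule F.normalize_coeff[THEN fun_cong, symmetric])
  also have "\<dots> = res (Polynomial.coeff p i)"
  proof (cases "i < length (coeffs p)")
    case True
    hence "F.coeff (map res (rev (coeffs p))) i = map res (rev (coeffs p)) ! (length (coeffs p) - 1 - i)"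
      by (subst F.coeff_nth) simp_all
    also have "\<dots> = res (coeffs p ! i)" using True by (simp add: rev_nth)
    also have "\<dots> = res (Polynomial.coeff p i)"
      using True by (simp add: nth_coeffs_coeff length_coeffs_degree split: if_splits)
    finally show ?thesis .
  next
    case False
    hence "Polynomial.coeff p i = 0"
      by (cases "p = 0") (auto simp: length_coeffs_degree coeff_eq_0)
    thus ?thesis using False by (simp add: F.coeff_length res_0)
  qed
  finally show ?thesis .
qed

lemma reduce_poly_eqI:
  assumes "O_poly p" "q \<in> carrier (poly_ring F)" "\<And>i. F.coeff q i = res (Polynomial.coeff p i)"
  shows "q = reduce_poly P p"
  using assms reduce_poly_carrier[OF assms(1)] reduce_poly_coeff[OF assms(1)]
    F.coeff_iff_polynomial_cond[of "carrier F" q "reduce_poly P p"]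
  by (auto simp: univ_poly_carrier[symmetric])

lemma poly_ring_set: "p \<in> carrier (poly_ring F) \<Longrightarrow> set p \<subseteq> carrier F"
  by (simp add: univ_poly_carrier[symmetric] F.polynomial_incl)

lemma reduce_poly_mult:
  assumes p: "O_poly p" and q: "O_poly q"
  shows "reduce_poly P p \<otimes>\<^bsub>poly_ring F\<^esub> reduce_poly P q = reduce_poly P (p * q)"
proof (rule reduce_poly_eqI[OF O_poly_mult[OF p q]])
  interpret U: cring "poly_ring F" by (rule F.univ_poly_is_cring[OF F.carrier_is_subring])
  note c = reduce_poly_carrier[OF p] reduce_poly_carrier[OF q]
  show "reduce_poly P p \<otimes>\<^bsub>poly_ring F\<^esub> reduce_poly P q \<in> carrier (poly_ring F)" using c by simp
  fix i
  have "F.coeff (reduce_poly P p \<otimes>\<^bsub>poly_ring F\<^esub> reduce_poly P q) i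
      = (\<Oplus>\<^bsub>F\<^esub>k\<in>{..i}. F.coeff (reduce_poly P p) k \<otimes>\<^bsub>F\<^esub> F.coeff (reduce_poly P q) (i - k))"
    unfolding univ_poly_mult using F.poly_mult_coeff[OF c[THEN poly_ring_set]] by simp
  also have "\<dots> = (\<Oplus>\<^bsub>F\<^esub>k\<in>{..i}. res (Polynomial.coeff p k * Polynomial.coeff q (i - k)))"
    using p q by (simp add: reduce_poly_coeff res_mult O_poly_def)
  also have "\<dots> = res (\<Sum>k\<le>i. Polynomial.coeff p k * Polynomial.coeff q (i - k))"
    using p q by (intro res_sum[symmetric]) (auto simp: O_poly_def intro: O_mult)
  finally show "F.coeff (reduce_poly P p \<otimes>\<^bsub>poly_ring F\<^esub> reduce_poly P q) i = res (Polynomial.coeff (p * q) i)"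
    by (simp add: coeff_mult)
qed

lemma reduce_poly_add:
  assumes p: "O_poly p" and q: "O_poly q"
  shows "reduce_poly P p \<oplus>\<^bsub>poly_ring F\<^esub> reduce_poly P q = reduce_poly P (p + q)"
proof (rule reduce_poly_eqI[OF O_poly_add[OF p q]])
  interpret U: cring "poly_ring F" by (rule F.univ_poly_is_cring[OF F.carrier_is_subring])
  note c = reduce_poly_carrier[OF p] reduce_poly_carrier[OF q]
  show "reduce_poly P p \<oplus>\<^bsub>poly_ring F\<^esub> reduce_poly P q \<in> carrier (poly_ring F)" using c by simp
  fix i
  show "F.coeff (reduce_poly P p \<oplus>\<^bsub>poly_ring F\<^esub> reduce_poly P q) i = res (Polynomial.coeff (p + q) i)"
    unfolding univ_poly_add using F.poly_add_coeff[OF c[THEN poly_ring_set]] p q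
    by (simp add: reduce_poly_coeff res_add O_poly_def)
qed

lemma reduce_poly_const: "c \<in> \<O> \<Longrightarrow> c \<notin> \<MM> \<Longrightarrow> reduce_poly P [:c:] = [res c]"
  using res_eq_0_iff[of c] inverse_O(2)[of c] by (simp add: reduce_poly_def cCons_def)

text \<open>The identity survives reduction with a nonzero constant on the right, and every common
  divisor divides that constant.\<close>

lemma pcoprime_if_bezout:
  assumes "O_poly R" "O_poly S" "O_poly U" "O_poly V" "c \<in> \<O>" "c \<notin> \<MM>" "U * R + V * S = [:c:]"
  shows "pcoprime F (reduce_poly P R) (reduce_poly P S)"
  unfolding pcoprime_def
proof (intro ballI impI, elim conjE)
  interpret U: cring "poly_ring F" by (rule F.univ_poly_is_cring[OF F.carrier_is_subring])
  fix d assume d: "d \<in> carrier (poly_ring F)" "d pdivides\<^bsub>F\<^esub> reduce_poly P R" "d pdivides\<^bsub>F\<^esub> reduce_poly P S"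
  note c = assms(1-4)[THEN reduce_poly_carrier]
  obtain r s where rs: "r \<in> carrier (poly_ring F)" "s \<in> carrier (poly_ring F)"
    "reduce_poly P R = d \<otimes>\<^bsub>poly_ring F\<^esub> r" "reduce_poly P S = d \<otimes>\<^bsub>poly_ring F\<^esub> s"
    using d(2,3) unfolding pdivides_def factor_def by blast
  let ?u = "reduce_poly P U" and ?v = "reduce_poly P V"
  have "[res c] = ?u \<otimes>\<^bsub>poly_ring F\<^esub> reduce_poly P R \<oplus>\<^bsub>poly_ring F\<^esub> ?v \<otimes>\<^bsub>poly_ring F\<^esub> reduce_poly P S"
    using assms by (simp add: reduce_poly_mult reduce_poly_add O_poly_mult reduce_poly_const)
  also have "\<dots> = d \<otimes>\<^bsub>poly_ring F\<^esub> (?u \<otimes>\<^bsub>poly_ring F\<^esub> r \<oplus>\<^bsub>poly_ring F\<^esub> ?v \<otimes>\<^bsub>poly_ring F\<^esub> s)"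
    unfolding rs(3,4) using c d(1) rs(1,2) by (simp add: U.r_distr U.m_lcomm)
  finally have eq: "d \<otimes>\<^bsub>poly_ring F\<^esub> (?u \<otimes>\<^bsub>poly_ring F\<^esub> r \<oplus>\<^bsub>poly_ring F\<^esub> ?v \<otimes>\<^bsub>poly_ring F\<^esub> s) = [res c]" ..
  have "[res c] \<in> Units (poly_ring F)"
    using F.univ_poly_carrier_units assms(5,6) res_eq_0_iff by auto
  thus "d \<in> Units (poly_ring F)"
    unfolding eq[symmetric] by (rule U.unit_factor) (use c d(1) rs in auto)
qed

lemma eval_reduce_poly:
  assumes "O_poly p" "x \<in> \<O>"
  shows "F.eval (reduce_poly P p) (res x) = res (poly p x)"
proof -
  have *: "F.eval (map res xs) (res x) = res (poly (Poly (rev xs)) x) \<and> poly (Poly (rev xs)) x \<in> \<O>"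
    if "set xs \<subseteq> \<O>" for xs
    using that
  proof (induction xs)
    case Nil
    show ?case by (simp add: res_0)
  next
    case (Cons a xs)
    have "poly (Poly (rev (a # xs))) x = a * x ^ length xs + poly (Poly (rev xs)) x"
      by (simp add: Poly_append poly_monom mult.commute)
    moreover have "a * x ^ length xs \<in> \<O>" using Cons.prems assms(2) by (auto intro: O_mult O_power)
    ultimately show ?case using Cons assms(2)
      by (auto simp: res_add res_mult res_power O_power intro: O_add)
  qed
  have "F.eval (reduce_poly P p) (res x) = F.eval (map res (rev (coeffs p))) (res x)"
    unfolding reduce_poly_def using reduce_poly_set[OF assms(1)] assms(2) by (intro F.eval_normalize) auto
  also have "\<dots> = res (poly p x)"
  proof -
    have "set (rev (coeffs p)) \<subseteq> \<O>"
      using assms(1) by (auto simp: O_poly_def coeffs_def split: if_splits)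
    from *[OF this] show ?thesis by simp
  qed
  finally show ?thesis .
qed

lemma degree_reduce_poly:
  assumes "O_poly p" "Polynomial.lead_coeff p \<notin> \<MM>"
  shows "Polynomials.degree (reduce_poly P p) = Polynomial.degree p"
proof -
  have p0: "p \<noteq> 0" using assms(2) M_0 by auto
  hence ne: "coeffs p \<noteq> []" by simp
  have "hd (map res (rev (coeffs p))) = res (Polynomial.lead_coeff p)"
    using ne by (simp add: hd_map hd_rev last_coeffs_eq_coeff_degree p0)
  also have "\<dots> \<noteq> \<zero>\<^bsub>F\<^esub>" using assms by (simp add: res_eq_0_iff O_poly_def)
  finally have "hd (map res (rev (coeffs p))) \<noteq> \<zero>\<^bsub>F\<^esub>" .
  hence "reduce_poly P p = map res (rev (coeffs p))"
    unfolding reduce_poly_def using ne by (cases "map res (rev (coeffs p))") auto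
  thus ?thesis using p0 by (simp add: length_coeffs_degree)
qed

lemma degree_reduce_poly_le:
  "Polynomials.degree (reduce_poly P p) \<le> Polynomial.degree p"
proof -
  have "length (reduce_poly P p) \<le> length (coeffs p)"
    unfolding reduce_poly_def using F.normalize_length_le[of "map res (rev (coeffs p))"] by simp
  thus ?thesis by (cases "p = 0") (auto simp: length_coeffs_degree)
qed

text \<open>The reduction of the point (x : y). Since \<open>proj_ratio\<close> would also return a
  value for (0 : 0), comparisons such as \<open>pr_eq_iff\<close> assume that x and y are not both
  in \<open>\<MM>\<close>.\<close>

definition pr :: "'k \<Rightarrow> 'k \<Rightarrow> 'k set option" where
  "pr x y = proj_ratio F (res x) (res y)"

lemma pr_eq_iff:
  assumes O: "x \<in> \<O>" "y \<in> \<O>" "x' \<in> \<O>" "y' \<in> \<O>"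
    and nz: "x \<notin> \<MM> \<or> y \<notin> \<MM>" "x' \<notin> \<MM> \<or> y' \<notin> \<MM>"
  shows "pr x y = pr x' y' \<longleftrightarrow> x * y' - x' * y \<in> \<MM>"
proof (cases "y \<in> \<MM> \<or> y' \<in> \<MM>")
  case True
  have 1: "x * y' - x' * y \<in> \<MM> \<longleftrightarrow> y' \<in> \<MM>" if "y \<in> \<MM>"
  proof -
    have "x \<notin> \<MM>" using nz that by blast
    have xy: "x' * y \<in> \<MM>" using that O by (intro M_mult)
    hence "x * y' - x' * y \<in> \<MM> \<longleftrightarrow> x * y' \<in> \<MM>"
      using M_add[of "x * y' - x' * y" "x' * y"] M_diff[of "x * y'" "x' * y"] by auto
    thus ?thesis using M_prime[OF O(1,4)] \<open>x \<notin> \<MM>\<close> M_mult(2)[of y' x] O by blast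
  qed
  have 2: "x * y' - x' * y \<in> \<MM> \<longleftrightarrow> y \<in> \<MM>" if "y' \<in> \<MM>"
  proof -
    have "x' \<notin> \<MM>" using nz that by blast
    have xy: "x * y' \<in> \<MM>" using that O by (intro M_mult)
    hence "x * y' - x' * y \<in> \<MM> \<longleftrightarrow> x' * y \<in> \<MM>"
      using M_diff[of "x * y'" "x * y' - x' * y"] M_diff[of "x * y'" "x' * y"] by auto
    thus ?thesis using M_prime[OF O(3,2)] \<open>x' \<notin> \<MM>\<close> M_mult(2)[of y x'] O by blast
  qed
  have "pr x y = pr x' y' \<longleftrightarrow> (y \<in> \<MM> \<longleftrightarrow> y' \<in> \<MM>)"
    using True O by (auto simp: pr_def proj_ratio_def res_eq_0_iff)
  thus ?thesis using 1 2 True by blast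
next
  case False
  have U: "res y \<in> Units F" "res y' \<in> Units F"
    using False O by (auto simp: F.field_Units res_eq_0_iff)
  have "pr x y = pr x' y' \<longleftrightarrow> res x \<otimes>\<^bsub>F\<^esub> inv\<^bsub>F\<^esub> res y = res x' \<otimes>\<^bsub>F\<^esub> inv\<^bsub>F\<^esub> res y'"
    using False O by (auto simp: pr_def proj_ratio_def res_eq_0_iff)
  also have "\<dots> \<longleftrightarrow> res x \<otimes>\<^bsub>F\<^esub> res y' = res x' \<otimes>\<^bsub>F\<^esub> res y"
  proof
    assume eq: "res x \<otimes>\<^bsub>F\<^esub> inv\<^bsub>F\<^esub> res y = res x' \<otimes>\<^bsub>F\<^esub> inv\<^bsub>F\<^esub> res y'"
    have "res x \<otimes>\<^bsub>F\<^esub> res y' = (res x \<otimes>\<^bsub>F\<^esub> inv\<^bsub>F\<^esub> res y) \<otimes>\<^bsub>F\<^esub> (res y \<otimes>\<^bsub>F\<^esub> res y')"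
      using O U by (simp add: F.m_assoc F.Units_inv_closed flip: F.m_assoc[of "inv\<^bsub>F\<^esub> res y"])
    also have "\<dots> = res x' \<otimes>\<^bsub>F\<^esub> ((inv\<^bsub>F\<^esub> res y' \<otimes>\<^bsub>F\<^esub> res y') \<otimes>\<^bsub>F\<^esub> res y)"
      unfolding eq using O U by (simp add: F.m_ac F.Units_inv_closed)
    also have "\<dots> = res x' \<otimes>\<^bsub>F\<^esub> res y" using O U by simp
    finally show "res x \<otimes>\<^bsub>F\<^esub> res y' = res x' \<otimes>\<^bsub>F\<^esub> res y" .
  next
    assume eq: "res x \<otimes>\<^bsub>F\<^esub> res y' = res x' \<otimes>\<^bsub>F\<^esub> res y"
    have "res x \<otimes>\<^bsub>F\<^esub> inv\<^bsub>F\<^esub> res y = (res x \<otimes>\<^bsub>F\<^esub> (res y' \<otimes>\<^bsub>F\<^esub> inv\<^bsub>F\<^esub> res y')) \<otimes>\<^bsub>F\<^esub> inv\<^bsub>F\<^esub> res y"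
      using O U by (subst F.Units_r_inv) simp_all
    also have "\<dots> = (res x \<otimes>\<^bsub>F\<^esub> res y') \<otimes>\<^bsub>F\<^esub> (inv\<^bsub>F\<^esub> res y' \<otimes>\<^bsub>F\<^esub> inv\<^bsub>F\<^esub> res y)"
      using O U by (simp add: F.m_assoc F.Units_inv_closed del: F.Units_r_inv)
    also have "\<dots> = res x' \<otimes>\<^bsub>F\<^esub> inv\<^bsub>F\<^esub> res y' \<otimes>\<^bsub>F\<^esub> (res y \<otimes>\<^bsub>F\<^esub> inv\<^bsub>F\<^esub> res y)"
      unfolding eq using O U by (simp add: F.m_ac F.Units_inv_closed del: F.Units_r_inv F.Units_l_inv)
    also have "\<dots> = res x' \<otimes>\<^bsub>F\<^esub> inv\<^bsub>F\<^esub> res y'" using O U by (subst F.Units_r_inv) (simp_all add: F.Units_inv_closed)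
    finally show "res x \<otimes>\<^bsub>F\<^esub> inv\<^bsub>F\<^esub> res y = res x' \<otimes>\<^bsub>F\<^esub> inv\<^bsub>F\<^esub> res y'" .
  qed
  also have "\<dots> \<longleftrightarrow> res (x * y') = res (x' * y)" using O by (simp add: res_mult)
  also have "\<dots> \<longleftrightarrow> x * y' - x' * y \<in> \<MM>" using O by (intro res_eq_iff O_mult)
  finally show ?thesis .
qed

lemma pr_closed: "x \<in> \<O> \<Longrightarrow> y \<in> \<O> \<Longrightarrow> pr x y \<in> proj_line F"
  by (auto simp: pr_def proj_ratio_def proj_line_def F.field_Units intro!: F.m_closed F.Units_inv_closed)

lemma pr_1: "x \<in> \<O> \<Longrightarrow> pr x 1 = Some (res x)"
  by (simp add: pr_def proj_ratio_def res_1)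

lemma pr_inf: "x \<in> \<O> \<Longrightarrow> pr x 0 = None"
  by (simp add: pr_def proj_ratio_def res_0)

lemma proj_line_cases:
  assumes "z \<in> proj_line F"
  obtains "z = pr 1 0" | x where "x \<in> \<O>" "z = pr x 1"
  using assms by (auto simp: proj_line_def carrier_F pr_1 pr_inf)

end

section \<open>The duplication map on the x-line\<close>

context place
begin

lemma O_numeral: "numeral n \<in> \<O>"
  using O_basic(3)[of "numeral n"] by simp

lemma O_poly_0: "O_poly 0"
  by (simp add: O_poly_def)

lemma O_poly_pCons: "c \<in> \<O> \<Longrightarrow> O_poly q \<Longrightarrow> O_poly (pCons c q)"
  by (auto simp: O_poly_def coeff_pCons split: nat.splits)

lemma good_reductionD:
  assumes "good_reduction P f" "num_den f = (R, S)"
  shows "O_poly R" "O_poly S" "pcoprime F (reduce_poly P R) (reduce_poly P S)"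
    "max (Polynomials.degree (reduce_poly P R)) (Polynomials.degree (reduce_poly P S)) = rat_degree f"
  using assms by (auto simp: good_reduction_def O_poly_def)

text \<open>A common zero of the reduced polynomials would make X minus that zero a common divisor
  of degree one, against \<open>pcoprime\<close>.\<close>

lemma reduced_map_finite:
  assumes g: "good_reduction P f" "num_den f = (R, S)" and x: "x \<in> \<O>"
  shows "reduced_map P f (pr x 1) = pr (poly R x) (poly S x)"
    "poly R x \<notin> \<MM> \<or> poly S x \<notin> \<MM>"
proof -
  note gr = good_reductionD[OF g]
  show "reduced_map P f (pr x 1) = pr (poly R x) (poly S x)"
    unfolding pr_1[OF x] unfolding pr_def using g(2) gr(1,2) x by (simp add: reduced_map_def eval_reduce_poly)
  show "poly R x \<notin> \<MM> \<or> poly S x \<notin> \<MM>"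
  proof (rule ccontr)
    assume "\<not> ?thesis"
    hence z: "F.eval (reduce_poly P R) (res x) = \<zero>\<^bsub>F\<^esub>" "F.eval (reduce_poly P S) (res x) = \<zero>\<^bsub>F\<^esub>"
      using gr(1,2) x by (simp_all add: eval_reduce_poly res_eq_0_iff poly_O)
    define d where "d = [\<one>\<^bsub>F\<^esub>, \<ominus>\<^bsub>F\<^esub> res x]"
    have d: "d \<in> carrier (poly_ring F)"
      using x by (auto simp: d_def univ_poly_carrier[symmetric] polynomial_def)
    have "d pdivides\<^bsub>F\<^esub> q" if "q \<in> carrier (poly_ring F)" "F.eval q (res x) = \<zero>\<^bsub>F\<^esub>" for q
    proof (cases "q = []")
      case True
      thus ?thesis using F.pdivides_zero[OF F.carrier_is_subring d] by simp
    next
      case False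
      thus ?thesis unfolding d_def using that x by (intro F.is_root_imp_pdivides) (auto simp: F.is_root_def)
    qed
    hence "d \<in> Units (poly_ring F)"
      using gr(1-3) d z reduce_poly_carrier unfolding pcoprime_def by blast
    thus False unfolding F.univ_poly_carrier_units d_def by auto
  qed
qed

lemma reduced_map_infinity:
  assumes g: "good_reduction P f" "num_den f = (R, S)" and n: "rat_degree f > 0"
  shows "reduced_map P f (pr 1 0) = pr (Polynomial.coeff R (rat_degree f)) (Polynomial.coeff S (rat_degree f))"
    "Polynomial.coeff R (rat_degree f) \<notin> \<MM> \<or> Polynomial.coeff S (rat_degree f) \<notin> \<MM>"
proof -
  note gr = good_reductionD[OF g]
  let ?r = "reduce_poly P R" and ?s = "reduce_poly P S"
  show "reduced_map P f (pr 1 0) = pr (Polynomial.coeff R (rat_degree f)) (Polynomial.coeff S (rat_degree f))"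
    unfolding pr_inf[OF O_basic(2)] unfolding pr_def using g(2) gr by (simp add: reduced_map_def reduce_poly_coeff Let_def)
  have *: "F.coeff q (rat_degree f) \<noteq> \<zero>\<^bsub>F\<^esub>" if "q \<in> carrier (poly_ring F)" "Polynomials.degree q = rat_degree f" for q
  proof -
    \<comment> \<open>The positive degree excludes the zero polynomial \<open>[]\<close>, whose
      degree counts as 0.\<close>
    have "q \<noteq> []" using that n by auto
    hence "F.coeff q (Polynomials.degree q) = hd q" by (rule F.lead_coeff_simp)
    moreover have "hd q \<noteq> \<zero>\<^bsub>F\<^esub>" using that(1) \<open>q \<noteq> []\<close> by (simp add: univ_poly_carrier[symmetric] polynomial_def)
    ultimately show ?thesis using that(2) by simp
  qed
  have "Polynomials.degree ?r = rat_degree f \<or> Polynomials.degree ?s = rat_degree f"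
    using gr(4) by (auto simp: max_def split: if_splits)
  hence "F.coeff ?r (rat_degree f) \<noteq> \<zero>\<^bsub>F\<^esub> \<or> F.coeff ?s (rat_degree f) \<noteq> \<zero>\<^bsub>F\<^esub>"
    using * reduce_poly_carrier gr(1,2) by blast
  thus "Polynomial.coeff R (rat_degree f) \<notin> \<MM> \<or> Polynomial.coeff S (rat_degree f) \<notin> \<MM>"
    using gr(1,2) by (auto simp: reduce_poly_coeff res_eq_0_iff O_poly_def)
qed

end

text \<open>
  Homogeneous form of the duplication map \<open>x(Q) \<mapsto> x(2Q)\<close> on the curve
  \<open>y\<^sup>2 = x\<^sup>3 + a x + b\<close>.
\<close>

definition dup_num :: "'a::comm_ring_1 \<Rightarrow> 'a \<Rightarrow> 'a \<Rightarrow> 'a \<Rightarrow> 'a" where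
  "dup_num a b x y = x^4 - 2 * a * x^2 * y^2 - 8 * b * x * y^3 + a^2 * y^4"

definition wcubic :: "'a::comm_ring_1 \<Rightarrow> 'a \<Rightarrow> 'a \<Rightarrow> 'a \<Rightarrow> 'a" where
  "wcubic a b x y = x^3 + a * x * y^2 + b * y^3"

definition dup_den :: "'a::comm_ring_1 \<Rightarrow> 'a \<Rightarrow> 'a \<Rightarrow> 'a \<Rightarrow> 'a" where
  "dup_den a b x y = 4 * y * wcubic a b x y"

definition wdisc :: "'a::comm_ring_1 \<Rightarrow> 'a \<Rightarrow> 'a" where
  "wdisc a b = 4 * a^3 + 27 * b^2"

lemmas dup_defs = dup_num_def wcubic_def dup_den_def wdisc_def

text \<open>Shows that numerator and cubic have no common zero with y = 1 away from the
  discriminant. It gives lowest terms over K, good reduction at P, and well-defined images of points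
  modulo p.\<close>

lemma dup_bezout:
  "(3 * x^2 + 4 * a * y^2) * dup_num a b x y - (3 * x^3 - 5 * a * x * y^2 - 27 * b * y^3) * wcubic a b x y
     = wdisc a b * y^6"
  unfolding dup_defs by (simp add: algebra_simps eval_nat_numeral)

text \<open>The second factor is the resultant of \<open>e\<^sup>3 + a e + b\<close> and \<open>2 e\<^sup>2 + (m + n) e + (a - m n)\<close>.\<close>

lemma dup_difference:
  fixes a b m n :: int
  defines "s \<equiv> m + n" and "r \<equiv> a - m * n"
  defines "L1 \<equiv> 4 * a + s^2 - 2 * r" and "L0 \<equiv> 4 * b + s * r"
  shows "4 * (dup_num a b m 1 * wcubic a b n 1 - dup_num a b n 1 * wcubic a b m 1)
     = (n - m) * (2 * L0^2 - s * L0 * L1 + r * L1^2)"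
  unfolding dup_defs L1_def L0_def s_def r_def by (simp add: algebra_simps eval_nat_numeral)

text \<open>Translation by the two-torsion point (e, 0) relates the x-coordinates m and n by (m - e)
  (n - e) = 3 e^2 + a, which is 2 e^2 + s e + r = 0. Dividing four times the cubic by this quadratic
  leaves the remainder L1 e + L0. If L1 is invertible, the zero of the remainder is a common root.
  Otherwise p divides L0 too, and s / 2, the zero of the quotient, is a root of the cubic.\<close>

lemma wcubic_root_if_resultant:
  fixes a b s r :: int
  defines "L1 \<equiv> 4 * a + s^2 - 2 * r" and "L0 \<equiv> 4 * b + s * r"
  assumes p: "prime p" "p \<noteq> 2" and dvd: "int p dvd 2 * L0^2 - s * L0 * L1 + r * L1^2"
  shows "\<exists>e. int p dvd wcubic a b e 1"
proof -
  have pp: "prime (int p)" using p(1) by simp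
  have p2: "\<not> int p dvd 2"
    using p primes_dvd_imp_eq[of p 2] two_is_prime_nat by (metis int_dvd_int_iff of_nat_numeral)
  have p4: "\<not> int p dvd 4" using p2 prime_dvd_mult_iff[OF pp, of 2 2] by simp
  have div: "4 * wcubic a b e 1 = (2 * e^2 + s * e + r) * (2 * e - s) + (L1 * e + L0)" for e
    unfolding dup_defs L1_def L0_def by (simp add: algebra_simps eval_nat_numeral)
  have fin: "\<exists>e. int p dvd wcubic a b e 1" if "int p dvd 4 * wcubic a b e 1" for e
    using that p4 prime_dvd_mult_iff[OF pp] by blast
  show ?thesis
  proof (cases "int p dvd L1")
    case True
    have "int p dvd L1 * (r * L1 - s * L0)" using True by simp
    moreover have "2 * L0^2 - s * L0 * L1 + r * L1^2 = 2 * L0^2 + L1 * (r * L1 - s * L0)"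
      by (simp add: algebra_simps power2_eq_square)
    ultimately have "int p dvd 2 * L0^2" using dvd by (metis dvd_add_left_iff)
    hence L0: "int p dvd L0" using p2 prime_dvd_mult_iff[OF pp] prime_dvd_power[OF pp] by blast
    have "coprime 2 (int p)" using prime_imp_coprime[OF pp p2] by (simp add: coprime_commute)
    then obtain h where "[2 * h = 1] (mod int p)" using cong_solve_coprime_int by blast
    hence "[2 * h * s = 1 * s] (mod int p)" by (rule cong_scalar_right)
    hence "int p dvd 2 * (h * s) - s" by (simp add: cong_iff_dvd_diff mult.assoc)
    thus ?thesis using True L0 by (intro fin[of "h * s"]) (simp add: div)
  next
    case False
    have "coprime L1 (int p)" using prime_imp_coprime[OF pp False] by (simp add: coprime_commute)
    then obtain i where "[L1 * i = 1] (mod int p)" using cong_solve_coprime_int by blast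
    hence "[L1 * i * (- L0) = 1 * (- L0)] (mod int p)" by (rule cong_scalar_right)
    then have e0: "int p dvd L1 * (i * (- L0)) + L0" by (simp add: cong_iff_dvd_diff mult.assoc)
    define e where "e = i * (- L0)"
    have e: "int p dvd L1 * e + L0" using e0 by (simp add: e_def)
    have "L1^2 * (2 * e^2 + s * e + r)
       = (L1 * e + L0) * (2 * (L1 * e - L0) + s * L1) + (2 * L0^2 - s * L0 * L1 + r * L1^2)"
      by (simp add: algebra_simps power2_eq_square)
    hence "int p dvd L1^2 * (2 * e^2 + s * e + r)" using e dvd by simp
    hence "int p dvd 2 * e^2 + s * e + r"
      using False prime_dvd_mult_iff[OF pp] prime_dvd_power[OF pp] by blast
    thus ?thesis using e by (intro fin[of e]) (simp add: div)
  qed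
qed

lemma dup_hom:
  "poly (dup_num a b p q) x = dup_num (poly a x) (poly b x) (poly p x) (poly q x)"
  "poly (dup_den a b p q) x = dup_den (poly a x) (poly b x) (poly p x) (poly q x)"
  by (simp_all add: dup_defs)

lemma dup_of_int:
  "dup_num (of_int a) (of_int b) (of_int x) (of_int y) = of_int (dup_num a b x y)"
  "dup_den (of_int a) (of_int b) (of_int x) (of_int y) = of_int (dup_den a b x y)"
  "wcubic (of_int a) (of_int b) (of_int x) (of_int y) = of_int (wcubic a b x y)"
  by (simp_all add: dup_defs)

section \<open>The duplication map as a rational function\<close>

definition lattes :: "int \<Rightarrow> int \<Rightarrow> 'k::field_char_0 poly fract" where
  "lattes a b = Fraction_Field.Fract (dup_num [:of_int a:] [:of_int b:] [:0, 1:] 1) (dup_den [:of_int a:] [:of_int b:] [:0, 1:] 1)"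

text \<open>The factor 1 / 4 keeps the denominator monic, as \<open>lowest_terms\<close> demands; it
  is the reason why the prime 2 is excluded from reduction.\<close>

definition lattes_R :: "int \<Rightarrow> int \<Rightarrow> 'k::field_char_0 poly" where
  "lattes_R a b = Polynomial.smult (1 / 4) [:of_int a ^ 2, - 8 * of_int b, - 2 * of_int a, 0, 1:]"

definition lattes_S :: "int \<Rightarrow> int \<Rightarrow> 'k::field_char_0 poly" where
  "lattes_S a b = [:of_int b, of_int a, 0, 1:]"

lemma lattes_polys:
  "dup_num [:of_int a:] [:of_int b:] [:0, 1:] 1 = Polynomial.smult 4 (lattes_R a b)"
  "wcubic [:of_int a:] [:of_int b:] [:0, 1:] 1 = lattes_S a b"
  "dup_den [:of_int a:] [:of_int b:] [:0, 1:] 1 = Polynomial.smult 4 (lattes_S a b)"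
  by (simp_all add: dup_defs lattes_R_def lattes_S_def numeral_poly eval_nat_numeral)

lemma lattes_bezout:
  "(Polynomial.smult 4 [:4 * of_int a, 0, 3:]) * lattes_R a b + [:27 * of_int b, 5 * of_int a, 0, - 3:] * lattes_S a b
     = [:of_int (wdisc a b):]"
proof -
  have "[:4 * of_int a, 0, 3:] = 3 * [:0, 1:]^2 + 4 * [:of_int a:] * (1 :: 'a poly)^2"
    by (simp add: numeral_poly eval_nat_numeral)
  moreover have "[:27 * of_int b, 5 * of_int a, 0, - 3:]
      = - (3 * [:0, 1:]^3 - 5 * [:of_int a:] * [:0, 1:] * 1^2 - 27 * [:of_int b:] * (1 :: 'a poly)^3)"
    by (simp add: numeral_poly eval_nat_numeral)
  moreover have "[:of_int (wdisc a b):] = wdisc [:of_int a:] [:of_int b :: 'a:] * 1^6"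
    by (simp add: dup_defs numeral_poly eval_nat_numeral)
  ultimately show ?thesis
    using dup_bezout[of "[:0, 1:]" "[:of_int a :: 'a:]" 1 "[:of_int b:]"]
    unfolding lattes_polys by (simp only: mult_smult_left mult_smult_right mult_minus_left add_uminus_conv_diff)
qed

lemma num_den_lattes:
  assumes "wdisc a b \<noteq> 0"
  shows "num_den (lattes a b :: 'k::field_char_0 poly fract) = (lattes_R a b, lattes_S a b)"
  unfolding num_den_eq_iff lowest_terms_def
proof (intro conjI)
  have S: "lattes_S a b \<noteq> (0 :: 'k poly)" by (simp add: lattes_S_def)
  show "lattes a b = Fraction_Field.Fract (lattes_R a b) (lattes_S a b :: 'k poly)"
    using S unfolding lattes_def lattes_polys by (simp add: Fraction_Field.eq_fract)
  show "Polynomial.lead_coeff (lattes_S a b :: 'k poly) = 1" by (simp add: lattes_S_def)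
  show "Rings.coprime (lattes_R a b) (lattes_S a b :: 'k poly)"
  proof (rule coprimeI)
    fix d :: "'k poly" assume "d dvd lattes_R a b" "d dvd lattes_S a b"
    hence "d dvd [:of_int (wdisc a b):]" unfolding lattes_bezout[symmetric] by (intro dvd_add dvd_mult)
    moreover have "is_unit [:of_int (wdisc a b) :: 'k:]" using assms by (simp add: is_unit_const_poly_iff dvd_field_iff)
    ultimately show "is_unit d" by (rule dvd_unit_imp_unit)
  qed
qed

lemma degree_lattes:
  "Polynomial.degree (lattes_R a b :: 'k::field_char_0 poly) = 4"
  "Polynomial.degree (lattes_S a b :: 'k::field_char_0 poly) = 3"
  by (simp_all add: lattes_R_def lattes_S_def)

lemma rat_degree_lattes:
  "wdisc a b \<noteq> 0 \<Longrightarrow> rat_degree (lattes a b :: 'k::field_char_0 poly fract) = 4"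
  by (simp add: rat_degree_def num_den_lattes degree_lattes)

text \<open>Tells the four maps apart: the reduced fraction is unique, and a is a coefficient of its
  denominator.\<close>

lemma lattes_eq_imp:
  assumes "wdisc a b \<noteq> 0" "wdisc a' b' \<noteq> 0" "(lattes a b :: 'k::field_char_0 poly fract) = lattes a' b'"
  shows "a = a'"
proof -
  have "(lattes_S a b :: 'k poly) = lattes_S a' b'"
    using num_den_lattes[OF assms(1), where 'k = 'k] num_den_lattes[OF assms(2), where 'k = 'k] assms(3) by simp
  thus ?thesis by (simp add: lattes_S_def)
qed

text \<open>Among the terms only p^4 above and q p^3 below reach the top degree. The inequality of
  degrees says that infinity is mapped to infinity, and its preservation allows iterated
  composition.\<close>

lemma degree_dup:
  fixes p q :: "'k::field_char_0 poly"
  assumes q: "q \<noteq> 0" and deg: "Polynomial.degree q < Polynomial.degree p"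
  shows "dup_den [:a:] [:b:] p q \<noteq> 0"
    "Polynomial.degree (dup_den [:a:] [:b:] p q) < Polynomial.degree (dup_num [:a:] [:b:] p q)"
proof -
  let ?n = "Polynomial.degree p" and ?m = "Polynomial.degree q"
  have p: "p \<noteq> 0" using deg by auto
  have dp: "Polynomial.degree (p ^ k) = k * ?n" "Polynomial.degree (q ^ k) = k * ?m" for k
    using p q by (simp_all add: degree_power_eq)
  have mono: "Polynomial.degree (Polynomial.smult c (p ^ i * q ^ j)) \<le> i * ?n + j * ?m" for c i j
    using degree_mult_le[of "p ^ i" "q ^ j"] Polynomial.degree_smult_le[of c "p ^ i * q ^ j"] by (simp add: dp)
  define r where "r = Polynomial.smult a (p ^ 1 * q ^ 2) + Polynomial.smult b (p ^ 0 * q ^ 3)"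
  have w: "wcubic [:a:] [:b:] p q = p ^ 3 + r"
    by (simp add: wcubic_def r_def)
  have r: "Polynomial.degree r < 3 * ?n"
    unfolding r_def using mono[of a 1 2] mono[of b 0 3] deg by (intro degree_add_less) auto
  have dw: "Polynomial.degree (wcubic [:a:] [:b:] p q) = 3 * ?n"
    unfolding w using r by (subst degree_add_eq_left) (auto simp: dp)
  have w0: "wcubic [:a:] [:b:] p q \<noteq> 0" using dw deg by auto
  have den: "dup_den [:a:] [:b:] p q = Polynomial.smult 4 (q * wcubic [:a:] [:b:] p q)"
    by (simp add: dup_den_def numeral_poly)
  show "dup_den [:a:] [:b:] p q \<noteq> 0" unfolding den using q w0 by simp
  have dd: "Polynomial.degree (dup_den [:a:] [:b:] p q) = ?m + 3 * ?n"
    unfolding den using q w0 dw by (simp add: degree_mult_eq)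
  define t where "t = Polynomial.smult (- 2 * a) (p ^ 2 * q ^ 2) + (Polynomial.smult (- 8 * b) (p ^ 1 * q ^ 3)
      + Polynomial.smult (a ^ 2) (p ^ 0 * q ^ 4))"
  have nn: "dup_num [:a:] [:b:] p q = p ^ 4 + t"
    by (simp add: dup_num_def t_def numeral_poly power2_eq_square mult.commute)
  have t: "Polynomial.degree t < 4 * ?n"
    unfolding t_def using mono[of "- 2 * a" 2 2] mono[of "- 8 * b" 1 3] mono[of "a ^ 2" 0 4] deg
    by (intro degree_add_less) auto
  have "Polynomial.degree (dup_num [:a:] [:b:] p q) = 4 * ?n"
    unfolding nn using t by (subst degree_add_eq_left) (auto simp: dp)
  thus "Polynomial.degree (dup_den [:a:] [:b:] p q) < Polynomial.degree (dup_num [:a:] [:b:] p q)"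
    using dd deg by simp
qed

text \<open>The fraction p / q need not be in lowest terms: homogenising multiplies numerator and
  denominator by the same q^4. Composites can thus be followed without ever computing their normal
  form.\<close>

lemma lattes_compose:
  fixes p q :: "'k::field_char_0 poly"
  assumes disc: "wdisc a b \<noteq> 0" and q: "q \<noteq> 0" and deg: "Polynomial.degree q < Polynomial.degree p"
  shows "lattes a b \<circ>\<^sub>r Fraction_Field.Fract p q
    = Fraction_Field.Fract (dup_num [:of_int a:] [:of_int b:] p q) (dup_den [:of_int a:] [:of_int b:] p q)"
proof -
  define c :: "'k \<Rightarrow> 'k poly fract" where "c = (\<lambda>x. Fraction_Field.Fract [:x:] 1)"
  have c_add: "c (x + y) = c x + c y" and c_mult: "c (x * y) = c x * c y" and c_1: "c 1 = 1" and c_0: "c 0 = 0" for x y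
    by (simp_all add: c_def One_fract_def Zero_fract_def pCons_one mult.commute)
  have c_minus: "c (- x) = - c x" for x
    by (simp add: c_def)
  have c_of_nat: "c (of_nat n) = of_nat n" for n by (induction n) (simp_all add: c_0 c_1 c_add)
  have c_num: "c (numeral n) = numeral n" for n using c_of_nat[of "numeral n"] by simp
  define G P Q where "G = Fraction_Field.Fract p q" and "P = Fraction_Field.Fract p 1" and "Q = Fraction_Field.Fract q 1"
  have Q0: "Q \<noteq> 0" using q by (simp add: Q_def Zero_fract_def Fraction_Field.eq_fract)
  have G: "G = P / Q" using q by (simp add: G_def P_def Q_def)
  have subst: "poly_subst f G = poly (map_poly c f) G" for f
    by (simp add: poly_subst_def c_def)
  let ?A = "c (of_int a)" and ?B = "c (of_int b)"
  have S: "poly_subst (lattes_S a b) G = G ^ 3 + ?A * G + ?B"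
    unfolding subst lattes_S_def by (simp add: map_poly_pCons c_0 c_1 algebra_simps eval_nat_numeral)
  have "c (1 / 4) * 4 = 1" using c_mult[of "1 / 4" 4] by (simp add: c_num c_1)
  moreover from this have four: "(4 :: 'k poly fract) \<noteq> 0" by (metis mult_zero_right zero_neq_one)
  ultimately have c4: "c (1 / 4) = 1 / 4" by (simp add: field_simps)
  define k0 k1 k2 :: 'k where "k0 = 1 / 4 * (of_int a * of_int a)" and "k1 = 1 / 4 * - (8 * of_int b)"
    and "k2 = 1 / 4 * - (2 * of_int a)"
  define i where "i = c (1 / 4)"
  have ck: "c k0 = i * (?A * ?A)" "c k1 = i * - (8 * ?B)" "c k2 = i * - (2 * ?A)"
    unfolding k0_def k1_def k2_def c_mult c_minus c_num i_def by simp_all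
  have "lattes_R a b = [:k0, k1, k2, 0, 1 / 4:]"
    by (simp add: lattes_R_def k0_def k1_def k2_def power2_eq_square)
  hence "poly_subst (lattes_R a b) G = poly [:c k0, c k1, c k2, 0, i:] G"
    unfolding subst i_def by (simp add: map_poly_pCons c_0 del: poly_pCons)
  also have "\<dots> = (G ^ 4 - 2 * ?A * G ^ 2 - 8 * ?B * G + ?A ^ 2) * i"
    unfolding ck by (simp add: algebra_simps eval_nat_numeral)
  also have "\<dots> = (G ^ 4 - 2 * ?A * G ^ 2 - 8 * ?B * G + ?A ^ 2) / 4"
    unfolding i_def c4 by simp
  finally have R: "poly_subst (lattes_R a b) G = (G ^ 4 - 2 * ?A * G ^ 2 - 8 * ?B * G + ?A ^ 2) / 4" .
  have fr: "Fraction_Field.Fract (dup_num [:of_int a:] [:of_int b:] p q) (dup_den [:of_int a:] [:of_int b:] p q)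
      = dup_num ?A ?B P Q / dup_den ?A ?B P Q"
  proof -
    define h :: "'k poly \<Rightarrow> 'k poly fract" where "h = (\<lambda>x. Fraction_Field.Fract x 1)"
    have h: "h (x + y) = h x + h y" "h (x * y) = h x * h y" "h 1 = 1" "h (x - y) = h x - h y" for x y
      by (simp_all add: h_def One_fract_def)
    have hp: "h (x ^ n) = h x ^ n" for x n by (induction n) (simp_all add: h)
    have "h (of_nat n) = of_nat n" for n
      by (induction n) (simp_all add: h, simp add: h_def Zero_fract_def)
    from this[of "numeral _"] have hn: "h (numeral n) = numeral n" for n by simp
    have "Fraction_Field.Fract x y = h x / h y" for x y
      by (simp add: h_def)
    moreover have "h [:of_int a:] = ?A" "h [:of_int b:] = ?B" "h p = P" "h q = Q"
      by (simp_all add: h_def c_def P_def Q_def)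
    ultimately show ?thesis unfolding dup_defs by (simp only: h hp hn)
  qed
  have num: "dup_num ?A ?B P Q = (G ^ 4 - 2 * ?A * G ^ 2 - 8 * ?B * G + ?A ^ 2) * Q ^ 4"
    and den: "dup_den ?A ?B P Q = 4 * (G ^ 3 + ?A * G + ?B) * Q ^ 4"
    using Q0 unfolding dup_defs G by (simp_all add: field_simps eval_nat_numeral)
  have "lattes a b \<circ>\<^sub>r G = poly_subst (lattes_R a b) G / poly_subst (lattes_S a b) G"
    by (simp add: rat_compose_def num_den_lattes[OF disc])
  also have "\<dots> = dup_num ?A ?B P Q / dup_den ?A ?B P Q"
    unfolding R S num den using Q0 four by simp
  finally show ?thesis unfolding fr G_def .
qed

section \<open>Duplication on the points over the prime field\<close>

locale place_over = place +
  fixes p :: nat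
  assumes p: "prime p" "of_nat p \<in> P"
begin

lemma int_M: "of_int a \<in> \<MM> \<longleftrightarrow> int p dvd a"
  using M_algebraic_int_iff[of "of_int a"] place_of_int_iff[OF P p] by simp

lemma prime_int: "prime (int p)" using p(1) by simp

definition pt :: "int \<Rightarrow> int \<Rightarrow> 'a set option" where
  "pt x y = pr (of_int x) (of_int y)"

definition good :: "int \<Rightarrow> int \<Rightarrow> bool" where
  "good x y \<longleftrightarrow> \<not> (int p dvd x \<and> int p dvd y)"

lemma pt_eq_iff: "good x y \<Longrightarrow> good x' y' \<Longrightarrow> pt x y = pt x' y' \<longleftrightarrow> int p dvd x * y' - x' * y"
  unfolding pt_def good_def int_M[symmetric] by (subst pr_eq_iff) (auto simp flip: of_int_mult of_int_diff)

lemma good_1: "good m 1" "good 1 0"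
  using prime_gt_1_nat[OF p(1)] by (auto simp: good_def)

lemma pt_cases:
  assumes "good x y"
  obtains "pt x y = pt 1 0" "int p dvd y" | m where "pt x y = pt m 1" "[x = m * y] (mod int p)" "\<not> int p dvd y"
proof (cases "int p dvd y")
  case True
  have "pt x y = pt 1 0" using True assms good_1 by (subst pt_eq_iff) auto
  thus ?thesis using True that(1) by blast
next
  case False
  have "coprime y (int p)" using prime_imp_coprime[OF prime_int False] by (simp add: coprime_commute)
  then obtain i where "[y * i = 1] (mod int p)" using cong_solve_coprime_int by blast
  hence "[y * i * x = 1 * x] (mod int p)" by (rule cong_scalar_right)
  hence d: "[x = i * x * y] (mod int p)" by (simp add: cong_sym mult_ac)
  hence "pt x y = pt (i * x) 1" using assms good_1 by (subst pt_eq_iff) (auto simp: cong_iff_dvd_diff)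
  thus ?thesis using that(2) d False by blast
qed

lemma pt_mod: "pt m 1 = pt (m mod int p) 1"
  using good_1 by (subst pt_eq_iff) (auto simp: minus_mod_eq_mult_div)

text \<open>The projective line over F_p inside the one over the residue field, whatever the residue
  degree. It is finite and stable under duplication with integer parameters.\<close>

definition prime_points :: "'a set option set" where
  "prime_points = {pt x y | x y. good x y}"

lemma prime_points_eq: "prime_points = insert (pt 1 0) ((\<lambda>m. pt m 1) ` {0..<int p})"
proof
  show "prime_points \<subseteq> insert (pt 1 0) ((\<lambda>m. pt m 1) ` {0..<int p})"
  proof
    fix z assume "z \<in> prime_points"
    then obtain x y where z: "z = pt x y" "good x y" unfolding prime_points_def by blast
    show "z \<in> insert (pt 1 0) ((\<lambda>m. pt m 1) ` {0..<int p})"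
      using z(2)
    proof (cases rule: pt_cases)
      case (2 m)
      have "z = pt (m mod int p) 1" using z(1) 2(1) pt_mod[of m] by simp
      moreover have "m mod int p \<in> {0..<int p}" using prime_gt_0_nat[OF p(1)] by simp
      ultimately show ?thesis by blast
    qed (use z in simp)
  qed
  show "insert (pt 1 0) ((\<lambda>m. pt m 1) ` {0..<int p}) \<subseteq> prime_points"
    unfolding prime_points_def using good_1 by blast
qed

lemma finite_prime_points: "finite prime_points"
  unfolding prime_points_eq by simp

lemma prime_points_subset: "prime_points \<subseteq> proj_line F"
  unfolding prime_points_def pt_def using pr_closed by auto

lemma prime_points_cases:
  assumes "z \<in> prime_points"
  obtains "z = pt 1 0" | m where "z = pt m 1"
  using assms unfolding prime_points_eq by auto

text \<open>Duplication never yields (0 : 0): if p does not divide y, this is the identity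
  \<open>dup_bezout\<close>; if p divides y, the numerator is x^4 modulo p.\<close>

lemma good_dup:
  assumes "\<not> int p dvd 2 * wdisc a b" "good x y"
  shows "good (dup_num a b x y) (dup_den a b x y)"
proof (rule ccontr)
  assume "\<not> ?thesis"
  hence d: "int p dvd dup_num a b x y" "int p dvd dup_den a b x y" by (auto simp: good_def)
  have p2: "\<not> int p dvd 2" "\<not> int p dvd wdisc a b" using assms(1) by auto
  have p4: "\<not> int p dvd 4" using p2(1) prime_dvd_mult_iff[OF prime_int, of 2 2] by simp
  have y: "int p dvd y"
  proof (rule ccontr)
    assume y: "\<not> int p dvd y"
    hence "int p dvd wcubic a b x y"
      using d(2) p4 unfolding dup_den_def by (simp add: prime_dvd_mult_iff[OF prime_int])
    with d(1) have "int p dvd (3 * x^2 + 4 * a * y^2) * dup_num a b x y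
        - (3 * x^3 - 5 * a * x * y^2 - 27 * b * y^3) * wcubic a b x y"
      by (intro dvd_diff dvd_mult)
    hence "int p dvd wdisc a b * y ^ 6" unfolding dup_bezout .
    thus False using p2(2) y prime_dvd_mult_iff[OF prime_int] prime_dvd_power[OF prime_int] by blast
  qed
  have "dup_num a b x y = x^4 + y * (- 2 * a * x^2 * y - 8 * b * x * y^2 + a^2 * y^3)"
    by (simp add: dup_num_def algebra_simps eval_nat_numeral)
  hence "int p dvd x^4" using d(1) y by (metis dvd_add_left_iff dvd_mult2)
  hence "int p dvd x" using prime_dvd_power[OF prime_int] by blast
  with y assms(2) show False by (simp add: good_def)
qed

lemma dup_cong:
  assumes "[x = x'] (mod int p)" "[y = y'] (mod int p)"
  shows "[dup_num a b x y = dup_num a b x' y'] (mod int p)" "[dup_den a b x y = dup_den a b x' y'] (mod int p)"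
  unfolding dup_defs by (intro cong_add cong_diff cong_mult cong_pow cong_refl assms)+

lemma dup_homogeneous:
  "dup_num a b (m * y) y = y^4 * dup_num a b m (1 :: int)" "dup_den a b (m * y) y = y^4 * dup_den a b m (1 :: int)"
  by (simp_all add: dup_defs algebra_simps eval_nat_numeral)

lemma pt_dup_normalise:
  assumes disc: "\<not> int p dvd 2 * wdisc a b" and g: "good x y"
  shows "int p dvd y \<Longrightarrow> pt (dup_num a b x y) (dup_den a b x y) = pt 1 0"
    "[x = m * y] (mod int p) \<Longrightarrow> \<not> int p dvd y \<Longrightarrow>
      pt (dup_num a b x y) (dup_den a b x y) = pt (dup_num a b m 1) (dup_den a b m 1)"
proof -
  assume "int p dvd y"
  hence "int p dvd dup_den a b x y" by (simp add: dup_den_def)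
  thus "pt (dup_num a b x y) (dup_den a b x y) = pt 1 0"
    using good_dup[OF disc g] good_1(2) by (subst pt_eq_iff) auto
next
  assume xm: "[x = m * y] (mod int p)" and y: "\<not> int p dvd y"
  have "[dup_num a b x y = y^4 * dup_num a b m 1] (mod int p)" "[dup_den a b x y = y^4 * dup_den a b m 1] (mod int p)"
    using dup_cong[OF xm cong_refl[of y], of a b] by (simp_all only: dup_homogeneous)
  hence "[dup_num a b x y * dup_den a b m 1 - dup_num a b m 1 * dup_den a b x y
      = y^4 * dup_num a b m 1 * dup_den a b m 1 - dup_num a b m 1 * (y^4 * dup_den a b m 1)] (mod int p)"
    by (intro cong_diff cong_mult cong_refl)
  hence "int p dvd dup_num a b x y * dup_den a b m 1 - dup_num a b m 1 * dup_den a b x y"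
    by (simp add: cong_iff_dvd_diff mult_ac)
  thus "pt (dup_num a b x y) (dup_den a b x y) = pt (dup_num a b m 1) (dup_den a b m 1)"
    using good_dup[OF disc] g good_1(1) by (subst pt_eq_iff) auto
qed

lemma pt_dup_cong:
  assumes disc: "\<not> int p dvd 2 * wdisc a b" and g: "good x y" "good x' y'" and eq: "pt x y = pt x' y'"
  shows "pt (dup_num a b x y) (dup_den a b x y) = pt (dup_num a b x' y') (dup_den a b x' y')"
proof -
  have d: "int p dvd x * y' - x' * y" using pt_eq_iff[OF g] eq by simp
  show ?thesis using g(1)
  proof (cases rule: pt_cases)
    case 1
    have "int p dvd x * y'" using d 1(2) by (metis diff_add_cancel dvd_add dvd_mult)
    hence "int p dvd y'" using 1(2) g(1) by (auto simp: good_def prime_dvd_mult_iff[OF prime_int])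
    thus ?thesis using pt_dup_normalise(1)[OF disc] g 1(2) by metis
  next
    case (2 m)
    have y': "\<not> int p dvd y'"
    proof
      assume y': "int p dvd y'"
      hence "int p dvd x' * y" using d by (metis dvd_diff_commute diff_add_cancel dvd_add dvd_mult)
      thus False using 2(3) g(2) y' by (auto simp: good_def prime_dvd_mult_iff[OF prime_int])
    qed
    have "[x * y' = m * y * y'] (mod int p)" using 2(2) by (rule cong_scalar_right)
    moreover have "[x * y' = x' * y] (mod int p)" using d by (simp add: cong_iff_dvd_diff)
    ultimately have "[x' * y = m * y * y'] (mod int p)" by (metis cong_sym cong_trans)
    hence "int p dvd y * (x' - m * y')" by (simp add: cong_iff_dvd_diff algebra_simps)
    hence "[x' = m * y'] (mod int p)" using 2(3) by (simp add: cong_iff_dvd_diff prime_dvd_mult_iff[OF prime_int])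
    thus ?thesis using pt_dup_normalise(2)[OF disc g(1) 2(2,3)] pt_dup_normalise(2)[OF disc g(2) _ y'] by simp
  qed
qed

text \<open>The map induced on points; the choice of integer coordinates is immaterial by
  \<open>pt_dup_cong\<close>.\<close>

definition dup_map :: "int \<Rightarrow> int \<Rightarrow> 'a set option \<Rightarrow> 'a set option" where
  "dup_map a b z = (SOME w. \<exists>x y. good x y \<and> z = pt x y \<and> w = pt (dup_num a b x y) (dup_den a b x y))"

lemma dup_map:
  assumes disc: "\<not> int p dvd 2 * wdisc a b" and g: "good x y"
  shows "dup_map a b (pt x y) = pt (dup_num a b x y) (dup_den a b x y)"
proof -
  have "\<exists>x' y'. good x' y' \<and> pt x y = pt x' y' \<and> dup_map a b (pt x y) = pt (dup_num a b x' y') (dup_den a b x' y')"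
    unfolding dup_map_def by (rule someI_ex) (use g in blast)
  thus ?thesis using pt_dup_cong[OF disc g] by metis
qed

lemma dup_map_prime_points: "\<not> int p dvd 2 * wdisc a b \<Longrightarrow> z \<in> prime_points \<Longrightarrow> dup_map a b z \<in> prime_points"
proof -
  assume disc: "\<not> int p dvd 2 * wdisc a b" and "z \<in> prime_points"
  then obtain x y where xy: "z = pt x y" "good x y" unfolding prime_points_def by blast
  show ?thesis unfolding xy(1) dup_map[OF disc xy(2)] prime_points_def using good_dup[OF disc xy(2)] by blast
qed

text \<open>The two-torsion point (e, 0) and the point at infinity both double to infinity.\<close>

lemma dup_map_not_inj:
  assumes disc: "\<not> int p dvd 2 * wdisc a b" and e: "int p dvd wcubic a b e 1"
  shows "\<not> inj_on (dup_map a b) prime_points"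
proof
  assume inj: "inj_on (dup_map a b) prime_points"
  have "dup_map a b (pt e 1) = pt (dup_num a b e 1) (dup_den a b e 1)" by (rule dup_map[OF disc good_1(1)])
  also have "\<dots> = pt 1 0"
    using good_dup[OF disc good_1(1)] good_1(2) e by (subst pt_eq_iff) (auto simp: dup_den_def)
  also have "\<dots> = dup_map a b (pt 1 0)"
    using dup_map[OF disc good_1(2)] by (simp add: dup_defs)
  finally have "pt e 1 = pt 1 0" using inj good_1 unfolding inj_on_def prime_points_def by blast
  thus False using pt_eq_iff[OF good_1(1,2), of e] prime_gt_1_nat[OF p(1)] by simp
qed

lemma good_reduction_lattes:
  assumes disc: "\<not> int p dvd 2 * wdisc a b"
  shows "good_reduction P (lattes a b)"
proof -
  have w0: "wdisc a b \<noteq> 0" using disc by auto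
  have p4: "\<not> int p dvd 4" using disc prime_dvd_mult_iff[OF prime_int, of 2 2] by auto
  hence 4: "4 \<notin> \<MM>" using int_M[of 4] by simp
  have q: "1 / 4 \<in> \<O>"
    using inverse_O(1)[OF O_numeral 4] unfolding inverse_eq_divide .
  note O_intros = O_poly_smult O_poly_pCons O_poly_0 O_mult O_power O_uminus
  have R: "O_poly (lattes_R a b)"
    unfolding lattes_R_def by (intro O_intros q) (simp_all add: O_numeral)
  have S: "O_poly (lattes_S a b)"
    unfolding lattes_S_def by (intro O_intros) simp_all
  have U: "O_poly (Polynomial.smult 4 [:4 * of_int a, 0, 3:])"
    by (intro O_intros) (simp_all add: O_numeral)
  have V: "O_poly [:27 * of_int b, 5 * of_int a, 0, - 3:]"
    by (intro O_intros) (simp_all add: O_numeral)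
  have "\<not> int p dvd wdisc a b" using disc by (metis dvd_mult)
  hence "of_int (wdisc a b) \<notin> \<MM>" unfolding int_M .
  hence cop: "pcoprime F (reduce_poly P (lattes_R a b)) (reduce_poly P (lattes_S a b))"
    using pcoprime_if_bezout[OF R S U V _ _ lattes_bezout] by simp
  have "1 / 4 \<notin> \<MM>"
  proof
    assume "1 / 4 \<in> \<MM>"
    from M_mult(1)[OF this O_basic(4)[of 4]] show False using M_1 by simp
  qed
  moreover have "Polynomial.lead_coeff (lattes_R a b) = (1 / 4 :: 'a)" by (simp add: lattes_R_def)
  ultimately have "Polynomial.lead_coeff (lattes_R a b) \<notin> \<MM>" by (simp only:) simp
  from degree_reduce_poly[OF R this] have "Polynomials.degree (reduce_poly P (lattes_R a b)) = 4"
    unfolding degree_lattes .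
  moreover have "Polynomials.degree (reduce_poly P (lattes_S a b)) \<le> 3"
    using degree_reduce_poly_le[of "lattes_S a b"] degree_lattes(2)[where 'k = 'a] by simp
  ultimately have "max (Polynomials.degree (reduce_poly P (lattes_R a b))) (Polynomials.degree (reduce_poly P (lattes_S a b))) = 4"
    by simp
  thus ?thesis
    unfolding good_reduction_def num_den_lattes[OF w0] rat_degree_lattes[OF w0]
    using R S cop by (simp add: O_poly_def)
qed

text \<open>The assumption \<open>deg1\<close> makes the residue field F_p, so the line is the
  finite set \<open>prime_points\<close> and injectivity suffices. Without a root no affine point
  goes to infinity, and by \<open>dup_difference\<close> two affine points with equal image would
  either agree or produce a root.\<close>

theorem lattes_bij:
  assumes disc: "\<not> int p dvd 2 * wdisc a b" and noroot: "\<And>e. \<not> int p dvd wcubic a b e 1"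
    and deg1: "\<And>c. algebraic_int c \<Longrightarrow> \<exists>m. c - of_int m \<in> P"
  shows "bij_betw (reduced_map P (lattes a b)) (proj_line F) (proj_line F)"
proof -
  have w0: "wdisc a b \<noteq> 0" using disc by auto
  have p4: "\<not> int p dvd 4" using disc prime_dvd_mult_iff[OF prime_int, of 2 2] by auto
  have O_int: "\<exists>m. x - of_int m \<in> \<MM>" if x: "x \<in> \<O>" for x
  proof -
    obtain c d where cd: "x = c / d" "algebraic_int c" "algebraic_int d" "d \<notin> P" using x unfolding \<O>_def by blast
    obtain m n where m: "c - of_int m \<in> P" and n: "d - of_int n \<in> P" using deg1 cd(2,3) by blast
    have "\<not> int p dvd n"
    proof
      assume "int p dvd n"
      hence "of_int n \<in> P" using place_of_int_iff[OF P p] by blast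
      hence "d - of_int n + of_int n \<in> P" using n place_idealD(5)[OF P] by blast
      thus False using cd(4) by simp
    qed
    hence "coprime n (int p)" using prime_imp_coprime[OF prime_int] by (simp add: coprime_commute)
    then obtain i where i: "[n * i = 1] (mod int p)" using cong_solve_coprime_int by blast
    have d0: "d \<noteq> 0" using not_P(1)[OF cd(4)] .
    have "[n * i * m = 1 * m] (mod int p)" using i by (rule cong_scalar_right)
    hence "int p dvd m - n * (i * m)" by (simp add: cong_iff_dvd_diff dvd_diff_commute mult.assoc)
    hence "of_int (m - n * (i * m)) \<in> P" using place_of_int_iff[OF P p] by blast
    hence "(c - of_int m) + of_int (m - n * (i * m)) - (d - of_int n) * of_int (i * m) \<in> P"
      using place_idealD(6)[OF P place_idealD(5)[OF P m] place_idealD(9)[OF P n algebraic_int_of_int]] by blast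
    also have "(c - of_int m) + of_int (m - n * (i * m)) - (d - of_int n) * of_int (i * m) = c - d * of_int (i * m)"
      by (simp add: algebra_simps)
    finally have "(c - d * of_int (i * m)) / d \<in> \<MM>" using cd by (intro MI)
    moreover have "(c - d * of_int (i * m)) / d = x - of_int (i * m)" using d0 by (simp add: cd(1) field_simps)
    ultimately have "x - of_int (i * m) \<in> \<MM>" by (simp only:)
    thus ?thesis by blast
  qed
  have line: "proj_line F = prime_points"
  proof
    show "proj_line F \<subseteq> prime_points"
    proof
      fix z assume "z \<in> proj_line F"
      thus "z \<in> prime_points"
      proof (cases rule: proj_line_cases)
        case 1
        thus ?thesis unfolding prime_points_eq by (simp add: pt_def)
      next
        case (2 x)
        obtain m where "x - of_int m \<in> \<MM>" using O_int 2(1) by blast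
        hence "z = pt m 1" using 2 res_eq_iff[of x "of_int m"] by (simp add: pt_def pr_1)
        thus ?thesis unfolding prime_points_def using good_1(1) by blast
      qed
    qed
  qed (rule prime_points_subset)
  note gr = good_reduction_lattes[OF disc] num_den_lattes[OF w0, where 'k = 'a]
  have fin: "reduced_map P (lattes a b) (pt m 1) = pt (dup_num a b m 1) (dup_den a b m 1)" for m
  proof -
    have R: "poly (lattes_R a b) (of_int m) = (of_int (dup_num a b m 1) / 4 :: 'a)"
      by (simp add: lattes_R_def dup_defs algebra_simps eval_nat_numeral add_divide_distrib diff_divide_distrib)
    have S: "poly (lattes_S a b) (of_int m) = (of_int (wcubic a b m 1) :: 'a)"
      by (simp add: lattes_S_def dup_defs algebra_simps eval_nat_numeral)
    have RO: "poly (lattes_R a b) (of_int m) \<in> \<O>" "poly (lattes_S a b) (of_int m) \<in> \<O>"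
      using good_reductionD(1,2)[OF gr] by (auto intro: poly_O)
    have "reduced_map P (lattes a b) (pt m 1) = pr (poly (lattes_R a b) (of_int m)) (poly (lattes_S a b) (of_int m))"
      unfolding pt_def using reduced_map_finite(1)[OF gr, of "of_int m"] by simp
    also have "\<dots> = pt (dup_num a b m 1) (dup_den a b m 1)"
      unfolding pt_def
    proof (subst pr_eq_iff)
      show "poly (lattes_R a b) (of_int m) \<notin> \<MM> \<or> poly (lattes_S a b) (of_int m) \<notin> \<MM>"
        using reduced_map_finite(2)[OF gr, of "of_int m"] by simp
      show "of_int (dup_num a b m 1) \<notin> \<MM> \<or> of_int (dup_den a b m 1) \<notin> \<MM>"
        using good_dup[OF disc good_1(1)] by (simp add: good_def int_M)
      have "poly (lattes_R a b) (of_int m) * of_int (dup_den a b m 1) - of_int (dup_num a b m 1) * poly (lattes_S a b) (of_int m) = (0 :: 'a)"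
        unfolding R S by (simp add: dup_den_def)
      thus "poly (lattes_R a b) (of_int m) * of_int (dup_den a b m 1) - of_int (dup_num a b m 1) * poly (lattes_S a b) (of_int m) \<in> \<MM>"
        using M_0 by simp
    qed (use RO in auto)
    finally show ?thesis .
  qed
  have inf: "reduced_map P (lattes a b) (pt 1 0) = pt 1 0"
  proof -
    have "Polynomial.coeff (lattes_S a b) 4 = (0 :: 'a)" by (simp add: lattes_S_def eval_nat_numeral)
    moreover have "Polynomial.coeff (lattes_R a b) 4 \<in> \<O>"
      using good_reductionD(1)[OF gr] by (simp add: O_poly_def)
    ultimately show ?thesis
      using reduced_map_infinity(1)[OF gr] rat_degree_lattes[OF w0, where 'k = 'a] by (simp add: pt_def pr_inf)
  qed
  have den_ne: "\<not> int p dvd dup_den a b m 1" for m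
    using noroot p4 by (simp add: dup_den_def prime_dvd_mult_iff[OF prime_int])
  have g: "good (dup_num a b m 1) (dup_den a b m 1)" for m
    by (rule good_dup[OF disc good_1(1)])
  have ne_inf: "pt (dup_num a b m 1) (dup_den a b m 1) \<noteq> pt 1 0" for m
    using pt_eq_iff[OF g good_1(2)] den_ne by simp
  have inj_fin: "pt m 1 = pt n 1" if "pt (dup_num a b m 1) (dup_den a b m 1) = pt (dup_num a b n 1) (dup_den a b n 1)" for m n
  proof -
    have "int p dvd dup_num a b m 1 * dup_den a b n 1 - dup_num a b n 1 * dup_den a b m 1"
      using that pt_eq_iff[OF g g] by simp
    also have "\<dots> = 4 * (dup_num a b m 1 * wcubic a b n 1 - dup_num a b n 1 * wcubic a b m 1)"
      by (simp add: dup_den_def algebra_simps)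
    finally have "int p dvd n - m \<or> int p dvd 2 * (4 * b + (m + n) * (a - m * n))^2
        - (m + n) * (4 * b + (m + n) * (a - m * n)) * (4 * a + (m + n)^2 - 2 * (a - m * n))
        + (a - m * n) * (4 * a + (m + n)^2 - 2 * (a - m * n))^2"
      unfolding dup_difference by (rule prime_dvd_multD[OF prime_int])
    moreover have "p \<noteq> 2" using disc by auto
    ultimately have "int p dvd n - m"
      using wcubic_root_if_resultant[OF p(1)] noroot by blast
    thus ?thesis using good_1(1) by (subst pt_eq_iff) (auto simp: dvd_diff_commute)
  qed
  have "inj_on (reduced_map P (lattes a b)) prime_points"
  proof (rule inj_onI)
    fix z w assume zw: "z \<in> prime_points" "w \<in> prime_points" "reduced_map P (lattes a b) z = reduced_map P (lattes a b) w"
    from zw(1) show "z = w"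
    proof (cases rule: prime_points_cases)
      case 1
      from zw(2) show ?thesis by (cases rule: prime_points_cases) (use 1 zw(3) inf fin ne_inf in metis)+
    next
      case (2 m)
      from zw(2) show ?thesis by (cases rule: prime_points_cases) (use 2 zw(3) inf fin ne_inf inj_fin in metis)+
    qed
  qed
  moreover have "reduced_map P (lattes a b) ` prime_points \<subseteq> prime_points"
  proof
    fix w assume "w \<in> reduced_map P (lattes a b) ` prime_points"
    then obtain z where z: "z \<in> prime_points" "w = reduced_map P (lattes a b) z" by blast
    from z(1) show "w \<in> prime_points"
      by (cases rule: prime_points_cases) (use z(2) inf fin g good_1 in \<open>auto simp: prime_points_def\<close>)
  qed
  ultimately show ?thesis
    unfolding line bij_betw_def using endo_inj_surj[OF finite_prime_points] by blast
qed

end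

section \<open>Composing four duplication maps\<close>

text \<open>Uncancelled numerator and denominator of a composite; the head of the list is the
  outermost map. \<open>dup_int_pair\<close> is the same recursion on integers and computes the
  values of these polynomials.\<close>

fun dup_poly_pair :: "(int \<times> int) list \<Rightarrow> 'k::field_char_0 poly \<times> 'k poly" where
  "dup_poly_pair [] = ([:0, 1:], 1)"
| "dup_poly_pair (c # cs) = (case dup_poly_pair cs of (u, v) \<Rightarrow>
     (dup_num [:of_int (fst c):] [:of_int (snd c):] u v, dup_den [:of_int (fst c):] [:of_int (snd c):] u v))"

fun dup_int_pair :: "(int \<times> int) list \<Rightarrow> int \<Rightarrow> int \<times> int" where
  "dup_int_pair [] m = (m, 1)"
| "dup_int_pair (c # cs) m = (case dup_int_pair cs m of (u, v) \<Rightarrow>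
     (dup_num (fst c) (snd c) u v, dup_den (fst c) (snd c) u v))"

fun lattes_chain :: "(int \<times> int) list \<Rightarrow> 'k::field_char_0 poly fract" where
  "lattes_chain [] = Fraction_Field.Fract [:0, 1:] 1"
| "lattes_chain (c # cs) = lattes (fst c) (snd c) \<circ>\<^sub>r lattes_chain cs"

lemma degree_dup_poly_pair:
  "snd (dup_poly_pair cs :: 'k::field_char_0 poly \<times> 'k poly) \<noteq> 0 \<and>
   Polynomial.degree (snd (dup_poly_pair cs :: 'k poly \<times> 'k poly)) < Polynomial.degree (fst (dup_poly_pair cs :: 'k poly \<times> 'k poly))"
proof (induction cs)
  case (Cons c cs)
  obtain u v :: "'k poly" where uv: "dup_poly_pair cs = (u, v)" by fastforce
  show ?case using Cons degree_dup[of v u] by (simp add: uv)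
qed simp

lemma lattes_chain_eq:
  assumes "\<And>c. c \<in> set cs \<Longrightarrow> wdisc (fst c) (snd c) \<noteq> 0"
  shows "(lattes_chain cs :: 'k::field_char_0 poly fract) = Fraction_Field.Fract (fst (dup_poly_pair cs)) (snd (dup_poly_pair cs))"
  using assms
proof (induction cs)
  case (Cons c cs)
  obtain u v :: "'k poly" where uv: "dup_poly_pair cs = (u, v)" by fastforce
  have "wdisc (fst c) (snd c) \<noteq> 0" using Cons.prems by simp
  from lattes_compose[OF this, of v u] show ?case
    using Cons degree_dup_poly_pair[of cs, where 'k = 'k] by (simp add: uv)
qed simp

lemma poly_dup_poly_pair:
  "poly (fst (dup_poly_pair cs)) (of_int m :: 'k::field_char_0) = of_int (fst (dup_int_pair cs m)) \<and>
   poly (snd (dup_poly_pair cs)) (of_int m :: 'k) = of_int (snd (dup_int_pair cs m))"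
proof (induction cs)
  case (Cons c cs)
  obtain u v :: "'k poly" where uv: "dup_poly_pair cs = (u, v)" by fastforce
  obtain x y where xy: "dup_int_pair cs m = (x, y)" by fastforce
  show ?case using Cons by (simp add: uv xy dup_hom dup_of_int)
qed simp

lemma lattes_compose_X:
  assumes "wdisc a b \<noteq> 0"
  shows "lattes a b \<circ>\<^sub>r Fraction_Field.Fract [:0, 1:] 1 = (lattes a b :: 'k::field_char_0 poly fract)"
  using lattes_compose[OF assms, of "1 :: 'k poly" "[:0, 1:]"] by (simp add: lattes_def)

context place_over
begin

text \<open>The reduced form R / S of a composite is never known explicitly. From A S = R B, the
  pairs (R(m), S(m)) and (A(m), B(m)) are proportional, so an integer value pair that is not
  divisible by p already gives the image point. The degree inequality passes to R and S and fixes
  infinity.\<close>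

lemma reduced_map_via_integers:
  fixes f :: "'a poly fract"
  assumes gr: "good_reduction P f" and f: "f = Fraction_Field.Fract A B"
    and B: "B \<noteq> 0" "Polynomial.degree B < Polynomial.degree A"
  shows "reduced_map P f (pt 1 0) = pt 1 0"
    "poly A (of_int m) = of_int x \<Longrightarrow> poly B (of_int m) = of_int y \<Longrightarrow> good x y \<Longrightarrow> reduced_map P f (pt m 1) = pt x y"
proof -
  obtain R S where nd: "num_den f = (R, S)" by fastforce
  hence lt: "lowest_terms f R S" by (simp add: num_den_eq_iff)
  hence S: "S \<noteq> 0" by (auto simp: lowest_terms_def)
  have "Fraction_Field.Fract A B = Fraction_Field.Fract R S" using lt f by (simp add: lowest_terms_def)
  hence eq: "A * S = R * B" using B S by (simp add: Fraction_Field.eq_fract)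
  have A: "A \<noteq> 0" using B by auto
  hence R: "R \<noteq> 0" using eq S by auto
  have "Polynomial.degree A + Polynomial.degree S = Polynomial.degree R + Polynomial.degree B"
    using arg_cong[OF eq, of Polynomial.degree] A B S R by (simp add: degree_mult_eq)
  hence dSR: "Polynomial.degree S < Polynomial.degree R" using B by simp
  hence rd: "rat_degree f = Polynomial.degree R" by (simp add: rat_degree_def nd)
  show "reduced_map P f (pt 1 0) = pt 1 0"
  proof -
    have "Polynomial.coeff S (Polynomial.degree R) = 0" using dSR by (rule coeff_eq_0)
    moreover have "Polynomial.lead_coeff R \<in> \<O>" using good_reductionD(1)[OF gr nd] by (simp add: O_poly_def)
    ultimately show ?thesis
      using reduced_map_infinity(1)[OF gr nd] dSR by (simp add: rd pt_def pr_inf)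
  qed
  assume xy: "poly A (of_int m) = of_int x" "poly B (of_int m) = of_int y" "good x y"
  have "poly (A * S) (of_int m) = poly (R * B) (of_int m)" unfolding eq ..
  hence e: "poly R (of_int m) * of_int y - of_int x * poly S (of_int m) = 0"
    using xy by simp
  have "reduced_map P f (pt m 1) = pr (poly R (of_int m)) (poly S (of_int m))"
    using reduced_map_finite(1)[OF gr nd, of "of_int m"] by (simp add: pt_def)
  also have "\<dots> = pr (of_int x) (of_int y)"
  proof (subst pr_eq_iff)
    show "poly R (of_int m) \<in> \<O>" "poly S (of_int m) \<in> \<O>"
      using good_reductionD(1,2)[OF gr nd] by (auto intro: poly_O)
    show "poly R (of_int m) \<notin> \<MM> \<or> poly S (of_int m) \<notin> \<MM>"
      using reduced_map_finite(2)[OF gr nd, of "of_int m"] by simp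
    show "of_int x \<notin> \<MM> \<or> of_int y \<notin> \<MM>" using xy(3) by (simp add: good_def int_M)
    show "poly R (of_int m) * of_int y - of_int x * poly S (of_int m) \<in> \<MM>" unfolding e by (rule M_0)
  qed auto
  finally show "reduced_map P f (pt m 1) = pt x y" by (simp add: pt_def)
qed

definition dup_chain :: "(int \<times> int) list \<Rightarrow> 'a set option \<Rightarrow> 'a set option" where
  "dup_chain cs = foldr (\<lambda>c. dup_map (fst c) (snd c)) cs"

lemma dup_chain_simps: "dup_chain [] z = z" "dup_chain (c # cs) z = dup_map (fst c) (snd c) (dup_chain cs z)"
  by (simp_all add: dup_chain_def)

lemma dup_chain_int_pair:
  assumes "\<And>c. c \<in> set cs \<Longrightarrow> \<not> int p dvd 2 * wdisc (fst c) (snd c)"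
  shows "good (fst (dup_int_pair cs m)) (snd (dup_int_pair cs m)) \<and>
    dup_chain cs (pt m 1) = pt (fst (dup_int_pair cs m)) (snd (dup_int_pair cs m))"
  using assms
proof (induction cs)
  case Nil
  thus ?case using good_1(1) by (simp add: dup_chain_simps)
next
  case (Cons c cs)
  obtain x y where xy: "dup_int_pair cs m = (x, y)" by fastforce
  have d: "\<not> int p dvd 2 * wdisc (fst c) (snd c)" using Cons.prems by auto
  have IH: "good x y" "dup_chain cs (pt m 1) = pt x y" using Cons by (simp_all add: xy)
  show ?case using good_dup[OF d IH(1)] dup_map[OF d IH(1)] IH(2) by (simp add: xy dup_chain_simps)
qed

lemma dup_chain_inf:
  assumes "\<And>c. c \<in> set cs \<Longrightarrow> \<not> int p dvd 2 * wdisc (fst c) (snd c)"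
  shows "dup_chain cs (pt 1 0) = pt 1 0"
  using assms
proof (induction cs)
  case (Cons c cs)
  have "\<not> int p dvd 2 * wdisc (fst c) (snd c)" using Cons.prems by auto
  from dup_map[OF this good_1(2)] show ?case using Cons by (simp add: dup_chain_simps dup_defs)
qed (simp add: dup_chain_simps)

lemma dup_chain_prime_points:
  assumes "\<And>c. c \<in> set cs \<Longrightarrow> \<not> int p dvd 2 * wdisc (fst c) (snd c)" "z \<in> prime_points"
  shows "dup_chain cs z \<in> prime_points"
  using assms(1)
proof (induction cs)
  case (Cons c cs)
  have "\<not> int p dvd 2 * wdisc (fst c) (snd c)" using Cons.prems by auto
  thus ?case using Cons dup_map_prime_points by (simp add: dup_chain_simps)
qed (simp add: dup_chain_simps assms(2))

text \<open>Injectivity of a composite makes the inner part injective, hence a permutation of the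
  finite set of prime points. The outer map is then injective on the whole set.\<close>

lemma dup_chain_inj_imp:
  assumes "\<And>c. c \<in> set cs \<Longrightarrow> \<not> int p dvd 2 * wdisc (fst c) (snd c)" "inj_on (dup_chain cs) prime_points" "c \<in> set cs"
  shows "inj_on (dup_map (fst c) (snd c)) prime_points"
  using assms
proof (induction cs)
  case (Cons c' cs)
  have eq: "dup_chain (c' # cs) = dup_map (fst c') (snd c') \<circ> dup_chain cs"
    by (rule ext) (simp add: dup_chain_simps)
  have inj: "inj_on (dup_chain cs) prime_points"
    using Cons.prems(2) unfolding eq by (rule inj_on_imageI2)
  have "dup_chain cs ` prime_points \<subseteq> prime_points" using Cons.prems(1) dup_chain_prime_points by auto
  hence "dup_chain cs ` prime_points = prime_points" by (rule endo_inj_surj[OF finite_prime_points _ inj])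
  hence "inj_on (dup_map (fst c') (snd c')) prime_points"
    using Cons.prems(2) unfolding eq by (metis comp_inj_on_iff inj)
  thus ?case using Cons inj by auto
qed simp

theorem lattes_chain_not_inj:
  assumes disc: "\<And>c. c \<in> set cs \<Longrightarrow> \<not> int p dvd 2 * wdisc (fst c) (snd c)"
    and gr: "good_reduction P (lattes_chain cs)"
    and c: "c \<in> set cs" and e: "int p dvd wcubic (fst c) (snd c) e 1"
  shows "\<not> inj_on (reduced_map P (lattes_chain cs)) (proj_line F)"
proof
  assume inj: "inj_on (reduced_map P (lattes_chain cs)) (proj_line F)"
  have "wdisc (fst c) (snd c) \<noteq> 0" if "c \<in> set cs" for c using disc[OF that] by auto
  note eq = lattes_chain_eq[OF this, where 'k = 'a]
  note red = reduced_map_via_integers[OF gr eq, OF _ degree_dup_poly_pair[THEN conjunct1] degree_dup_poly_pair[THEN conjunct2]]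
  have "reduced_map P (lattes_chain cs) z = dup_chain cs z" if "z \<in> prime_points" for z
    using that
  proof (cases rule: prime_points_cases)
    case 1
    thus ?thesis using red(1) dup_chain_inf[OF disc] by simp
  next
    case (2 m)
    show ?thesis
      using red(2)[OF _ poly_dup_poly_pair[THEN conjunct1] poly_dup_poly_pair[THEN conjunct2]] dup_chain_int_pair[OF disc]
      unfolding 2 by simp
  qed
  moreover have "inj_on (reduced_map P (lattes_chain cs)) prime_points" using inj prime_points_subset by (rule inj_on_subset)
  ultimately have "inj_on (dup_chain cs) prime_points" by (simp cong: inj_on_cong)
  hence "inj_on (dup_map (fst c) (snd c)) prime_points" using dup_chain_inj_imp[OF disc] c by blast
  thus False using dup_map_not_inj[OF disc[OF c] e] by blast
qed

end

section \<open>Products of two Gauss sums and primes with nontrivial Frobenius\<close>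

lemma cubic_frob_mult:
  assumes "cubic_frob p x s" "cubic_frob p y t" "algebraic_int x" "algebraic_int y"
  shows "cubic_frob p (x * y) (s + t)"
proof (cases "[p = 1] (mod 3)")
  case True
  have "acong p (x ^ p * y ^ p) ((omega ^ (2 * s) * x) * (omega ^ (2 * t) * y))"
    using assms True by (intro acong_mult algebraic_int_intros algebraic_int_omega) (simp_all add: cubic_frob_def)
  thus ?thesis using True by (simp add: cubic_frob_def power_mult_distrib power_add distrib_left mult_ac)
next
  case False
  have "acong p (x ^ p * y ^ p) ((omega ^ s * cnj x) * (omega ^ t * cnj y))"
    using assms False by (intro acong_mult algebraic_int_intros algebraic_int_omega algebraic_int_cnj) (simp_all add: cubic_frob_def)
  thus ?thesis using False by (simp add: cubic_frob_def power_mult_distrib power_add mult_ac)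
qed

lemma cubic_frob_power:
  assumes "cubic_frob p x s" "algebraic_int x"
  shows "cubic_frob p (x ^ i) (i * s)"
proof (induction i)
  case 0
  show ?case by (simp add: cubic_frob_def)
next
  case (Suc i)
  show ?case using cubic_frob_mult[OF assms(1) Suc assms(2)] assms(2) by (simp add: algebraic_int_power)
qed

text \<open>Used to exclude b = 0, the case of vanishing discriminant: then N^3 = a^2, against the
  odd valuation of N at l.\<close>

lemma cube_not_square:
  assumes l: "prime (l :: nat)" and odd: "odd (multiplicity l N)" and N: "N > 0"
  shows "int N ^ 3 \<noteq> a ^ 2"
proof
  assume "int N ^ 3 = a ^ 2"
  hence "int (N ^ 3) = int (nat \<bar>a\<bar> ^ 2)" by simp
  hence eq: "N ^ 3 = nat \<bar>a\<bar> ^ 2" by (simp only: of_nat_eq_iff)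
  hence "nat \<bar>a\<bar> \<noteq> 0" using N by auto
  have "3 * multiplicity l N = 2 * multiplicity l (nat \<bar>a\<bar>)"
    using arg_cong[OF eq, of "multiplicity l"] l N \<open>nat \<bar>a\<bar> \<noteq> 0\<close>
    by (simp add: prime_elem_multiplicity_power_distrib)
  thus False using odd by presburger
qed

text \<open>The second equation is the norm of gamma^3 = a + b omega. By it the first becomes minus
  the square of the 9 b in \<open>cubic_disc\<close>, since \<open>wdisc\<close> is minus the
  discriminant of the cubic.\<close>

lemma (in cubic_resolvent) discriminant:
  "wdisc (- 3 * int N) (b - 2 * a) = - 81 * b ^ 2"
  "int N ^ 3 = a ^ 2 - a * b + b ^ 2"
proof -
  have "of_int (int N ^ 3) = (\<gamma> * cnj \<gamma>) ^ 3" by (simp add: norm)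
  also have "\<dots> = (of_int a + of_int b * omega) * (of_int a + of_int b * omega\<^sup>2)"
    by (simp add: power_mult_distrib cube cnj_cube)
  also have "\<dots> = of_int a ^ 2 + of_int a * of_int b * (omega + omega\<^sup>2) + of_int b ^ 2 * omega ^ 3"
    by (simp add: algebra_simps power2_eq_square power3_eq_cube)
  also have "\<dots> = of_int (a ^ 2 - a * b + b ^ 2)"
    unfolding omega_cube omega_sq by simp
  finally show *: "int N ^ 3 = a ^ 2 - a * b + b ^ 2" by (simp only: of_int_eq_iff)
  have "wdisc (- 3 * int N) (b - 2 * a) = - 108 * int N ^ 3 + 27 * (b - 2 * a) ^ 2"
    by (simp add: wdisc_def power_mult_distrib)
  thus "wdisc (- 3 * int N) (b - 2 * a) = - 81 * b ^ 2"
    unfolding * by (simp add: algebra_simps power2_eq_square)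
qed

lemma (in cubic_resolvent) \<Phi>_wcubic: "\<Phi> x = wcubic (- 3 * int N) (b - 2 * a) x 1"
  by (simp add: \<Phi>_def wcubic_def)

context cubic_gauss_sum
begin

lemma l_not_dvd: "\<not> int l dvd 1" "\<not> int l dvd - 1"
  using l_pos by auto

lemma ind_1: "[ind 1 = 0] (mod 3)"
  using ind_mult[OF l_not_dvd(1) l_not_dvd(1)] by (simp add: cong_def) presburger

lemma ind_minus: "\<not> int l dvd a \<Longrightarrow> [ind (- a) = ind a] (mod 3)"
proof -
  assume a: "\<not> int l dvd a"
  have "[ind (- 1) + ind (- 1) = 0] (mod 3)"
    using ind_mult[OF l_not_dvd(2) l_not_dvd(2)] ind_1 by (simp add: cong_def)
  hence "[ind (- 1) = 0] (mod 3)" by (simp add: cong_def) presburger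
  from cong_trans[OF ind_mult[OF l_not_dvd(2) a] cong_add[OF this cong_refl]] show ?thesis by simp
qed

end

locale two_cubic_gauss_sums =
  g1: cubic_gauss_sum l1 r1 + g2: cubic_gauss_sum l2 r2 for l1 r1 l2 r2 +
  assumes l12: "l1 \<noteq> l2"
begin

text \<open>At a prime a this is the Frobenius shift of the product g1^i g2^j.\<close>

definition symb :: "nat \<Rightarrow> nat \<Rightarrow> int \<Rightarrow> nat" where
  "symb i j a = i * g1.ind a + j * g2.ind a"

text \<open>Applies the resolvent to gamma = g1^i g2^j, of absolute square l1^i l2^j. An odd
  exponent makes this an integer whose cube is not a square, so the discriminant is nonzero.\<close>

lemma cubic_with_frobenius:
  assumes ij: "odd i \<or> odd j"
  obtains b :: int where
    "wdisc (- 3 * int (l1 ^ i * l2 ^ j)) b \<noteq> 0"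
    "\<And>p. prime p \<Longrightarrow> p \<notin> {3, l1, l2} \<Longrightarrow> 3 dvd symb i j (int p) \<Longrightarrow>
       \<exists>x. int p dvd wcubic (- 3 * int (l1 ^ i * l2 ^ j)) b x 1"
    "\<And>p x. prime p \<Longrightarrow> p \<notin> {3, l1, l2} \<Longrightarrow> \<not> 3 dvd symb i j (int p) \<Longrightarrow>
       \<not> int p dvd wdisc (- 3 * int (l1 ^ i * l2 ^ j)) b \<Longrightarrow> \<not> int p dvd wcubic (- 3 * int (l1 ^ i * l2 ^ j)) b x 1"
proof -
  define \<gamma> where "\<gamma> = g1.g ^ i * g2.g ^ j"
  define N where "N = l1 ^ i * l2 ^ j"
  have alg: "algebraic_int \<gamma>"
    unfolding \<gamma>_def by (intro algebraic_int_intros g1.algebraic_int_gauss g2.algebraic_int_gauss)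
  have "\<gamma> ^ 3 = (g1.g ^ 3) ^ i * (g2.g ^ 3) ^ j"
    by (simp add: \<gamma>_def power_mult_distrib flip: power_mult) (simp add: mult.commute)
  hence "\<gamma> ^ 3 \<in> eisenstein"
    using g1.gauss_cube g2.gauss_cube by (auto intro: eisenstein_mult eisenstein_power)
  then obtain a b where cube: "\<gamma> ^ 3 = of_int a + of_int b * omega" unfolding eisenstein_def by blast
  have "\<gamma> * cnj \<gamma> = (g1.g * cnj g1.g) ^ i * (g2.g * cnj g2.g) ^ j"
    by (simp add: \<gamma>_def power_mult_distrib mult_ac)
  also have "\<dots> = of_nat N" unfolding g1.gauss_norm g2.gauss_norm by (simp add: N_def)
  finally have norm: "\<gamma> * cnj \<gamma> = of_nat N" .
  interpret cubic_resolvent \<gamma> a b N by unfold_locales (fact alg cube norm)+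
  have N0: "N > 0" using g1.l_pos g2.l_pos by (simp add: N_def)
  have "multiplicity l1 l2 = 0" "multiplicity l2 l1 = 0"
    using g1.l g2.l l12 primes_dvd_imp_eq by (auto intro!: not_dvd_imp_multiplicity_0)
  hence mult: "multiplicity l1 N = i" "multiplicity l2 N = j"
    using g1.l g2.l g1.l_pos g2.l_pos unfolding N_def
    by (simp_all add: prime_elem_multiplicity_mult_distrib prime_elem_multiplicity_power_distrib)
  have b0: "b \<noteq> 0"
  proof
    assume "b = 0"
    hence "int N ^ 3 = a ^ 2" using discriminant(2) by simp
    thus False using ij cube_not_square[OF g1.l, of N a] cube_not_square[OF g2.l, of N a] mult N0 by auto
  qed
  have frob: "cubic_frob p \<gamma> (symb i j (int p))" if p: "prime p" "p \<notin> {3, l1, l2}" for p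
    unfolding \<gamma>_def symb_def using p
    by (intro cubic_frob_mult cubic_frob_power g1.gauss_frob g2.gauss_frob algebraic_int_power
        g1.algebraic_int_gauss g2.algebraic_int_gauss) auto
  show ?thesis
  proof (rule that[of "b - 2 * a"], unfold N_def[symmetric])
    show "wdisc (- 3 * int N) (b - 2 * a) \<noteq> 0" unfolding discriminant using b0 by simp
    show "\<exists>x. int p dvd wcubic (- 3 * int N) (b - 2 * a) x 1"
      if "prime p" "p \<notin> {3, l1, l2}" "3 dvd symb i j (int p)" for p
      using root_if_frob_trivial[OF that(1) _ frob[OF that(1,2)] that(3)] that(2) by (simp add: \<Phi>_wcubic)
    show "\<not> int p dvd wcubic (- 3 * int N) (b - 2 * a) x 1"
      if "prime p" "p \<notin> {3, l1, l2}" "\<not> 3 dvd symb i j (int p)" "\<not> int p dvd wdisc (- 3 * int N) (b - 2 * a)" for p x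
    proof -
      have "\<not> int p dvd b" using that(4) unfolding discriminant by (auto simp: power2_eq_square)
      thus ?thesis
        using no_root_if_frob_nontrivial[OF that(1) _ frob[OF that(1,2)] that(3)] that(2) by (simp add: \<Phi>_wcubic)
    qed
  qed
qed

lemma symb_mult:
  assumes "\<not> int l1 dvd a" "\<not> int l2 dvd a" "\<not> int l1 dvd b" "\<not> int l2 dvd b"
  shows "[symb i j (a * b) = symb i j a + symb i j b] (mod 3)"
proof -
  have "[i * g1.ind (a * b) + j * g2.ind (a * b) = i * (g1.ind a + g1.ind b) + j * (g2.ind a + g2.ind b)] (mod 3)"
    using assms by (intro cong_add cong_scalar_left g1.ind_mult g2.ind_mult)
  thus ?thesis by (simp add: symb_def algebra_simps)
qed

lemma symb_nontrivial_prime: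
  assumes "n > 0" "\<not> l1 dvd n" "\<not> l2 dvd n" "\<not> 3 dvd symb i j (int n)"
  shows "\<exists>p. prime p \<and> p dvd n \<and> \<not> 3 dvd symb i j (int p)"
  using assms
proof (induction n rule: less_induct)
  case (less n)
  have "n \<noteq> 1"
  proof
    assume "n = 1"
    moreover have "[symb i j 1 = i * 0 + j * 0] (mod 3)"
      unfolding symb_def by (intro cong_add cong_scalar_left g1.ind_1 g2.ind_1)
    ultimately show False using less.prems(4) by (simp add: cong_0_iff)
  qed
  then obtain p where p: "prime p" "p dvd n" using prime_factor_nat by blast
  then obtain m where m: "n = p * m" by blast
  show ?case
  proof (cases "3 dvd symb i j (int p)")
    case True
    have nd: "\<not> l1 dvd p" "\<not> l2 dvd p" "\<not> l1 dvd m" "\<not> l2 dvd m" using less.prems(2,3) m by auto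
    have "[symb i j (int p * int m) = symb i j (int p) + symb i j (int m)] (mod 3)"
      using nd by (intro symb_mult) simp_all
    hence "\<not> 3 dvd symb i j (int p) + symb i j (int m)"
      using less.prems(4) by (metis cong_dvd_iff m of_nat_mult)
    hence "\<not> 3 dvd symb i j (int m)" using True by (metis dvd_add)
    moreover have "m < n" "m > 0" using m less.prems(1) prime_gt_1_nat[OF p(1)] by (auto intro: Nat.gr0I)
    ultimately obtain q where "prime q" "q dvd m" "\<not> 3 dvd symb i j (int q)" using less.IH nd by blast
    thus ?thesis using m by (metis dvd_mult)
  qed (use p in blast)
qed

text \<open>The value G(t) = l1 G(0) M is arranged so that M = 1 / l1 modulo l2 and modulo m0, the
  part of m prime to l1. This fixes the index of M modulo l2 and keeps its prime factors away from
  m, while the index modulo l1 remains free. The first index is chosen to make the symbol of M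
  nonzero, and a prime factor of M inherits this.\<close>

lemma exceptional_prime:
  fixes G :: "int poly"
  assumes G0: "poly G 0 \<noteq> 0" and t: "int l1 dvd poly G t1" "\<not> int l1 dvd poly (pderiv G) t1" "\<not> int l1 dvd poly G 0"
    and i: "\<not> 3 dvd i" and m: "m \<noteq> 0"
  obtains p t where "prime p" "\<not> int p dvd m" "p \<noteq> l1" "p \<noteq> l2" "int p dvd poly G t" "\<not> 3 dvd symb i j (int p)"
proof -
  have pl1: "prime (int l1)" using g1.l by simp
  have "\<not> is_unit (int l1)" using pl1 by (metis not_prime_unit)
  then obtain k m0 where m0: "m = int l1 ^ k * m0" "\<not> int l1 dvd m0"
    using multiplicity_decompose'[OF m] by metis
  have "\<not> l1 dvd l2" "\<not> l2 dvd l1" using g1.l g2.l l12 primes_dvd_imp_eq by auto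
  hence nd: "\<not> int l1 dvd int l2" "\<not> int l2 dvd int l1" by simp_all
  have "\<not> int l1 dvd m0 * int l2" using m0(2) nd by (simp add: prime_dvd_mult_iff[OF pl1])
  from prime_imp_coprime[OF pl1 this] have cop: "coprime (m0 * int l2) (int l1)" by (simp only: coprime_commute)
  \<comment> \<open>The factor 2 is -1 modulo 3: since l1 M = 1 modulo l2, this is the index of M
    there.\<close>
  define k2 where "k2 = 2 * g2.ind (int l1)"
  \<comment> \<open>Since 3 does not divide i, one of the values 0 and 1 avoids i d + j k2 = 0
    modulo 3.\<close>
  define d :: nat where "d = (if 3 dvd j * k2 then 1 else 0)"
  have d: "\<not> 3 dvd i * d + j * k2" using i unfolding d_def by (auto simp: dvd_add_left_iff)
  obtain r where r: "\<not> int l1 dvd r" "[g1.ind r = d] (mod 3)" using g1.ind_surj by blast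
  obtain t M where tM: "poly G t = int l1 * poly G 0 * M" "[M = r] (mod int l1)" "[int l1 * M = 1] (mod (m0 * int l2))"
    using poly_value_prescribed[OF G0 g1.l t(1,2,3) cop] .
  have M1: "\<not> int l1 dvd M" using tM(2) r(1) cong_dvd_iff by blast
  have no_common: "\<not> int p dvd m0 * int l2" if "prime p" "int p dvd M" for p
  proof
    assume "int p dvd m0 * int l2"
    hence "int p dvd int l1 * M - 1" using tM(3) dvd_trans by (auto simp: cong_iff_dvd_diff)
    hence "int p dvd 1" using that(2) by (metis dvd_diff_right_iff dvd_mult)
    thus False using prime_gt_1_nat[OF that(1)] by simp
  qed
  have M2: "\<not> int l2 dvd M" using no_common[OF g2.l] by auto
  have "[int l1 * M = 1] (mod int l2)" using tM(3) cong_modulus_mult by (metis mult.commute)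
  hence "[g2.ind 1 = g2.ind (int l1 * M)] (mod 3)"
    using g2.ind_cong[OF g2.l_not_dvd(1)] cong_sym by blast
  hence "[g2.ind (int l1) + g2.ind M = 0] (mod 3)"
    using g2.ind_mult[OF nd(2) M2] g2.ind_1 by (metis cong_sym cong_trans)
  hence "[g2.ind M = k2] (mod 3)" unfolding k2_def cong_def by presburger
  moreover have "[g1.ind M = d] (mod 3)" using g1.ind_cong[OF M1 tM(2)] r(2) by (rule cong_trans)
  ultimately have "[symb i j M = i * d + j * k2] (mod 3)"
    unfolding symb_def by (intro cong_add cong_scalar_left)
  hence sM: "\<not> 3 dvd symb i j M" using d cong_dvd_iff by blast
  \<comment> \<open>M may be negative, but prime factors are sought for its absolute value; -1 is a
    cube modulo l1 and l2, so the sign leaves the symbol unchanged.\<close>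
  have "[symb i j (- M) = symb i j M] (mod 3)"
    unfolding symb_def by (intro cong_add cong_scalar_left g1.ind_minus[OF M1] g2.ind_minus[OF M2])
  hence sM': "\<not> 3 dvd symb i j (- M)" using sM cong_dvd_iff by blast
  define n where "n = nat \<bar>M\<bar>"
  have n: "int n = M \<or> int n = - M" by (auto simp: n_def)
  have "M \<noteq> 0" using M1 by auto
  hence "n > 0" by (simp add: n_def)
  moreover have dvd_n: "int q dvd M \<longleftrightarrow> q dvd n" for q
    using n by (metis dvd_minus_iff int_dvd_int_iff)
  ultimately obtain p where p: "prime p" "p dvd n" "\<not> 3 dvd symb i j (int p)"
    using symb_nontrivial_prime[of n i j] M1 M2 n sM sM' by metis
  have pM: "int p dvd M" using p(2) dvd_n by blast
  have "p \<noteq> l1" using pM M1 by auto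
  moreover have "p \<noteq> l2" using pM M2 by auto
  moreover have "\<not> int p dvd m"
  proof
    assume "int p dvd m"
    hence "int p dvd int l1 ^ k \<or> int p dvd m0" using p(1) m0(1) prime_dvd_mult_iff[of "int p"] by auto
    thus False
    proof
      assume "int p dvd int l1 ^ k"
      hence "p dvd l1 ^ k" by (metis int_dvd_int_iff of_nat_power)
      hence "p dvd l1" by (rule prime_dvd_power[OF p(1)])
      thus False using \<open>p \<noteq> l1\<close> p(1) g1.l primes_dvd_imp_eq by blast
    next
      assume "int p dvd m0"
      thus False using no_common[OF p(1) pM] by simp
    qed
  qed
  moreover have "int p dvd poly G t" unfolding tM(1) using pM by simp
  ultimately show ?thesis using that p(1,3) by blast
qed

end

text \<open>Euclid's argument: if only finitely many places were good, choose a rational prime below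
  each of them and apply the hypothesis with a multiple of their product. The place obtained is good
  too, yet its prime divides none of those chosen.\<close>

lemma arithmetically_exceptional_lattes:
  assumes disc: "wdisc a b \<noteq> 0"
    and pl: "\<And>m. m \<noteq> 0 \<Longrightarrow> \<exists>p P. prime p \<and> \<not> int p dvd m \<and> place_ideal (P :: 'k set) \<and> of_nat p \<in> P \<and>
        (\<forall>c. algebraic_int c \<longrightarrow> (\<exists>n. c - of_int n \<in> P)) \<and>
        (\<not> int p dvd wdisc a b \<longrightarrow> (\<forall>e. \<not> int p dvd wcubic a b e 1))"
  shows "arithmetically_exceptional (lattes a b :: 'k::field_char_0 poly fract)"
  unfolding arithmetically_exceptional_def
proof
  let ?f = "lattes a b :: 'k poly fract"
  define S where "S = {P \<in> finite_places. good_reduction P ?f \<and>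
    bij_betw (reduced_map P ?f) (proj_line (residue_field P)) (proj_line (residue_field P))}"
  assume "finite {P \<in> finite_places. good_reduction P ?f \<and>
    bij_betw (reduced_map P ?f) (proj_line (residue_field P)) (proj_line (residue_field P))}"
  hence fin: "finite S" unfolding S_def .
  have "\<forall>P\<in>S. \<exists>q. prime q \<and> of_nat q \<in> P"
  proof
    fix P assume "P \<in> S"
    hence "place_ideal P" by (simp add: S_def finite_places_iff)
    then obtain q where "prime q" "of_nat q \<in> P" by (rule place_rational_prime)
    thus "\<exists>q. prime q \<and> of_nat q \<in> P" by blast
  qed
  from bchoice[OF this] obtain q where q: "\<And>P. P \<in> S \<Longrightarrow> prime (q P) \<and> of_nat (q P) \<in> P" by blast
  have "int (q P) \<noteq> 0" if "P \<in> S" for P using q[OF that] prime_gt_0_nat[of "q P"] by simp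
  hence "(\<Prod>P\<in>S. int (q P)) \<noteq> 0" unfolding prod_zero_iff[OF fin] by (intro notI, elim bexE) (rule notE)
  hence "2 * wdisc a b * (\<Prod>P\<in>S. int (q P)) \<noteq> 0" using disc by simp
  from pl[OF this] obtain p and P :: "'k set" where p: "prime p" "\<not> int p dvd 2 * wdisc a b * (\<Prod>P\<in>S. int (q P))"
    "place_ideal P" "of_nat p \<in> P" "\<forall>c. algebraic_int c \<longrightarrow> (\<exists>n. c - of_int n \<in> P)"
    "\<not> int p dvd wdisc a b \<longrightarrow> (\<forall>e. \<not> int p dvd wcubic a b e 1)" by blast
  interpret pl: place_over P p by unfold_locales (use p in auto)
  have d: "\<not> int p dvd 2 * wdisc a b" using p(2) by (metis dvd_mult2)
  hence "\<not> int p dvd wdisc a b" by (metis dvd_mult)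
  hence "\<not> int p dvd wcubic a b e 1" for e using p(6) by blast
  hence "P \<in> S"
    unfolding S_def using pl.good_reduction_lattes[OF d] pl.lattes_bij[OF d _ p(5)[rule_format]] p(3) by (simp add: finite_places_iff)
  hence "int p dvd int (q P)" using place_of_int_iff[OF p(3,1,4), of "int (q P)"] q by simp
  also have "int (q P) dvd (\<Prod>P\<in>S. int (q P))" using fin \<open>P \<in> S\<close> by (rule dvd_prodI)
  finally show False using p(2) by (metis dvd_mult)
qed

theorem theorem1p6:
  assumes "number_field TYPE('k::field_char_0)"
  shows "\<exists>f1 f2 f3 f4 :: 'k poly fract.
    distinct [f1, f2, f3, f4] \<and>
    (\<forall>f \<in> {f1, f2, f3, f4}. rat_degree f = 4 \<and> arithmetically_exceptional f) \<and>
    \<not> arithmetically_exceptional (f1 \<circ>\<^sub>r f2 \<circ>\<^sub>r f3 \<circ>\<^sub>r f4)"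
proof -
  obtain G :: "int poly" and D :: int where D: "D \<noteq> 0" and G: "Polynomial.degree G > 0" "poly G 0 \<noteq> 0"
    and GD: "\<And>p t. prime p \<Longrightarrow> \<not> int p dvd D \<Longrightarrow> int p dvd poly G t \<Longrightarrow>
       p mod 3 = 1 \<and> \<not> int p dvd poly (pderiv G) t \<and>
       (\<exists>P :: 'k set. place_ideal P \<and> of_nat p \<in> P \<and> (\<forall>a. algebraic_int a \<longrightarrow> (\<exists>m. a - of_int m \<in> P)))"
    using degree_one_places[OF assms] by metis
  have "D * poly G 0 \<noteq> 0" using D G by simp
  \<comment> \<open>Avoiding D makes l1 = 1 modulo 3 and t1 a simple root; avoiding G(0) is needed
    because \<open>poly_value_prescribed\<close> inverts it modulo l1.\<close>
  then obtain l1 t1 where l1: "prime l1" "\<not> int l1 dvd D * poly G 0" "int l1 dvd poly G t1"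
    using prime_dividing_value_avoiding[OF G] by metis
  have "D * poly G 0 * int l1 \<noteq> 0" using D G prime_gt_0_nat[OF l1(1)] by simp
  then obtain l2 t2 where l2: "prime l2" "\<not> int l2 dvd D * poly G 0 * int l1" "int l2 dvd poly G t2"
    using prime_dividing_value_avoiding[OF G] by metis
  have nd: "\<not> int l1 dvd D" "\<not> int l1 dvd poly G 0" "\<not> int l2 dvd D" "\<not> int l2 dvd poly G 0" "l1 \<noteq> l2"
    using l1(2) l2(2) by auto
  note G1 = GD[OF l1(1) nd(1) l1(3)] and G2 = GD[OF l2(1) nd(3) l2(3)]
  obtain r1 where r1: "residue_primroot l1 r1" using prime_primitive_root_exists[of l1] l1(1) prime_gt_1_nat by blast
  obtain r2 where r2: "residue_primroot l2 r2" using prime_primitive_root_exists[of l2] l2(1) prime_gt_1_nat by blast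
  interpret A: two_cubic_gauss_sums l1 r1 l2 r2
    by unfold_locales (use l1(1) l2(1) G1 G2 r1 r2 nd(5) in \<open>simp_all add: cong_def\<close>)
  \<comment> \<open>In \<open>exceptional_prime\<close> the first exponent must be prime to 3; for
    exponents such as (0, 1) the two primes change roles.\<close>
  interpret B: two_cubic_gauss_sums l2 r2 l1 r1
    by unfold_locales (use nd(5) in simp)
  have BA: "B.symb j i x = A.symb i j x" for i j x
    by (simp add: A.symb_def B.symb_def add.commute)
  have exc: "\<exists>p t. prime p \<and> \<not> int p dvd m \<and> p \<noteq> l1 \<and> p \<noteq> l2 \<and> int p dvd poly G t \<and> \<not> 3 dvd A.symb i j (int p)"
    if "\<not> 3 dvd i \<or> \<not> 3 dvd j" "m \<noteq> 0" for i j m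
    using that(1)
  proof
    assume "\<not> 3 dvd i"
    thus ?thesis using A.exceptional_prime[OF G(2) l1(3) _ nd(2), of i m j] G1 that(2) by metis
  next
    assume "\<not> 3 dvd j"
    thus ?thesis using B.exceptional_prime[OF G(2) l2(3) _ nd(4), of j m i] G2 that(2) unfolding BA by metis
  qed
  define N where "N = (\<lambda>(i, j). - 3 * int (l1 ^ i * l2 ^ j))"
  have "\<exists>b. wdisc (N (i, j)) b \<noteq> 0 \<and>
      (\<forall>p. prime p \<longrightarrow> p \<notin> {3, l1, l2} \<longrightarrow> 3 dvd A.symb i j (int p) \<longrightarrow> (\<exists>x. int p dvd wcubic (N (i, j)) b x 1)) \<and>
      (\<forall>p x. prime p \<longrightarrow> p \<notin> {3, l1, l2} \<longrightarrow> \<not> 3 dvd A.symb i j (int p) \<longrightarrow>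
         \<not> int p dvd wdisc (N (i, j)) b \<longrightarrow> \<not> int p dvd wcubic (N (i, j)) b x 1)"
    if "odd i \<or> odd j" for i j
    using A.cubic_with_frobenius[OF that] unfolding N_def prod.case by metis
  then obtain b where disc: "\<And>i j. odd i \<or> odd j \<Longrightarrow> wdisc (N (i, j)) (b i j) \<noteq> 0"
    and root: "\<And>i j p. odd i \<or> odd j \<Longrightarrow> prime p \<Longrightarrow> p \<notin> {3, l1, l2} \<Longrightarrow> 3 dvd A.symb i j (int p) \<Longrightarrow>
      \<exists>x. int p dvd wcubic (N (i, j)) (b i j) x 1"
    and noroot: "\<And>i j p x. odd i \<or> odd j \<Longrightarrow> prime p \<Longrightarrow> p \<notin> {3, l1, l2} \<Longrightarrow> \<not> 3 dvd A.symb i j (int p) \<Longrightarrow>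
      \<not> int p dvd wdisc (N (i, j)) (b i j) \<Longrightarrow> \<not> int p dvd wcubic (N (i, j)) (b i j) x 1"
    by metis
  define f where "f = (\<lambda>i j. lattes (N (i, j)) (b i j) :: 'k poly fract)"
  have ae: "arithmetically_exceptional (f i j)" if ij: "odd i \<or> odd j" "\<not> 3 dvd i \<or> \<not> 3 dvd j" for i j
    unfolding f_def
  proof (rule arithmetically_exceptional_lattes[OF disc[OF ij(1)]])
    fix m :: int assume "m \<noteq> 0"
    hence "3 * D * m \<noteq> 0" using D by simp
    from exc[OF ij(2) this] obtain p t where p: "prime p" "\<not> int p dvd 3 * D * m" "p \<noteq> l1" "p \<noteq> l2"
      "int p dvd poly G t" "\<not> 3 dvd A.symb i j (int p)" by blast
    have pd: "\<not> int p dvd D" "\<not> int p dvd m" "p \<noteq> 3" using p(2) by auto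
    obtain P :: "'k set" where P: "place_ideal P" "of_nat p \<in> P" "\<forall>a. algebraic_int a \<longrightarrow> (\<exists>m. a - of_int m \<in> P)"
      using GD[OF p(1) pd(1) p(5)] by blast
    have "\<not> int p dvd wdisc (N (i, j)) (b i j) \<longrightarrow> (\<forall>e. \<not> int p dvd wcubic (N (i, j)) (b i j) e 1)"
      using noroot[OF ij(1) p(1) _ p(6)] p(3,4) pd(3) by blast
    thus "\<exists>p P. prime p \<and> \<not> int p dvd m \<and> place_ideal (P :: 'k set) \<and> of_nat p \<in> P \<and>
        (\<forall>c. algebraic_int c \<longrightarrow> (\<exists>n. c - of_int n \<in> P)) \<and>
        (\<not> int p dvd wdisc (N (i, j)) (b i j) \<longrightarrow> (\<forall>e. \<not> int p dvd wcubic (N (i, j)) (b i j) e 1))"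
      using p(1) pd(2) P by blast
  qed
  have deg: "rat_degree (f i j) = 4" if "odd i \<or> odd j" for i j
    unfolding f_def by (rule rat_degree_lattes[OF disc[OF that]])
  have inj: "l1 ^ i * l2 ^ j = l1 ^ i' * l2 ^ j'" if "odd i \<or> odd j" "odd i' \<or> odd j'" "f i j = f i' j'" for i j i' j'
    using lattes_eq_imp[OF disc[OF that(1)] disc[OF that(2)]] that(3) unfolding f_def N_def prod.case
    by (metis mult_cancel_left of_nat_eq_iff neg_equal_0_iff_equal zero_neq_numeral)
  \<comment> \<open>One exponent vector for each point of the projective line over Z/3, chosen with
    an odd entry as \<open>cubic_with_frobenius\<close> requires.\<close>
  define cs where "cs = [(N (1, 0), b 1 0), (N (0, 1), b 0 1), (N (1, 1), b 1 1), (N (2, 1), b 2 1)]"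
  have chain: "f 1 0 \<circ>\<^sub>r f 0 1 \<circ>\<^sub>r f 1 1 \<circ>\<^sub>r f 2 1 = lattes_chain cs"
    using disc[of 2 1] by (simp add: cs_def f_def lattes_compose_X)
  have "\<not> arithmetically_exceptional (lattes_chain cs :: 'k poly fract)"
  proof -
    define m where "m = 6 * int l1 * int l2 * (\<Prod>c\<leftarrow>cs. wdisc (fst c) (snd c))"
    have disc_cs: "wdisc (fst c) (snd c) \<noteq> 0" if "c \<in> set cs" for c
      using that disc by (auto simp: cs_def)
    hence m0: "m \<noteq> 0"
      using prime_gt_0_nat[OF l1(1)] prime_gt_0_nat[OF l2(1)] by (auto simp: m_def prod_list_zero_iff)
    let ?S = "{P :: 'k set. P \<in> finite_places \<and> good_reduction P (lattes_chain cs :: 'k poly fract) \<and>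
      bij_betw (reduced_map P (lattes_chain cs)) (proj_line (residue_field P)) (proj_line (residue_field P))}"
    \<comment> \<open>Places of every residue degree must be covered here; a collision among the
      points over the prime field already destroys injectivity on the whole line.\<close>
    have "?S \<subseteq> (\<Union>p\<in>{p. prime p \<and> int p dvd m}. {P. P \<in> finite_places \<and> of_nat p \<in> P})"
    proof
      fix P assume "P \<in> ?S"
      hence P: "place_ideal P" "good_reduction P (lattes_chain cs)"
        "bij_betw (reduced_map P (lattes_chain cs)) (proj_line (residue_field P)) (proj_line (residue_field P))"
        by (auto simp: finite_places_iff)
      obtain p where p: "prime p" "of_nat p \<in> P" using place_rational_prime[OF P(1)] .
      interpret pl: place_over P p by unfold_locales (use p P in auto)
      have "int p dvd m"
      proof (rule ccontr)
        assume n: "\<not> int p dvd m"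
        have pl: "p \<notin> {3, l1, l2}" using n by (auto simp: m_def)
        have d: "\<not> int p dvd 2 * wdisc (fst c) (snd c)" if "c \<in> set cs" for c
        proof
          assume "int p dvd 2 * wdisc (fst c) (snd c)"
          moreover have "wdisc (fst c) (snd c) dvd (\<Prod>c\<leftarrow>cs. wdisc (fst c) (snd c))"
            using that by (intro prod_list_dvd) auto
          hence "2 * wdisc (fst c) (snd c) dvd 6 * int l1 * int l2 * (\<Prod>c\<leftarrow>cs. wdisc (fst c) (snd c))"
            by (intro mult_dvd_mono) (auto simp: mult.assoc)
          ultimately show False using n unfolding m_def by (metis dvd_trans)
        qed
        have "\<exists>c\<in>set cs. \<exists>e. int p dvd wcubic (fst c) (snd c) e 1"
        proof -
          let ?s = "A.g1.ind (int p)" and ?t = "A.g2.ind (int p)"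
          have "3 dvd ?s \<or> 3 dvd ?t \<or> 3 dvd ?s + ?t \<or> 3 dvd 2 * ?s + ?t" by presburger
          hence "3 dvd A.symb 1 0 (int p) \<or> 3 dvd A.symb 0 1 (int p) \<or> 3 dvd A.symb 1 1 (int p) \<or> 3 dvd A.symb 2 1 (int p)"
            by (simp add: A.symb_def)
          thus ?thesis
            using root[of 1 0 p] root[of 0 1 p] root[of 1 1 p] root[of 2 1 p] p(1) pl by (auto simp: cs_def)
        qed
        then obtain c e where "c \<in> set cs" "int p dvd wcubic (fst c) (snd c) e 1" by blast
        from pl.lattes_chain_not_inj[OF d P(2) this] P(3) show False by (simp add: bij_betw_def)
      qed
      thus "P \<in> (\<Union>p\<in>{p. prime p \<and> int p dvd m}. {P. P \<in> finite_places \<and> of_nat p \<in> P})"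
        using p P(1) by (auto simp: finite_places_iff)
    qed
    moreover have "finite {p. prime p \<and> int p dvd m}"
    proof (rule finite_subset)
      show "{p. prime p \<and> int p dvd m} \<subseteq> {..nat \<bar>m\<bar>}"
        using m0 zdvd_imp_le[of _ "\<bar>m\<bar>"] by (auto simp: le_nat_iff)
    qed simp
    ultimately have "finite ?S"
      using finite_places_over_prime[OF assms] by (elim finite_subset) (auto intro!: finite_UN_I)
    thus ?thesis unfolding arithmetically_exceptional_def by simp
  qed
  hence "\<not> arithmetically_exceptional (f 1 0 \<circ>\<^sub>r f 0 1 \<circ>\<^sub>r f 1 1 \<circ>\<^sub>r f 2 1)" unfolding chain .
  moreover have "distinct [f 1 0, f 0 1, f 1 1, f 2 1]"
  proof -
    have "l1 > 1" "l2 > 1" using prime_gt_1_nat l1(1) l2(1) by auto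
    moreover have "l1 * l1 \<noteq> 1" using \<open>l1 > 1\<close> by simp
    moreover have "l1 \<noteq> l1 * l1 * l2 \<and> l1 \<noteq> l1 * l2 \<and> l2 \<noteq> l1 * l2 \<and> l2 \<noteq> l1 * l1 * l2 \<and> l1 * l2 \<noteq> l1 * l1 * l2"
      using calculation by (simp add: mult.assoc)
    ultimately show ?thesis
      using inj[of 1 0 0 1] inj[of 1 0 1 1] inj[of 1 0 2 1] inj[of 0 1 1 1] inj[of 0 1 2 1] inj[of 1 1 2 1] nd(5)
      by (auto simp: power2_eq_square)
  qed
  moreover have "\<forall>g \<in> {f 1 0, f 0 1, f 1 1, f 2 1}. rat_degree g = 4 \<and> arithmetically_exceptional g"
    using deg ae by (auto simp: nat_dvd_not_less)
  ultimately show ?thesis by blast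
qed

end
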